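(* Let $\mathfrak g$ be a complex semisimple Lie algebra with Killing form $B$, and let $\mathfrak g=\mathfrak r\oplus\mathfrak s=\mathfrak r'\oplus\mathfrak s'$ be two decompositions, where $\mathfrak r,\mathfrak r'$ are reductive subalgebras to which $B$ restricts nondegenerately and $\mathfrak s,\mathfrak s'$ are their $B$-orthogonals. Assume the decompositions are compatible: $$\mathfrak r=\mathfrak r\cap\mathfrak r'\oplus\mathfrak r\cap\mathfrak s',\quad \mathfrak s=\mathfrak s\cap\mathfrak r'\oplus\mathfrak s\cap\mathfrak s',\quad \mathfrak r'=\mathfrak r'\cap\mathfrak r\oplus\mathfrak r'\cap\mathfrak s,\quad \mathfrak s'=\mathfrak s'\cap\mathfrak r\oplus\mathfrak s'\cap\mathfrak s.$$ Then, in $U(\mathfrak g)\otimes C(\mathfrak s\oplus(\mathfrak r\cap\mathfrak s'))=U(\mathfrak g)\otimes C(\mathfrak s)\,\bar\otimes\, C(\mathfrak r\cap\mathfrak s')$: (i) $D(\mathfrak g,\mathfrak r\cap\mathfrak r')=D(\mathfrak g,\mathfrak r)+D_\Delta(\mathfrak r,\mathfrak r\cap\mathfrak r')$; (ii) the summands $D(\mathfrak g,\mathfrak r)$ and $D_\Delta(\mathfrak r,\mathfrak r\cap\mathfrak r')$ anticommute.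
   Context: Clifford algebras $C(\cdot)$ are taken with respect to the restriction of $B$, with relations $vw+wv=2B(v,w)$; $\bar\otimes$ is the $\mathbb Z_2$-graded tensor product. Cubic Dirac operator: if $\mathfrak a$ is a reductive Lie algebra with nondegenerate invariant symmetric form $B$, $\mathfrak b\subset\mathfrak a$ a reductive subalgebra with $B|_{\mathfrak b}$ nondegenerate, and $W_1,\dots,W_m$ is a $B$-orthonormal basis of the orthogonal complement $\mathfrak b^\perp$ of $\mathfrak b$ in $\mathfrak a$, then $$D(\mathfrak a,\mathfrak b)=\sum_k W_k\otimes W_k-\tfrac12\sum_{i<j<k}B([W_i,W_j],W_k)\otimes W_iW_jW_k\in U(\mathfrak a)\otimes C(\mathfrak b^\perp).$$ For $\mathfrak a=\mathfrak r$ one uses $B|_{\mathfrak r}$; the orthogonal complement of $\mathfrak r\cap\mathfrak r'$ in $\mathfrak r$ is $\mathfrak r\cap\mathfrak s'$, and its orthogonal complement in $\mathfrak g$ is $\mathfrak s\oplus(\mathfrak r\cap\mathfrak s')$. $U(\mathfrak g)\otimes C(\mathfrak s)$ is viewed as the subalgebra $U(\mathfrak g)\otimes C(\mathfrak s)\otimes 1$; in this way $D(\mathfrak g,\mathfrak r)$ is an element of the big algebra. Diagonal embedding: let $\alpha:\mathfrak r\to\mathfrak{so}(\mathfrak s)\hookrightarrow C(\mathfrak s)$ be the adjoint action of $\mathfrak r$ on $\mathfrak s$ followed by the standard inclusion $E_{ij}-E_{ji}\mapsto\frac12 Z_iZ_j$ ($Z_i$ an orthonormal basis of $\mathfrak s$,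 $E_{ij}$ the matrix units in this basis). The map $X\mapsto X\otimes1+1\otimes\alpha(X)$ embeds $\mathfrak r$ as a Lie algebra $\mathfrak r_\Delta$ in $U(\mathfrak g)\otimes C(\mathfrak s)$ and extends to $U(\mathfrak r)\cong U(\mathfrak r_\Delta)\subset U(\mathfrak g)\otimes C(\mathfrak s)$. Together with the identity on $C(\mathfrak r\cap\mathfrak s')$ this gives $$\Delta:U(\mathfrak r)\otimes C(\mathfrak r\cap\mathfrak s')\cong U(\mathfrak r_\Delta)\bar\otimes C(\mathfrak r\cap\mathfrak s')\subset U(\mathfrak g)\otimes C(\mathfrak s)\bar\otimes C(\mathfrak r\cap\mathfrak s'),$$ and $D_\Delta(\mathfrak r,\mathfrak r\cap\mathfrak r'):=\Delta(D(\mathfrak r,\mathfrak r\cap\mathfrak r'))$. *)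

theory Defs
  imports
    Complex_Main
    "HOL-Library.Poly_Mapping"
    "HOL-Library.Z2"
    "HOL-Algebra.Module"
    "HOL-Algebra.QuotRing"
begin

section \<open>Complex Lie algebras\<close>

class complex_lie_algebra = ab_group_add +
  fixes scaleC :: "complex \<Rightarrow> 'a \<Rightarrow> 'a"
    and lie_bracket :: "'a \<Rightarrow> 'a \<Rightarrow> 'a"
  assumes scaleC_add_right: "scaleC c (x + y) = scaleC c x + scaleC c y"
    and scaleC_add_left: "scaleC (c + d) x = scaleC c x + scaleC d x"
    and scaleC_scaleC: "scaleC c (scaleC d x) = scaleC (c * d) x"
    and scaleC_one: "scaleC 1 x = x"
    and bracket_add_left: "lie_bracket (x + y) z = lie_bracket x z + lie_bracket y z"
    and bracket_add_right: "lie_bracket x (y + z) = lie_bracket x y + lie_bracket x z"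
    and bracket_scaleC_left: "lie_bracket (scaleC c x) y = scaleC c (lie_bracket x y)"
    and bracket_scaleC_right: "lie_bracket x (scaleC c y) = scaleC c (lie_bracket x y)"
    and bracket_self: "lie_bracket x x = 0"
    and jacobi: "lie_bracket x (lie_bracket y z) + lie_bracket y (lie_bracket z x)
                   + lie_bracket z (lie_bracket x y) = 0"

global_interpretation lie: vector_space "scaleC :: complex \<Rightarrow> 'a::complex_lie_algebra \<Rightarrow> 'a"
  by unfold_locales
     (simp_all add: scaleC_add_right scaleC_add_left scaleC_scaleC scaleC_one)

definition finite_dim :: "'g::complex_lie_algebra set \<Rightarrow> bool" where
  "finite_dim V \<longleftrightarrow> (\<exists>S. finite S \<and> lie.span S = V)"

definition lie_subalgebra :: "'g::complex_lie_algebra set \<Rightarrow> bool" where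
  "lie_subalgebra h \<longleftrightarrow> lie.subspace h \<and> (\<forall>x\<in>h. \<forall>y\<in>h. lie_bracket x y \<in> h)"

definition lie_ideal :: "'g::complex_lie_algebra set \<Rightarrow> 'g set \<Rightarrow> bool" where
  "lie_ideal I h \<longleftrightarrow> lie.subspace I \<and> I \<subseteq> h \<and> (\<forall>x\<in>h. \<forall>y\<in>I. lie_bracket x y \<in> I)"

primrec derived_series :: "'g::complex_lie_algebra set \<Rightarrow> nat \<Rightarrow> 'g set" where
  "derived_series h 0 = h"
| "derived_series h (Suc n) =
     lie.span {lie_bracket x y | x y. x \<in> derived_series h n \<and> y \<in> derived_series h n}"

definition solvable_lie :: "'g::complex_lie_algebra set \<Rightarrow> bool" where
  "solvable_lie h \<longleftrightarrow> (\<exists>n. derived_series h n = {0})"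

text \<open>The sum of all solvable ideals, which is the largest one.\<close>

definition lie_radical :: "'g::complex_lie_algebra set \<Rightarrow> 'g set" where
  "lie_radical h = lie.span (\<Union>{I. lie_ideal I h \<and> solvable_lie I})"

definition lie_center :: "'g::complex_lie_algebra set \<Rightarrow> 'g set" where
  "lie_center h = {x \<in> h. \<forall>y\<in>h. lie_bracket x y = 0}"

definition semisimple_lie :: "'g::complex_lie_algebra set \<Rightarrow> bool" where
  "semisimple_lie h \<longleftrightarrow> lie_radical h = {0}"

definition reductive_lie :: "'g::complex_lie_algebra set \<Rightarrow> bool" where
  "reductive_lie h \<longleftrightarrow> lie_radical h = lie_center h"

text \<open>The trace does not depend on the chosen basis.\<close>

definition lie_trace :: "('g::complex_lie_algebra \<Rightarrow> 'g) \<Rightarrow> complex" where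
  "lie_trace f = (let E = (SOME E. lie.independent E \<and> lie.span E = UNIV)
                  in \<Sum>b\<in>E. lie.representation E (f b) b)"

definition killing_form :: "'g::complex_lie_algebra \<Rightarrow> 'g \<Rightarrow> complex" where
  "killing_form x y = lie_trace (\<lambda>z. lie_bracket x (lie_bracket y z))"

definition nondegenerate_on :: "('g::complex_lie_algebra \<Rightarrow> 'g \<Rightarrow> complex) \<Rightarrow> 'g set \<Rightarrow> bool" where
  "nondegenerate_on B V \<longleftrightarrow> (\<forall>x\<in>V. (\<forall>y\<in>V. B x y = 0) \<longrightarrow> x = 0)"

definition orth_compl :: "('g::complex_lie_algebra \<Rightarrow> 'g \<Rightarrow> complex) \<Rightarrow> 'g set \<Rightarrow> 'g set \<Rightarrow> 'g set" where
  "orth_compl B a b = {x \<in> a. \<forall>y\<in>b. B x y = 0}"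

definition subspace_sum :: "'g::complex_lie_algebra set \<Rightarrow> 'g set \<Rightarrow> 'g set" where
  "subspace_sum X Y = {x + y | x y. x \<in> X \<and> y \<in> Y}"

definition is_direct_sum :: "'g::complex_lie_algebra set \<Rightarrow> 'g set \<Rightarrow> 'g set \<Rightarrow> bool" where
  "is_direct_sum V X Y \<longleftrightarrow> V = subspace_sum X Y \<and> X \<inter> Y = {0}"

text \<open>Linear independence and distinctness of the entries follow from orthonormality.\<close>

definition orthonormal_basis :: "('g::complex_lie_algebra \<Rightarrow> 'g \<Rightarrow> complex) \<Rightarrow> 'g set \<Rightarrow> 'g list \<Rightarrow> bool" where
  "orthonormal_basis B V Ws \<longleftrightarrow> lie.span (set Ws) = V \<and>
     (\<forall>i<length Ws. \<forall>j<length Ws. B (Ws ! i) (Ws ! j) = (if i = j then 1 else 0))"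


section \<open>$\mathbb{Z}_2$-graded associative algebras over the complex numbers\<close>

text \<open>In a \<^typ>\<open>complex\<close>-algebra record, \<open>hcomp A i\<close> is the projection to the homogeneous
  component of degree \<open>i\<close>.\<close>

record 'a superalgebra = "(complex, 'a) module" +
  hcomp :: "bit \<Rightarrow> 'a \<Rightarrow> 'a"

definition quot_alg :: "'a superalgebra \<Rightarrow> 'a set \<Rightarrow> 'a set superalgebra" where
  "quot_alg R I =
     \<lparr> carrier = a_rcosets\<^bsub>R\<^esub> I,
       mult = rcoset_mult R I,
       one = I +>\<^bsub>R\<^esub> \<one>\<^bsub>R\<^esub>,
       zero = I,
       add = set_add R,
       smult = (\<lambda>c X. \<Union>x\<in>X. I +>\<^bsub>R\<^esub> (c \<odot>\<^bsub>R\<^esub> x)),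
       hcomp = (\<lambda>k X. \<Union>x\<in>X. I +>\<^bsub>R\<^esub> hcomp R k x) \<rparr>"

definition fscale :: "complex \<Rightarrow> ('x \<Rightarrow>\<^sub>0 complex) \<Rightarrow> ('x \<Rightarrow>\<^sub>0 complex)" where
  "fscale c p = Poly_Mapping.map ((*) c) p"

text \<open>The linear extension of \<open>\<phi>\<close> from basis elements to formal linear combinations,
  induced on a coset \<open>X\<close> of such combinations. It is only used for maps constant on cosets.\<close>

definition lin_lift :: "'b superalgebra \<Rightarrow> ('x \<Rightarrow> 'b) \<Rightarrow> ('x \<Rightarrow>\<^sub>0 complex) set \<Rightarrow> 'b" where
  "lin_lift M \<phi> X =
     the_elem ((\<lambda>p. finsum M (\<lambda>x. Poly_Mapping.lookup p x \<odot>\<^bsub>M\<^esub> \<phi> x) (Poly_Mapping.keys p)) ` X)"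


subsection \<open>Free algebras\<close>

text \<open>The free monoid, so that \<open>'x mword \<Rightarrow>\<^sub>0 complex\<close> with the library's convolution
  product is the free associative algebra on \<open>'x\<close>.\<close>

datatype 'x mword = MWord (letters: "'x list")

instantiation mword :: (type) monoid_add
begin

definition zero_mword :: "'a mword" where "0 = MWord []"

definition plus_mword :: "'a mword \<Rightarrow> 'a mword \<Rightarrow> 'a mword" where
  "u + v = MWord (letters u @ letters v)"

instance
  by standard (simp_all add: zero_mword_def plus_mword_def)

end

text \<open>The free algebra on the set \<open>V\<close> of generators, where \<open>x\<close> has degree \<open>\<delta> x\<close>.\<close>

definition free_alg :: "('x \<Rightarrow> bit) \<Rightarrow> 'x set \<Rightarrow> ('x mword \<Rightarrow>\<^sub>0 complex) superalgebra" where
  "free_alg \<delta> V =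
     \<lparr> carrier = {p. \<forall>w\<in>Poly_Mapping.keys p. set (letters w) \<subseteq> V},
       mult = (*),
       one = 1,
       zero = 0,
       add = (+),
       smult = fscale,
       hcomp = (\<lambda>k p. \<Sum>w | w \<in> Poly_Mapping.keys p \<and> sum_list (map \<delta> (letters w)) = k.
                  Poly_Mapping.single w (Poly_Mapping.lookup p w)) \<rparr>"

definition free_gen :: "'x \<Rightarrow> 'x mword \<Rightarrow>\<^sub>0 complex" where
  "free_gen x = Poly_Mapping.single (MWord [x]) 1"

text \<open>These relations turn the free algebra on the set \<open>V\<close> into the tensor algebra
  of the vector space \<open>V\<close>.\<close>

definition linear_rels :: "'g::complex_lie_algebra set \<Rightarrow> ('g mword \<Rightarrow>\<^sub>0 complex) set" where
  "linear_rels V =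
     {free_gen (x + y) - free_gen x - free_gen y | x y. x \<in> V \<and> y \<in> V} \<union>
     {free_gen (scaleC c x) - fscale c (free_gen x) | c x. x \<in> V}"

definition alg_lift :: "'b superalgebra \<Rightarrow> ('x \<Rightarrow> 'b) \<Rightarrow> ('x mword \<Rightarrow>\<^sub>0 complex) set \<Rightarrow> 'b" where
  "alg_lift M f = lin_lift M (\<lambda>w. foldr (\<lambda>x y. f x \<otimes>\<^bsub>M\<^esub> y) (letters w) \<one>\<^bsub>M\<^esub>)"


subsection \<open>Universal enveloping algebras\<close>

definition env_ideal :: "'g::complex_lie_algebra set \<Rightarrow> ('g mword \<Rightarrow>\<^sub>0 complex) set" where
  "env_ideal a = genideal (free_alg (\<lambda>_. 0) a)
     (linear_rels a \<union>
      {free_gen x * free_gen y - free_gen y * free_gen x - free_gen (lie_bracket x y)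
        | x y. x \<in> a \<and> y \<in> a})"

text \<open>The enveloping algebra is purely even.\<close>

definition env_alg :: "'g::complex_lie_algebra set \<Rightarrow> ('g mword \<Rightarrow>\<^sub>0 complex) set superalgebra" where
  "env_alg a = quot_alg (free_alg (\<lambda>_. 0) a) (env_ideal a)"

definition env_gen :: "'g::complex_lie_algebra set \<Rightarrow> 'g \<Rightarrow> ('g mword \<Rightarrow>\<^sub>0 complex) set" where
  "env_gen a x = env_ideal a +>\<^bsub>free_alg (\<lambda>_. 0) a\<^esub> free_gen x"


subsection \<open>Clifford algebras\<close>

definition cliff_ideal :: "('g::complex_lie_algebra \<Rightarrow> 'g \<Rightarrow> complex) \<Rightarrow> 'g set
    \<Rightarrow> ('g mword \<Rightarrow>\<^sub>0 complex) set" where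
  "cliff_ideal B V = genideal (free_alg (\<lambda>_. 1) V)
     (linear_rels V \<union>
      {free_gen v * free_gen w + free_gen w * free_gen v - fscale (2 * B v w) 1
        | v w. v \<in> V \<and> w \<in> V})"

definition cliff_alg :: "('g::complex_lie_algebra \<Rightarrow> 'g \<Rightarrow> complex) \<Rightarrow> 'g set
    \<Rightarrow> ('g mword \<Rightarrow>\<^sub>0 complex) set superalgebra" where
  "cliff_alg B V = quot_alg (free_alg (\<lambda>_. 1) V) (cliff_ideal B V)"

definition cliff_gen :: "('g::complex_lie_algebra \<Rightarrow> 'g \<Rightarrow> complex) \<Rightarrow> 'g set \<Rightarrow> 'g
    \<Rightarrow> ('g mword \<Rightarrow>\<^sub>0 complex) set" where
  "cliff_gen B V v = cliff_ideal B V +>\<^bsub>free_alg (\<lambda>_. 1) V\<^esub> free_gen v"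

text \<open>The homomorphism from the Clifford algebra of a subspace of \<open>W\<close> to that of \<open>W\<close>
  induced by the inclusion.\<close>

definition cliff_incl :: "('g::complex_lie_algebra \<Rightarrow> 'g \<Rightarrow> complex) \<Rightarrow> 'g set
    \<Rightarrow> ('g mword \<Rightarrow>\<^sub>0 complex) set \<Rightarrow> ('g mword \<Rightarrow>\<^sub>0 complex) set" where
  "cliff_incl B W = alg_lift (cliff_alg B W) (cliff_gen B W)"


subsection \<open>Graded tensor products\<close>

definition koszul_sign :: "bit \<Rightarrow> bit \<Rightarrow> complex" where
  "koszul_sign i j = (if i = 1 \<and> j = 1 then -1 else 1)"

text \<open>Formal linear combinations of pairs. The product extends
  \<open>(a, b) (a', b') = (-1)\<^bsup>|b| |a'|\<^esup> (a a', b b')\<close> (\<open>b\<close>, \<open>a'\<close> homogeneous); this is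
  an algebra only after the bilinearity relations have been divided out.\<close>

definition pre_gtensor :: "'a superalgebra \<Rightarrow> 'b superalgebra
    \<Rightarrow> ('a \<times> 'b \<Rightarrow>\<^sub>0 complex) superalgebra" where
  "pre_gtensor A B =
     \<lparr> carrier = {p. Poly_Mapping.keys p \<subseteq> carrier A \<times> carrier B},
       mult = (\<lambda>p q. \<Sum>(a, b)\<in>Poly_Mapping.keys p. \<Sum>(a', b')\<in>Poly_Mapping.keys q.
          \<Sum>i\<in>{0, 1}. \<Sum>j\<in>{0, 1}.
            Poly_Mapping.single (a \<otimes>\<^bsub>A\<^esub> hcomp A i a', hcomp B j b \<otimes>\<^bsub>B\<^esub> b')
              (koszul_sign j i * Poly_Mapping.lookup p (a, b) * Poly_Mapping.lookup q (a', b'))),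
       one = Poly_Mapping.single (\<one>\<^bsub>A\<^esub>, \<one>\<^bsub>B\<^esub>) 1,
       zero = 0,
       add = (+),
       smult = fscale,
       hcomp = (\<lambda>k p. \<Sum>(a, b)\<in>Poly_Mapping.keys p. \<Sum>i\<in>{0, 1}.
          Poly_Mapping.single (hcomp A i a, hcomp B (k - i) b) (Poly_Mapping.lookup p (a, b))) \<rparr>"

definition bilinear_rels :: "'a superalgebra \<Rightarrow> 'b superalgebra \<Rightarrow> ('a \<times> 'b \<Rightarrow>\<^sub>0 complex) set" where
  "bilinear_rels A B =
     {Poly_Mapping.single (a \<oplus>\<^bsub>A\<^esub> a', b) 1 - Poly_Mapping.single (a, b) 1 - Poly_Mapping.single (a', b) 1
        | a a' b. a \<in> carrier A \<and> a' \<in> carrier A \<and> b \<in> carrier B} \<union>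
     {Poly_Mapping.single (a, b \<oplus>\<^bsub>B\<^esub> b') 1 - Poly_Mapping.single (a, b) 1 - Poly_Mapping.single (a, b') 1
        | a b b'. a \<in> carrier A \<and> b \<in> carrier B \<and> b' \<in> carrier B} \<union>
     {Poly_Mapping.single (c \<odot>\<^bsub>A\<^esub> a, b) 1 - Poly_Mapping.single (a, b) c
        | c a b. a \<in> carrier A \<and> b \<in> carrier B} \<union>
     {Poly_Mapping.single (a, c \<odot>\<^bsub>B\<^esub> b) 1 - Poly_Mapping.single (a, b) c
        | c a b. a \<in> carrier A \<and> b \<in> carrier B}"

definition gtensor_ideal :: "'a superalgebra \<Rightarrow> 'b superalgebra \<Rightarrow> ('a \<times> 'b \<Rightarrow>\<^sub>0 complex) set" where
  "gtensor_ideal A B = Modules.module.span fscale (bilinear_rels A B)"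

text \<open>If one of the factors is purely even, this is the ordinary tensor product of algebras.\<close>

definition gtensor :: "'a superalgebra \<Rightarrow> 'b superalgebra
    \<Rightarrow> ('a \<times> 'b \<Rightarrow>\<^sub>0 complex) set superalgebra" where
  "gtensor A B = quot_alg (pre_gtensor A B) (gtensor_ideal A B)"

definition gtens :: "'a superalgebra \<Rightarrow> 'b superalgebra \<Rightarrow> 'a \<Rightarrow> 'b \<Rightarrow> ('a \<times> 'b \<Rightarrow>\<^sub>0 complex) set" where
  "gtens A B a b = gtensor_ideal A B +>\<^bsub>pre_gtensor A B\<^esub> Poly_Mapping.single (a, b) 1"

definition gtens_lift :: "'m superalgebra \<Rightarrow> ('a \<Rightarrow> 'b \<Rightarrow> 'm) \<Rightarrow> ('a \<times> 'b \<Rightarrow>\<^sub>0 complex) set \<Rightarrow> 'm" where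
  "gtens_lift M \<beta> = lin_lift M (\<lambda>(a, b). \<beta> a b)"


section \<open>Cubic Dirac operators\<close>

definition env_cliff :: "('g::complex_lie_algebra \<Rightarrow> 'g \<Rightarrow> complex) \<Rightarrow> 'g set \<Rightarrow> 'g set
    \<Rightarrow> (('g mword \<Rightarrow>\<^sub>0 complex) set \<times> ('g mword \<Rightarrow>\<^sub>0 complex) set \<Rightarrow>\<^sub>0 complex) set superalgebra" where
  "env_cliff B a V = gtensor (env_alg a) (cliff_alg B V)"

definition ec_tens :: "('g::complex_lie_algebra \<Rightarrow> 'g \<Rightarrow> complex) \<Rightarrow> 'g set \<Rightarrow> 'g set
    \<Rightarrow> ('g mword \<Rightarrow>\<^sub>0 complex) set \<Rightarrow> ('g mword \<Rightarrow>\<^sub>0 complex) set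
    \<Rightarrow> (('g mword \<Rightarrow>\<^sub>0 complex) set \<times> ('g mword \<Rightarrow>\<^sub>0 complex) set \<Rightarrow>\<^sub>0 complex) set" where
  "ec_tens B a V = gtens (env_alg a) (cliff_alg B V)"

text \<open>\<open>D(a, b)\<close>, computed in the orthonormal basis \<open>Ws\<close> of the orthogonal complement
  of \<open>b\<close> in \<open>a\<close>. The value does not depend on that basis.\<close>

definition cubic_dirac :: "('g::complex_lie_algebra \<Rightarrow> 'g \<Rightarrow> complex) \<Rightarrow> 'g set \<Rightarrow> 'g set \<Rightarrow> 'g list
    \<Rightarrow> (('g mword \<Rightarrow>\<^sub>0 complex) set \<times> ('g mword \<Rightarrow>\<^sub>0 complex) set \<Rightarrow>\<^sub>0 complex) set" where
  "cubic_dirac B a b Ws =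
     (let V = orth_compl B a b; A = env_cliff B a V; C = cliff_alg B V;
          W = (\<lambda>k. Ws ! k); c = (\<lambda>k. cliff_gen B V (Ws ! k)); m = length Ws
      in finsum A (\<lambda>k. ec_tens B a V (env_gen a (W k)) (c k)) {..<m}
         \<ominus>\<^bsub>A\<^esub> (1/2) \<odot>\<^bsub>A\<^esub>
           finsum A (\<lambda>(i, j, k). B (lie_bracket (W i) (W j)) (W k) \<odot>\<^bsub>A\<^esub>
                       ec_tens B a V \<one>\<^bsub>env_alg a\<^esub> (c i \<otimes>\<^bsub>C\<^esub> c j \<otimes>\<^bsub>C\<^esub> c k))
             {(i, j, k). i < j \<and> j < k \<and> k < m})"


section \<open>The diagonal embedding\<close>

text \<open>In an orthonormal basis \<open>Zs\<close> of \<open>s\<close>, the skew matrix \<open>M\<close>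
  equals \<open>\<Sum>\<^bsub>i<j\<^esub> M\<^sub>i\<^sub>j (E\<^sub>i\<^sub>j - E\<^sub>j\<^sub>i)\<close>.\<close>

definition so_to_cliff :: "('g::complex_lie_algebra \<Rightarrow> 'g \<Rightarrow> complex) \<Rightarrow> 'g set \<Rightarrow> 'g list
    \<Rightarrow> (nat \<Rightarrow> nat \<Rightarrow> complex) \<Rightarrow> ('g mword \<Rightarrow>\<^sub>0 complex) set" where
  "so_to_cliff B s Zs M =
     finsum (cliff_alg B s)
       (\<lambda>(i, j). M i j \<odot>\<^bsub>cliff_alg B s\<^esub> ((1/2) \<odot>\<^bsub>cliff_alg B s\<^esub>
          (cliff_gen B s (Zs ! i) \<otimes>\<^bsub>cliff_alg B s\<^esub> cliff_gen B s (Zs ! j))))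
       {(i, j). i < j \<and> j < length Zs}"

definition ad_matrix :: "('g::complex_lie_algebra \<Rightarrow> 'g \<Rightarrow> complex) \<Rightarrow> 'g list \<Rightarrow> 'g
    \<Rightarrow> nat \<Rightarrow> nat \<Rightarrow> complex" where
  "ad_matrix B Zs X i j = B (lie_bracket X (Zs ! j)) (Zs ! i)"

definition spin_alpha :: "('g::complex_lie_algebra \<Rightarrow> 'g \<Rightarrow> complex) \<Rightarrow> 'g set \<Rightarrow> 'g list \<Rightarrow> 'g
    \<Rightarrow> ('g mword \<Rightarrow>\<^sub>0 complex) set" where
  "spin_alpha B s Zs X = so_to_cliff B s Zs (ad_matrix B Zs X)"

text \<open>The algebra \<open>U(g) \<otimes> C(s) \<otimes> C(t)\<close>, graded in the last two factors;
  \<open>g\<close> is the whole type.\<close>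

definition big_alg where
  "big_alg B s t = gtensor (env_cliff B UNIV s) (cliff_alg B t)"

definition big_tens where
  "big_tens B s t = gtens (env_cliff B UNIV s) (cliff_alg B t)"

definition diag_env :: "('g::complex_lie_algebra \<Rightarrow> 'g \<Rightarrow> complex) \<Rightarrow> 'g set \<Rightarrow> 'g list
    \<Rightarrow> ('g mword \<Rightarrow>\<^sub>0 complex) set
    \<Rightarrow> (('g mword \<Rightarrow>\<^sub>0 complex) set \<times> ('g mword \<Rightarrow>\<^sub>0 complex) set \<Rightarrow>\<^sub>0 complex) set" where
  "diag_env B s Zs = alg_lift (env_cliff B UNIV s)
     (\<lambda>X. ec_tens B UNIV s (env_gen UNIV X) \<one>\<^bsub>cliff_alg B s\<^esub>
          \<oplus>\<^bsub>env_cliff B UNIV s\<^esub>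
          ec_tens B UNIV s \<one>\<^bsub>env_alg (UNIV :: 'g set)\<^esub> (spin_alpha B s Zs X))"

definition diag_emb where
  "diag_emb B s t Zs = gtens_lift (big_alg B s t) (\<lambda>u c. big_tens B s t (diag_env B s Zs u) c)"

text \<open>The inclusion of \<open>U(g) \<otimes> C(s)\<close> as \<open>U(g) \<otimes> C(s) \<otimes> 1\<close>.\<close>

definition first_emb where
  "first_emb B s t x = big_tens B s t x \<one>\<^bsub>cliff_alg B t\<^esub>"

text \<open>The identification of \<open>U(g) \<otimes> C(s) \<otimes> C(t)\<close> with \<open>U(g) \<otimes> C(s \<oplus> t)\<close>,
  for orthogonal \<open>s\<close> and \<open>t\<close>, by
  \<open>u \<otimes> c \<otimes> d \<mapsto> u \<otimes> c d\<close>, with the product taken in \<open>C(s \<oplus> t)\<close>.\<close>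

definition merge_iso where
  "merge_iso B s t =
     gtens_lift (env_cliff B UNIV (subspace_sum s t)) (\<lambda>x d.
       gtens_lift (env_cliff B UNIV (subspace_sum s t)) (\<lambda>u c.
         ec_tens B UNIV (subspace_sum s t) u
           (cliff_incl B (subspace_sum s t) c
              \<otimes>\<^bsub>cliff_alg B (subspace_sum s t)\<^esub> cliff_incl B (subspace_sum s t) d)) x)"

end

theory Submission
  imports Defs
begin

text \<open>
  Write \<open>t = r \<inter> s'\<close>. A cubic Dirac operator \<open>D(a, b)\<close> is the contraction of the identity
  of the orthogonal complement of \<open>b\<close>, placed in \<open>U(a) \<otimes> C\<close>, minus one twelfth of the
  contraction of the alternating form \<open>B([u, v], w)\<close> with the products \<open>uvw\<close>, both taken over
  all basis vectors (\<open>dual_cubic_dirac\<close>). Contractions with \<open>B\<close> do not depend on the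
  orthonormal basis, and they are invariant under every \<open>X\<close> whose adjoint action preserves the
  space.

  For the first claim, the orthogonal complement of \<open>r \<inter> r'\<close> is \<open>s \<oplus> t\<close>, and one computes in
  a basis that joins a basis \<open>Z\<close> of \<open>s\<close> and a basis \<open>Y\<close> of \<open>t\<close>. The terms with all vectors
  in \<open>Z\<close> form \<open>D(g, r)\<close>, those with all vectors in \<open>Y\<close> form \<open>D(r, r \<inter> r')\<close>
  with \<open>r\<close> embedded in \<open>U(g)\<close> without spin terms. Cubic terms with exactly two vectors in \<open>Y\<close> vanish because \<open>r\<close> is a
  subalgebra orthogonal to \<open>s\<close>. Those with exactly one vector \<open>y\<close> in \<open>Y\<close> add up to
  \<open>-1/4 \<Sum> B([z, z'], y) zz'y\<close> (\<open>cubic_sum_union\<close>). Since \<open>\<alpha> y = 1/4 \<Sum>\<^sub>e [y, e] e\<close>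
  (\<open>dual_alpha\<close>), this is \<open>\<Sum>\<^sub>y \<alpha>(y) y\<close>, exactly what the diagonal embedding adds.

  For the second claim, the commutator of \<open>\<alpha> X\<close> with a vector \<open>v\<close> of \<open>s\<close> is \<open>[X, v]\<close>
  (\<open>alpha_commutator\<close>). So the diagonal copy of \<open>X\<close> in \<open>r\<close> acts on \<open>D(g, r)\<close> by
  rotating the basis vectors, and invariance of contractions shows that the two commute
  (\<open>diagonal_commutes\<close>). Every term of the second operator is such a diagonal element, or
  \<open>1\<close>, times an odd element of \<open>C(t)\<close>. As \<open>D(g, r)\<close> is odd, it anticommutes with each of
  them (\<open>graded_commutator\<close>).

  The algebras are quotients of spaces of formal linear combinations. Each of them has enough linear
  functionals to separate points, so an identity between elements is a family of identities
  between complex numbers, and a map defined on generators descends to a quotient as soon as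
  functionals vanish on the relations. All multilinear computations are therefore carried out with
  complex valued forms.
\<close>

section \<open>Formal linear combinations\<close>

lemma lookup_fscale [simp]: "Poly_Mapping.lookup (fscale c p) x = c * Poly_Mapping.lookup p x"
  unfolding fscale_def by transfer (auto simp: when_def)

global_interpretation fs: vector_space "fscale :: complex \<Rightarrow> ('x \<Rightarrow>\<^sub>0 complex) \<Rightarrow> _"
  by unfold_locales (auto intro!: poly_mapping_eqI simp: lookup_add algebra_simps)

lemma fscale_single [simp]: "fscale c (Poly_Mapping.single x d) = Poly_Mapping.single x (c * d)"
  by (rule poly_mapping_eqI) (auto simp: lookup_single when_def)

lemma fscale_mult_left: "fscale c p * q = fscale c (p * q)"
  and fscale_mult_right: "p * fscale c q = fscale c (p * q)"
  for p q :: "'x::monoid_add \<Rightarrow>\<^sub>0 complex"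
proof -
  have fs: "fscale c p = Poly_Mapping.single 0 c * p" for c and p :: "'x \<Rightarrow>\<^sub>0 complex"
    unfolding fscale_def by (rule mult_map_scale_conv_mult)
  have comm: "Poly_Mapping.single 0 c * p = p * Poly_Mapping.single 0 c" for p :: "'x \<Rightarrow>\<^sub>0 complex"
  proof (induction p rule: update_induct)
    case const
    then show ?case by simp
  next
    case (update p a b)
    have "Poly_Mapping.update a b p = p + Poly_Mapping.single a b"
      using update(1) by (intro poly_mapping_eqI)
        (auto simp: lookup_update lookup_add lookup_single when_def in_keys_iff)
    then show ?case using update by (simp add: algebra_simps mult_single)
  qed
  show "fscale c p * q = fscale c (p * q)" by (simp add: fs mult.assoc)
  show "p * fscale c q = fscale c (p * q)" by (metis fs comm mult.assoc)
qed

definition lincomb :: "('x \<Rightarrow> complex) \<Rightarrow> ('x \<Rightarrow>\<^sub>0 complex) \<Rightarrow> complex" where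
  "lincomb f p = (\<Sum>x\<in>Poly_Mapping.keys p. Poly_Mapping.lookup p x * f x)"

lemma lincomb_superset:
  assumes "finite S" "Poly_Mapping.keys p \<subseteq> S"
  shows "lincomb f p = (\<Sum>x\<in>S. Poly_Mapping.lookup p x * f x)"
  unfolding lincomb_def
  by (rule sum.mono_neutral_left) (use assms in \<open>auto simp: in_keys_iff\<close>)

lemma lincomb_zero [simp]: "lincomb f 0 = 0"
  by (simp add: lincomb_def)

lemma lincomb_add: "lincomb f (p + q) = lincomb f p + lincomb f q"
proof -
  let ?S = "Poly_Mapping.keys p \<union> Poly_Mapping.keys q"
  have "Poly_Mapping.keys (p + q) \<subseteq> ?S" by (rule keys_add)
  then show ?thesis
    by (simp add: lincomb_superset[of ?S] lookup_add distrib_right sum.distrib)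
qed

lemma lincomb_scale: "lincomb f (fscale c p) = c * lincomb f p"
proof -
  have "Poly_Mapping.keys (fscale c p) \<subseteq> Poly_Mapping.keys p" by (auto simp: in_keys_iff)
  then show ?thesis
    by (simp add: lincomb_superset[of "Poly_Mapping.keys p"] sum_distrib_left mult.assoc)
qed

lemma lincomb_single [simp]: "lincomb f (Poly_Mapping.single x c) = c * f x"
  by (simp add: lincomb_def)

lemma lincomb_diff: "lincomb f (p - q) = lincomb f p - lincomb f q"
  by (metis add_diff_cancel_right' diff_add_cancel lincomb_add)

lemma subspace_supported: "fs.subspace {p. Poly_Mapping.keys p \<subseteq> S}"
proof (rule fs.subspaceI)
  show "p + q \<in> {p. Poly_Mapping.keys p \<subseteq> S}"
    if "p \<in> {p. Poly_Mapping.keys p \<subseteq> S}" "q \<in> {p. Poly_Mapping.keys p \<subseteq> S}" for p q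
    using that keys_add[of p q] by blast
  show "fscale c p \<in> {p. Poly_Mapping.keys p \<subseteq> S}"
    if "p \<in> {p. Poly_Mapping.keys p \<subseteq> S}" for c p
    using that by (auto simp: in_keys_iff)
qed simp

lemma supported_induct [consumes 1, case_names zero add single]:
  assumes "Poly_Mapping.keys p \<subseteq> S"
    and "P 0"
    and "\<And>p q. P p \<Longrightarrow> P q \<Longrightarrow> P (p + q)"
    and "\<And>x c. x \<in> S \<Longrightarrow> P (Poly_Mapping.single x c)"
  shows "P p"
  using assms(1)
proof (induction p rule: update_induct)
  case const
  show ?case by (rule assms(2))
next
  case (update p a b)
  have u: "Poly_Mapping.update a b p = p + Poly_Mapping.single a b"
    using update(1) by (intro poly_mapping_eqI)
      (auto simp: lookup_update lookup_add lookup_single when_def in_keys_iff)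
  have "Poly_Mapping.keys (Poly_Mapping.update a b p) = insert a (Poly_Mapping.keys p)"
    using update(2) by (simp add: keys_update)
  then have "a \<in> S" "P p" using update by auto
  then show ?case unfolding u by (intro assms(3,4))
qed

definition functional :: "(('x \<Rightarrow>\<^sub>0 complex) \<Rightarrow> complex) \<Rightarrow> bool" where
  "functional f \<longleftrightarrow> (\<forall>p q. f (p + q) = f p + f q) \<and> (\<forall>c p. f (fscale c p) = c * f p)"

lemma functional_lincomb [simp]: "functional (lincomb f)"
  by (simp add: functional_def lincomb_add lincomb_scale)

lemma functional_zero: "functional f \<Longrightarrow> f 0 = 0"
  by (metis add_cancel_left_right functional_def)

lemma functional_diff: "functional f \<Longrightarrow> f (p - q) = f p - f q"
  by (metis add_diff_cancel_right' diff_add_cancel functional_def)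

lemma functional_eq_lincomb:
  assumes "functional f" shows "f p = lincomb (\<lambda>x. f (Poly_Mapping.single x 1)) p"
proof (rule supported_induct[of p UNIV])
  show "f (Poly_Mapping.single x c) = lincomb (\<lambda>x. f (Poly_Mapping.single x 1)) (Poly_Mapping.single x c)" for x c
    using assms fscale_single[of c x 1] by (metis functional_def lincomb_single mult.right_neutral)
qed (simp_all add: functional_zero[OF assms] assms[unfolded functional_def] lincomb_add)

text \<open>A basis of \<open>I\<close> together with \<open>p\<close> is linearly independent, so there is a functional
  that is \<open>1\<close> at \<open>p\<close> and \<open>0\<close> on that basis.\<close>

lemma functional_separating:
  assumes I: "fs.subspace I" and p: "p \<notin> I"
  obtains f where "functional f" "\<forall>i\<in>I. f i = 0" "f p \<noteq> 0"
proof -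
  have vs: "vector_space_pair (fscale :: complex \<Rightarrow> ('x \<Rightarrow>\<^sub>0 complex) \<Rightarrow> _) ((*) :: complex \<Rightarrow> _)"
    by (intro vector_space_pair.intro fs.vector_space_axioms vector_space.intro)
      (simp_all add: distrib_left distrib_right)
  obtain b where b: "b \<subseteq> I" "fs.independent b" "I \<subseteq> fs.span b"
    by (rule fs.basis_exists[of I])
  have "fs.span b = I" using b I fs.span_subspace by blast
  with p b have "fs.independent (insert p b)"
    by (simp add: fs.independent_insertI)
  from vector_space_pair.linear_independent_extend[OF vs this, of "\<lambda>x. if x = p then 1 else 0"]
  obtain g where g: "Vector_Spaces.linear fscale (*) g" and
    gb: "\<And>x. x \<in> insert p b \<Longrightarrow> g x = (if x = p then 1 else 0)" by blast
  have add: "g (u + v) = g u + g v" and scale: "g (fscale c u) = c * g u" for u v c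
    using g by (simp_all add: module_hom_iff_linear[symmetric] module_hom.add module_hom.scale)
  show thesis
  proof
    show fg: "functional g" by (simp add: functional_def add scale)
    have "g x = 0" if "x \<in> b" for x using gb[of x] that p b by auto
    then have "fs.span b \<subseteq> {x. g x = 0}"
      by (intro fs.span_minimal fs.subspaceI) (auto simp: add scale functional_zero[OF fg])
    then show "\<forall>i\<in>I. g i = 0"
      using \<open>fs.span b = I\<close> by auto
    show "g p \<noteq> 0" by (simp add: gb)
  qed
qed

section \<open>Algebras with enough linear functionals\<close>

text \<open>Only the values on the carrier are constrained. Composing such a functional with any map that
  is linear between the carriers therefore gives such a functional again.\<close>

definition dual :: "'a superalgebra \<Rightarrow> ('a \<Rightarrow> complex) set" where
  "dual A = {\<psi>. \<psi> \<zero>\<^bsub>A\<^esub> = 0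
     \<and> (\<forall>x\<in>carrier A. \<forall>y\<in>carrier A. \<psi> (x \<oplus>\<^bsub>A\<^esub> y) = \<psi> x + \<psi> y)
     \<and> (\<forall>c. \<forall>x\<in>carrier A. \<psi> (c \<odot>\<^bsub>A\<^esub> x) = c * \<psi> x)}"

lemma dual_zero: "\<psi> \<in> dual A \<Longrightarrow> \<psi> \<zero>\<^bsub>A\<^esub> = 0"
  and dual_add: "\<psi> \<in> dual A \<Longrightarrow> x \<in> carrier A \<Longrightarrow> y \<in> carrier A \<Longrightarrow> \<psi> (x \<oplus>\<^bsub>A\<^esub> y) = \<psi> x + \<psi> y"
  and dual_smult: "\<psi> \<in> dual A \<Longrightarrow> x \<in> carrier A \<Longrightarrow> \<psi> (c \<odot>\<^bsub>A\<^esub> x) = c * \<psi> x"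
  by (auto simp: dual_def)

text \<open>With enough functionals, every law of a vector space holds because its two sides agree under
  each functional, where it is a law of the complex numbers. Sums in the algebra turn into
  ordinary sums in the same way.\<close>

locale linear_space =
  fixes A :: "'a superalgebra" (structure)
  assumes add_closed [simp, intro]: "x \<in> carrier A \<Longrightarrow> y \<in> carrier A \<Longrightarrow> x \<oplus> y \<in> carrier A"
    and zero_closed [simp, intro]: "\<zero> \<in> carrier A"
    and smult_closed [simp, intro]: "x \<in> carrier A \<Longrightarrow> c \<odot> x \<in> carrier A"
    and dual_separates: "x \<in> carrier A \<Longrightarrow> y \<in> carrier A \<Longrightarrow> (\<And>\<psi>. \<psi> \<in> dual A \<Longrightarrow> \<psi> x = \<psi> y) \<Longrightarrow> x = y"
begin

sublocale abelian_group A
proof (rule abelian_groupI)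
  show "\<exists>y\<in>carrier A. y \<oplus> x = \<zero>" if "x \<in> carrier A" for x
    by (rule bexI[of _ "(-1) \<odot> x"], rule dual_separates)
      (use that in \<open>auto simp: dual_zero dual_add dual_smult\<close>)
qed (auto intro!: dual_separates simp: dual_zero dual_add)

lemma dual_finsum:
  assumes "\<psi> \<in> dual A" "\<And>i. i \<in> S \<Longrightarrow> f i \<in> carrier A"
  shows "\<psi> (finsum A f S) = (\<Sum>i\<in>S. \<psi> (f i))"
  using assms(2)
proof (induction S rule: infinite_finite_induct)
  case (infinite S)
  then show ?case using assms(1) by (simp add: dual_zero finsum_infinite)
next
  case empty
  then show ?case using assms(1) by (simp add: dual_zero)
next
  case (insert x F)
  then show ?case using assms(1)
    by (subst finsum_insert) (auto simp: dual_add intro!: finsum_closed)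
qed

lemma dual_minus:
  assumes "\<psi> \<in> dual A" "x \<in> carrier A" "y \<in> carrier A"
  shows "\<psi> (x \<ominus> y) = \<psi> x - \<psi> y"
proof -
  have "\<psi> (x \<ominus> y \<oplus> y) = \<psi> (x \<ominus> y) + \<psi> y" using assms by (simp add: dual_add)
  moreover have "x \<ominus> y \<oplus> y = x" using assms by (simp add: minus_eq a_assoc l_neg)
  ultimately show ?thesis by simp
qed

end

text \<open>Linearity as the existence of the transpose map between the duals. For targets with enough
  functionals this is additivity and homogeneity; in this form maps compose without any reference
  to their values, and a functional can be pulled back along a chain of them.\<close>

definition linear_map :: "'a superalgebra \<Rightarrow> 'b superalgebra \<Rightarrow> ('a \<Rightarrow> 'b) \<Rightarrow> bool" where
  "linear_map A M h \<longleftrightarrow> h \<in> carrier A \<rightarrow> carrier M \<and> (\<forall>\<psi>\<in>dual M. (\<lambda>x. \<psi> (h x)) \<in> dual A)"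

lemma linear_map_closed: "linear_map A M h \<Longrightarrow> x \<in> carrier A \<Longrightarrow> h x \<in> carrier M"
  and linear_map_dual: "linear_map A M h \<Longrightarrow> \<psi> \<in> dual M \<Longrightarrow> (\<lambda>x. \<psi> (h x)) \<in> dual A"
  by (auto simp: linear_map_def)

lemma linear_map_comp:
  "linear_map A M h \<Longrightarrow> linear_map M N k \<Longrightarrow> linear_map A N (\<lambda>x. k (h x))"
  by (auto simp: linear_map_def)

lemma linear_mapI:
  assumes "linear_space M" "linear_space A" "\<And>x. x \<in> carrier A \<Longrightarrow> h x \<in> carrier M"
    and "\<And>x y. x \<in> carrier A \<Longrightarrow> y \<in> carrier A \<Longrightarrow> h (x \<oplus>\<^bsub>A\<^esub> y) = h x \<oplus>\<^bsub>M\<^esub> h y"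
    and "\<And>c x. x \<in> carrier A \<Longrightarrow> h (c \<odot>\<^bsub>A\<^esub> x) = c \<odot>\<^bsub>M\<^esub> h x"
  shows "linear_map A M h"
proof -
  interpret M: linear_space M by fact
  interpret A: linear_space A by fact
  have "\<zero>\<^bsub>A\<^esub> = 0 \<odot>\<^bsub>A\<^esub> \<zero>\<^bsub>A\<^esub>"
    by (rule A.dual_separates) (auto simp: dual_zero dual_smult)
  then have "h \<zero>\<^bsub>A\<^esub> = 0 \<odot>\<^bsub>M\<^esub> h \<zero>\<^bsub>A\<^esub>"
    using assms(5)[OF A.zero_closed, of 0] by simp
  then have "\<psi> (h \<zero>\<^bsub>A\<^esub>) = 0" if "\<psi> \<in> dual M" for \<psi>
    using dual_smult[OF that, of "h \<zero>\<^bsub>A\<^esub>" 0] assms(3)[OF A.zero_closed] by simp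
  then show ?thesis
    using assms(3) by (auto simp: linear_map_def dual_def assms(4,5))
qed

context linear_space begin

lemma linear_map_add:
  assumes "linear_map B A h" "linear_space B" "x \<in> carrier B" "y \<in> carrier B"
  shows "h (x \<oplus>\<^bsub>B\<^esub> y) = h x \<oplus> h y"
proof -
  interpret B: linear_space B by fact
  show ?thesis
    using assms by (intro dual_separates)
      (auto simp: dual_add linear_map_closed dual_add[OF linear_map_dual[OF assms(1)]])
qed

lemma linear_map_smult:
  assumes "linear_map B A h" "linear_space B" "x \<in> carrier B"
  shows "h (c \<odot>\<^bsub>B\<^esub> x) = c \<odot> h x"
proof -
  interpret B: linear_space B by fact
  show ?thesis
    using assms by (intro dual_separates)
      (auto simp: dual_smult linear_map_closed dual_smult[OF linear_map_dual[OF assms(1)]])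
qed

lemma linear_map_zero:
  assumes "linear_map B A h" "linear_space B"
  shows "h \<zero>\<^bsub>B\<^esub> = \<zero>"
proof -
  interpret B: linear_space B by fact
  show ?thesis
    using assms by (intro dual_separates)
      (auto simp: dual_zero linear_map_closed dual_zero[OF linear_map_dual[OF assms(1)]])
qed

end

text \<open>Products are bilinear but need not be associative, and this class of algebras is closed under
  graded tensor products. Associativity is assumed below for the algebras into which homomorphisms
  are lifted.\<close>

locale linear_algebra = linear_space A for A :: "'a superalgebra" (structure) +
  assumes mult_closed [simp, intro]: "x \<in> carrier A \<Longrightarrow> y \<in> carrier A \<Longrightarrow> x \<otimes> y \<in> carrier A"
    and one_closed [simp, intro]: "\<one> \<in> carrier A"
    and linear_mult_left: "y \<in> carrier A \<Longrightarrow> linear_map A A (\<lambda>x. x \<otimes> y)"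
    and linear_mult_right: "x \<in> carrier A \<Longrightarrow> linear_map A A (\<lambda>y. x \<otimes> y)"
    and linear_hcomp: "linear_map A A (hcomp A k)"
begin

lemma hcomp_closed [simp, intro]: "x \<in> carrier A \<Longrightarrow> hcomp A k x \<in> carrier A"
  using linear_map_closed[OF linear_hcomp] .

lemmas mult_add_left = linear_map_add[OF linear_mult_left linear_space_axioms]
  and mult_add_right = linear_map_add[OF linear_mult_right linear_space_axioms]
  and mult_smult_left = linear_map_smult[OF linear_mult_left linear_space_axioms]
  and mult_smult_right = linear_map_smult[OF linear_mult_right linear_space_axioms]
  and mult_zero_l = linear_map_zero[OF linear_mult_left linear_space_axioms]
  and mult_zero_r = linear_map_zero[OF linear_mult_right linear_space_axioms]
  and hcomp_add = linear_map_add[OF linear_hcomp linear_space_axioms]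
  and hcomp_smult = linear_map_smult[OF linear_hcomp linear_space_axioms]
  and hcomp_zero = linear_map_zero[OF linear_hcomp linear_space_axioms]

end

locale assoc_algebra = linear_algebra A for A :: "'a superalgebra" (structure) +
  assumes mult_assoc: "x \<in> carrier A \<Longrightarrow> y \<in> carrier A \<Longrightarrow> z \<in> carrier A \<Longrightarrow> (x \<otimes> y) \<otimes> z = x \<otimes> (y \<otimes> z)"
    and one_left [simp]: "x \<in> carrier A \<Longrightarrow> \<one> \<otimes> x = x"
    and one_right [simp]: "x \<in> carrier A \<Longrightarrow> x \<otimes> \<one> = x"
begin

sublocale ring A
  by (rule ringI) (auto intro!: monoidI abelian_group_axioms simp: mult_assoc mult_add_left mult_add_right)

end


section \<open>Quotients by ideals of formal linear combinations\<close>

text \<open>The product of \<open>R\<close> is only assumed bilinear: formal combinations of pairs multiply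
  associatively only after the bilinearity relations have been divided out.\<close>

locale quotient_algebra =
  fixes R :: "('x \<Rightarrow>\<^sub>0 complex) superalgebra" (structure) and I :: "('x \<Rightarrow>\<^sub>0 complex) set"
  assumes R_add: "x \<oplus> y = x + y" and R_zero: "\<zero> = 0" and R_smult: "c \<odot> x = fscale c x"
    and R_subspace: "fs.subspace (carrier R)" and I_subspace: "fs.subspace I" and I_sub: "I \<subseteq> carrier R"
    and R_one: "\<one> \<in> carrier R"
    and R_mult: "x \<in> carrier R \<Longrightarrow> y \<in> carrier R \<Longrightarrow> x \<otimes> y \<in> carrier R"
    and R_mult_add: "x \<in> carrier R \<Longrightarrow> y \<in> carrier R \<Longrightarrow> z \<in> carrier R \<Longrightarrow> (x + y) \<otimes> z = x \<otimes> z + y \<otimes> z"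
       "x \<in> carrier R \<Longrightarrow> y \<in> carrier R \<Longrightarrow> z \<in> carrier R \<Longrightarrow> z \<otimes> (x + y) = z \<otimes> x + z \<otimes> y"
    and R_mult_scale: "x \<in> carrier R \<Longrightarrow> y \<in> carrier R \<Longrightarrow> fscale c x \<otimes> y = fscale c (x \<otimes> y)"
       "x \<in> carrier R \<Longrightarrow> y \<in> carrier R \<Longrightarrow> x \<otimes> fscale c y = fscale c (x \<otimes> y)"
    and I_mult: "i \<in> I \<Longrightarrow> y \<in> carrier R \<Longrightarrow> i \<otimes> y \<in> I" "i \<in> I \<Longrightarrow> y \<in> carrier R \<Longrightarrow> y \<otimes> i \<in> I"
    and R_hcomp: "x \<in> carrier R \<Longrightarrow> hcomp R k x \<in> carrier R"
    and R_hcomp_add: "x \<in> carrier R \<Longrightarrow> y \<in> carrier R \<Longrightarrow> hcomp R k (x + y) = hcomp R k x + hcomp R k y"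
    and R_hcomp_scale: "x \<in> carrier R \<Longrightarrow> hcomp R k (fscale c x) = fscale c (hcomp R k x)"
    and I_hcomp: "i \<in> I \<Longrightarrow> hcomp R k i \<in> I"
begin

abbreviation Q where "Q \<equiv> quot_alg R I"

abbreviation cls where "cls x \<equiv> I +>\<^bsub>R\<^esub> x"

lemma cls_def: "cls x = (\<lambda>i. i + x) ` I"
  by (auto simp: a_r_coset_def' R_add)

lemma mem_cls: "y \<in> cls x \<longleftrightarrow> y - x \<in> I"
  by (auto simp: cls_def image_iff) (metis diff_add_cancel)

lemma cls_eq_iff: "cls x = cls y \<longleftrightarrow> x - y \<in> I"
proof
  assume "cls x = cls y"
  moreover have "x \<in> cls x" using I_subspace by (simp add: mem_cls fs.subspace_0)
  ultimately show "x - y \<in> I" by (simp add: mem_cls)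
next
  assume h: "x - y \<in> I"
  have "z - x \<in> I \<longleftrightarrow> z - y \<in> I" for z
    using fs.subspace_add[OF I_subspace _ h, of "z - x"] fs.subspace_diff[OF I_subspace _ h, of "z - y"] by auto
  then show "cls x = cls y" by (auto simp: mem_cls)
qed

lemma cls_zero: "cls 0 = I"
  by (auto simp: mem_cls)

lemma R_closed [intro]: "x \<in> carrier R \<Longrightarrow> y \<in> carrier R \<Longrightarrow> x + y \<in> carrier R"
  "x \<in> carrier R \<Longrightarrow> fscale c x \<in> carrier R" "x \<in> carrier R \<Longrightarrow> y \<in> carrier R \<Longrightarrow> x - y \<in> carrier R"
  "0 \<in> carrier R"
  using R_subspace by (auto intro: fs.subspace_add fs.subspace_scale fs.subspace_diff fs.subspace_0)

lemma cls_carrier: "carrier Q = cls ` carrier R"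
  by (auto simp: quot_alg_def A_RCOSETS_def')

lemma cls_closed [simp, intro]: "x \<in> carrier R \<Longrightarrow> cls x \<in> carrier Q"
  by (simp add: cls_carrier)

lemma cls_mem_carrier: "y \<in> cls x \<Longrightarrow> x \<in> carrier R \<Longrightarrow> y \<in> carrier R"
  using I_sub R_closed(1)[of "y - x" x] by (auto simp: mem_cls)

lemma UN_cls:
  assumes "\<And>x y. x - y \<in> I \<Longrightarrow> x \<in> carrier R \<Longrightarrow> y \<in> carrier R \<Longrightarrow> f x - f y \<in> I" "x \<in> carrier R"
  shows "(\<Union>y\<in>cls x. cls (f y)) = cls (f x)"
proof -
  have "cls (f y) = cls (f x)" if "y \<in> cls x" for y
    using that assms cls_mem_carrier[OF that] by (simp add: cls_eq_iff mem_cls)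
  moreover have "x \<in> cls x" using I_subspace by (simp add: mem_cls fs.subspace_0)
  ultimately show ?thesis by blast
qed

lemma cls_add: "cls x \<oplus>\<^bsub>Q\<^esub> cls y = cls (x + y)"
proof -
  have "cls x \<oplus>\<^bsub>Q\<^esub> cls y = {(i + x) + (j + y) | i j. i \<in> I \<and> j \<in> I}"
    by (auto simp: quot_alg_def set_add_def' cls_def R_add)
  also have "\<dots> = cls (x + y)"
  proof (intro Set.set_eqI iffI)
    fix z assume "z \<in> {(i + x) + (j + y) | i j. i \<in> I \<and> j \<in> I}"
    then obtain i j where "z - (x + y) = i + j" "i \<in> I" "j \<in> I" by (auto simp: algebra_simps)
    then show "z \<in> cls (x + y)" using I_subspace by (simp add: mem_cls fs.subspace_add)
  next
    fix z assume "z \<in> cls (x + y)"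
    then have "z = ((z - (x + y)) + x) + (0 + y)" "z - (x + y) \<in> I" "0 \<in> I"
      using I_subspace by (simp_all add: mem_cls fs.subspace_0)
    then show "z \<in> {(i + x) + (j + y) | i j. i \<in> I \<and> j \<in> I}" by blast
  qed
  finally show ?thesis .
qed

lemma cls_smult: "x \<in> carrier R \<Longrightarrow> c \<odot>\<^bsub>Q\<^esub> cls x = cls (fscale c x)"
proof -
  assume x: "x \<in> carrier R"
  have "c \<odot>\<^bsub>Q\<^esub> cls x = (\<Union>y\<in>cls x. cls (fscale c y))"
    by (simp add: quot_alg_def R_smult)
  also have "\<dots> = cls (fscale c x)"
    by (rule UN_cls[OF _ x]) (metis I_subspace fs.subspace_scale fs.scale_right_diff_distrib)
  finally show ?thesis .
qed

lemma cls_hcomp: "x \<in> carrier R \<Longrightarrow> hcomp Q k (cls x) = cls (hcomp R k x)"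
proof -
  assume x: "x \<in> carrier R"
  have "hcomp Q k (cls x) = (\<Union>y\<in>cls x. cls (hcomp R k y))"
    by (simp add: quot_alg_def)
  also have "\<dots> = cls (hcomp R k x)"
  proof (rule UN_cls[OF _ x])
    fix x y assume "x - y \<in> I" "x \<in> carrier R" "y \<in> carrier R"
    moreover from this have "hcomp R k ((x - y) + y) = hcomp R k (x - y) + hcomp R k y"
      by (intro R_hcomp_add) auto
    ultimately show "hcomp R k x - hcomp R k y \<in> I" using I_hcomp by simp
  qed
  finally show ?thesis .
qed

lemma cls_mult:
  assumes "x \<in> carrier R" "y \<in> carrier R"
  shows "cls x \<otimes>\<^bsub>Q\<^esub> cls y = cls (x \<otimes> y)"
proof -
  have self: "x \<in> cls x" for x using I_subspace by (simp add: mem_cls fs.subspace_0)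
  have "cls (a \<otimes> b) = cls (x \<otimes> y)" if "a \<in> cls x" "b \<in> cls y" for a b
  proof -
    have ab: "a \<in> carrier R" "b \<in> carrier R" using cls_mem_carrier assms that by auto
    have "a \<otimes> b = (a - x) \<otimes> b + x \<otimes> b"
      using R_mult_add(1)[of "a - x" x b] ab assms by auto
    moreover have "x \<otimes> b = x \<otimes> (b - y) + x \<otimes> y"
      using R_mult_add(2)[of "b - y" y x] ab assms by auto
    ultimately have "a \<otimes> b - x \<otimes> y = (a - x) \<otimes> b + x \<otimes> (b - y)" by simp
    also have "\<dots> \<in> I"
      using that ab assms by (intro fs.subspace_add[OF I_subspace] I_mult) (auto simp: mem_cls)
    finally show ?thesis by (simp add: cls_eq_iff)
  qed
  then have "(\<Union>a\<in>cls x. \<Union>b\<in>cls y. cls (a \<otimes> b)) = cls (x \<otimes> y)"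
    using self[of x] self[of y] by blast
  then show ?thesis by (simp add: quot_alg_def rcoset_mult_def)
qed

lemma cls_one: "\<one>\<^bsub>Q\<^esub> = cls \<one>"
  by (simp add: quot_alg_def)

lemma Q_zero: "\<zero>\<^bsub>Q\<^esub> = cls 0"
  by (simp add: quot_alg_def cls_zero)

text \<open>A functional that vanishes on \<open>I\<close> is constant on cosets, so it may be evaluated at any
  representative.\<close>

lemma functional_dual_Q:
  assumes f: "functional f" and fI: "\<forall>i\<in>I. f i = 0"
  obtains \<psi> where "\<psi> \<in> dual Q" "\<And>x. x \<in> carrier R \<Longrightarrow> \<psi> (cls x) = f x"
proof -
  define \<psi> where "\<psi> X = f (SOME x. x \<in> X)" for X
  have \<psi>: "\<psi> (cls x) = f x" for x
  proof -
    have "x \<in> cls x" using I_subspace by (simp add: mem_cls fs.subspace_0)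
    then have "(SOME y. y \<in> cls x) \<in> cls x" by (rule someI)
    then have "f ((SOME y. y \<in> cls x) - x) = 0" using fI by (simp add: mem_cls)
    then show ?thesis by (simp add: \<psi>_def functional_diff[OF f])
  qed
  show thesis
  proof
    show "\<psi> (cls x) = f x" for x by (rule \<psi>)
    show "\<psi> \<in> dual Q"
      using f unfolding dual_def by (auto simp: cls_carrier Q_zero cls_add cls_smult \<psi> functional_zero functional_def)
  qed
qed

lemma linear_space_Q: "linear_space Q"
proof
  show "x = y" if "x \<in> carrier Q" "y \<in> carrier Q" and eq: "\<And>\<psi>. \<psi> \<in> dual Q \<Longrightarrow> \<psi> x = \<psi> y" for x y
  proof (rule ccontr)
    assume "x \<noteq> y"
    from that obtain p q where pq: "x = cls p" "y = cls q" "p \<in> carrier R" "q \<in> carrier R"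
      by (auto simp: cls_carrier)
    with \<open>x \<noteq> y\<close> have "p - q \<notin> I" by (simp add: cls_eq_iff)
    then obtain f where f: "functional f" "\<forall>i\<in>I. f i = 0" "f (p - q) \<noteq> 0"
      using functional_separating[OF I_subspace] by blast
    then obtain \<psi> where "\<psi> \<in> dual Q" "\<And>x. x \<in> carrier R \<Longrightarrow> \<psi> (cls x) = f x"
      using functional_dual_Q by blast
    then show False using eq[of \<psi>] pq f by (simp add: functional_diff)
  qed
qed (auto simp: cls_carrier cls_add cls_smult Q_zero)

lemma linear_algebra_Q: "linear_algebra Q"
proof -
  interpret linear_space Q by (rule linear_space_Q)
  show ?thesis
  proof
    show "linear_map Q Q (\<lambda>x. x \<otimes>\<^bsub>Q\<^esub> y)" if "y \<in> carrier Q" for y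
      using that by (intro linear_mapI linear_space_Q)
        (auto simp: cls_carrier cls_add cls_smult cls_mult R_mult R_mult_add R_mult_scale R_closed)
    show "linear_map Q Q (\<lambda>y. x \<otimes>\<^bsub>Q\<^esub> y)" if "x \<in> carrier Q" for x
      using that by (intro linear_mapI linear_space_Q)
        (auto simp: cls_carrier cls_add cls_smult cls_mult R_mult R_mult_add R_mult_scale R_closed)
    show "linear_map Q Q (hcomp Q k)" for k
      by (intro linear_mapI linear_space_Q)
        (auto simp: cls_carrier cls_add cls_smult cls_hcomp R_hcomp R_hcomp_add R_hcomp_scale R_closed)
  qed (auto simp: cls_carrier cls_one R_one cls_mult R_mult)
qed

lemma assoc_algebra_Q:
  assumes "\<And>x y z. x \<in> carrier R \<Longrightarrow> y \<in> carrier R \<Longrightarrow> z \<in> carrier R \<Longrightarrow> (x \<otimes> y) \<otimes> z = x \<otimes> (y \<otimes> z)"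
    and "\<And>x. x \<in> carrier R \<Longrightarrow> \<one> \<otimes> x = x" "\<And>x. x \<in> carrier R \<Longrightarrow> x \<otimes> \<one> = x"
  shows "assoc_algebra Q"
proof -
  interpret linear_algebra Q by (rule linear_algebra_Q)
  show ?thesis
    by unfold_locales (auto simp: cls_carrier cls_mult cls_one R_mult R_one assms)
qed

end

section \<open>Linear extensions to quotients\<close>

definition comb :: "'b superalgebra \<Rightarrow> ('x \<Rightarrow> 'b) \<Rightarrow> ('x \<Rightarrow>\<^sub>0 complex) \<Rightarrow> 'b" where
  "comb M \<phi> p = finsum M (\<lambda>x. Poly_Mapping.lookup p x \<odot>\<^bsub>M\<^esub> \<phi> x) (Poly_Mapping.keys p)"

context linear_space begin

lemma comb_closed:
  assumes "\<And>x. x \<in> S \<Longrightarrow> \<phi> x \<in> carrier A" "Poly_Mapping.keys p \<subseteq> S"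
  shows "comb A \<phi> p \<in> carrier A"
  unfolding comb_def using assms by (intro finsum_closed) auto

lemma dual_comb:
  assumes "\<psi> \<in> dual A" "\<And>x. x \<in> S \<Longrightarrow> \<phi> x \<in> carrier A" "Poly_Mapping.keys p \<subseteq> S"
  shows "\<psi> (comb A \<phi> p) = lincomb (\<lambda>x. \<psi> (\<phi> x)) p"
proof -
  have "\<phi> x \<in> carrier A" if "x \<in> Poly_Mapping.keys p" for x using assms that by auto
  then show ?thesis
    using assms(1) by (simp add: comb_def lincomb_def dual_finsum dual_smult)
qed

lemma comb_single: "\<phi> x \<in> carrier A \<Longrightarrow> comb A \<phi> (Poly_Mapping.single x c) = c \<odot> \<phi> x"
  using comb_closed[of "{x}" \<phi> "Poly_Mapping.single x c"]
    dual_comb[of _ "{x}" \<phi> "Poly_Mapping.single x c"]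
  by (intro dual_separates) (auto simp: dual_smult)

lemma smult_one: "x \<in> carrier A \<Longrightarrow> 1 \<odot> x = x"
  by (rule dual_separates) (auto simp: dual_smult)

end

context quotient_algebra begin

text \<open>If every functional of the target, composed with the linear extension of \<open>\<phi>\<close>, kills
  the ideal, then the extension itself is constant on cosets, since functionals separate points.\<close>

lemma
  assumes M: "linear_space M" and S: "carrier R = {p. Poly_Mapping.keys p \<subseteq> S}"
    and \<phi>: "\<And>x. x \<in> S \<Longrightarrow> \<phi> x \<in> carrier M"
    and van: "\<And>\<psi> i. \<psi> \<in> dual M \<Longrightarrow> i \<in> I \<Longrightarrow> lincomb (\<lambda>x. \<psi> (\<phi> x)) i = 0"
  shows lin_lift_cls: "p \<in> carrier R \<Longrightarrow> lin_lift M \<phi> (cls p) = comb M \<phi> p"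
    and linear_map_lin_lift: "linear_map Q M (lin_lift M \<phi>)"
proof -
  interpret M: linear_space M by (rule M)
  have closed: "p \<in> carrier R \<Longrightarrow> comb M \<phi> p \<in> carrier M" for p
    using S \<phi> by (intro M.comb_closed[of S]) auto
  have dual: "\<psi> \<in> dual M \<Longrightarrow> p \<in> carrier R \<Longrightarrow> \<psi> (comb M \<phi> p) = lincomb (\<lambda>x. \<psi> (\<phi> x)) p" for \<psi> p
    using S \<phi> by (intro M.dual_comb[of _ S]) auto
  have lift: "lin_lift M \<phi> (cls p) = comb M \<phi> p" if p: "p \<in> carrier R" for p
  proof -
    have "comb M \<phi> q = comb M \<phi> p" if "q \<in> cls p" for q
    proof (rule M.dual_separates)
      have q: "q \<in> carrier R" using that p cls_mem_carrier by blast
      then show "comb M \<phi> q \<in> carrier M" by (rule closed)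
      show "comb M \<phi> p \<in> carrier M" using p by (rule closed)
      show "\<psi> (comb M \<phi> q) = \<psi> (comb M \<phi> p)" if "\<psi> \<in> dual M" for \<psi>
        using van[OF that, of "q - p"] \<open>q \<in> cls p\<close> that q p by (simp add: mem_cls dual lincomb_diff)
    qed
    moreover have "p \<in> cls p" using I_subspace by (simp add: mem_cls fs.subspace_0)
    ultimately have "comb M \<phi> ` cls p = {comb M \<phi> p}" by blast
    then show ?thesis by (simp add: lin_lift_def comb_def[abs_def])
  qed
  show "p \<in> carrier R \<Longrightarrow> lin_lift M \<phi> (cls p) = comb M \<phi> p" by (rule lift)
  show "linear_map Q M (lin_lift M \<phi>)"
  proof (rule linear_mapI[OF M linear_space_Q])
    show "lin_lift M \<phi> x \<in> carrier M" if "x \<in> carrier Q" for x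
      using that by (auto simp: cls_carrier lift closed)
    show "lin_lift M \<phi> (x \<oplus>\<^bsub>Q\<^esub> y) = lin_lift M \<phi> x \<oplus>\<^bsub>M\<^esub> lin_lift M \<phi> y"
      if "x \<in> carrier Q" "y \<in> carrier Q" for x y
      using that by (intro M.dual_separates)
        (auto simp: cls_carrier lift closed cls_add R_closed dual_add dual lincomb_add)
    show "lin_lift M \<phi> (c \<odot>\<^bsub>Q\<^esub> x) = c \<odot>\<^bsub>M\<^esub> lin_lift M \<phi> x" if "x \<in> carrier Q" for c x
      using that by (intro M.dual_separates)
        (auto simp: cls_carrier lift closed cls_smult R_closed dual_smult dual lincomb_scale)
  qed
qed

end


section \<open>Quotients of free algebras\<close>

lemma free_alg_simps [simp]:
  "mult (free_alg \<delta> V) = (*)" "one (free_alg \<delta> V) = 1" "zero (free_alg \<delta> V) = 0"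
  "add (free_alg \<delta> V) = (+)" "smult (free_alg \<delta> V) = fscale"
  by (simp_all add: free_alg_def)

lemma carrier_free_alg: "carrier (free_alg \<delta> V) = {p. Poly_Mapping.keys p \<subseteq> {w. set (letters w) \<subseteq> V}}"
  by (auto simp: free_alg_def)

lemma letters_plus [simp]: "letters (u + v) = letters u @ letters v"
  and letters_zero [simp]: "letters 0 = []"
  by (simp_all add: plus_mword_def zero_mword_def)

lemma free_alg_closed:
  "p \<in> carrier (free_alg \<delta> V) \<Longrightarrow> q \<in> carrier (free_alg \<delta> V) \<Longrightarrow> p + q \<in> carrier (free_alg \<delta> V)"
  "p \<in> carrier (free_alg \<delta> V) \<Longrightarrow> q \<in> carrier (free_alg \<delta> V) \<Longrightarrow> p - q \<in> carrier (free_alg \<delta> V)"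
  "p \<in> carrier (free_alg \<delta> V) \<Longrightarrow> fscale c p \<in> carrier (free_alg \<delta> V)"
  "p \<in> carrier (free_alg \<delta> V) \<Longrightarrow> q \<in> carrier (free_alg \<delta> V) \<Longrightarrow> p * q \<in> carrier (free_alg \<delta> V)"
  "0 \<in> carrier (free_alg \<delta> V)" "1 \<in> carrier (free_alg \<delta> V)"
  "Poly_Mapping.single w c \<in> carrier (free_alg \<delta> V) \<longleftrightarrow> c = 0 \<or> set (letters w) \<subseteq> V"
proof -
  note sub = subspace_supported[of "{w. set (letters w) \<subseteq> V}"]
  show "p \<in> carrier (free_alg \<delta> V) \<Longrightarrow> q \<in> carrier (free_alg \<delta> V) \<Longrightarrow> p + q \<in> carrier (free_alg \<delta> V)"
    unfolding carrier_free_alg by (rule fs.subspace_add[OF sub])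
  show "p \<in> carrier (free_alg \<delta> V) \<Longrightarrow> q \<in> carrier (free_alg \<delta> V) \<Longrightarrow> p - q \<in> carrier (free_alg \<delta> V)"
    unfolding carrier_free_alg by (rule fs.subspace_diff[OF sub])
  show "p \<in> carrier (free_alg \<delta> V) \<Longrightarrow> fscale c p \<in> carrier (free_alg \<delta> V)"
    unfolding carrier_free_alg by (rule fs.subspace_scale[OF sub])
  show "0 \<in> carrier (free_alg \<delta> V)" by (simp add: carrier_free_alg)
  show "p \<in> carrier (free_alg \<delta> V) \<Longrightarrow> q \<in> carrier (free_alg \<delta> V) \<Longrightarrow> p * q \<in> carrier (free_alg \<delta> V)"
    unfolding carrier_free_alg using keys_mult[of p q] by fastforce
  show "1 \<in> carrier (free_alg \<delta> V)" by (simp add: carrier_free_alg)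
  show "Poly_Mapping.single w c \<in> carrier (free_alg \<delta> V) \<longleftrightarrow> c = 0 \<or> set (letters w) \<subseteq> V"
    by (auto simp: carrier_free_alg)
qed

lemma free_gen_closed: "x \<in> V \<Longrightarrow> free_gen x \<in> carrier (free_alg \<delta> V)"
  by (simp add: free_gen_def free_alg_closed)

lemma ring_free_alg: "ring (free_alg \<delta> V)"
proof (rule ringI)
  show "abelian_group (free_alg \<delta> V)"
  proof (rule abelian_groupI)
    show "\<exists>y\<in>carrier (free_alg \<delta> V). y \<oplus>\<^bsub>free_alg \<delta> V\<^esub> x = \<zero>\<^bsub>free_alg \<delta> V\<^esub>"
      if "x \<in> carrier (free_alg \<delta> V)" for x
      by (rule bexI[of _ "- x"]) (use free_alg_closed(2)[OF free_alg_closed(5) that] in auto)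
  qed (auto simp: free_alg_closed algebra_simps)
  show "monoid (free_alg \<delta> V)"
    by (rule monoidI) (auto simp: free_alg_closed algebra_simps)
qed (auto simp: algebra_simps)

definition word_degree :: "('x \<Rightarrow> bit) \<Rightarrow> 'x mword \<Rightarrow> bit" where
  "word_degree \<delta> w = sum_list (map \<delta> (letters w))"

lemma lookup_hcomp_free_alg:
  "Poly_Mapping.lookup (hcomp (free_alg \<delta> V) k p) w = (if word_degree \<delta> w = k then Poly_Mapping.lookup p w else 0)"
proof -
  let ?K = "{w. w \<in> Poly_Mapping.keys p \<and> word_degree \<delta> w = k}"
  have "Poly_Mapping.lookup (hcomp (free_alg \<delta> V) k p) w
      = (\<Sum>v\<in>?K. if v = w then Poly_Mapping.lookup p v else 0)"
    by (simp add: free_alg_def lookup_sum lookup_single when_def word_degree_def)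
  also have "\<dots> = (if word_degree \<delta> w = k then Poly_Mapping.lookup p w else 0)"
    by (subst sum.delta) (auto simp: in_keys_iff)
  finally show ?thesis .
qed

lemma hcomp_free_alg_add: "hcomp (free_alg \<delta> V) k (p + q) = hcomp (free_alg \<delta> V) k p + hcomp (free_alg \<delta> V) k q"
  by (rule poly_mapping_eqI) (simp add: lookup_hcomp_free_alg lookup_add)

lemma hcomp_free_alg_diff: "hcomp (free_alg \<delta> V) k (p - q) = hcomp (free_alg \<delta> V) k p - hcomp (free_alg \<delta> V) k q"
  by (rule poly_mapping_eqI) (simp add: lookup_hcomp_free_alg lookup_minus)

lemma hcomp_free_alg_scale: "hcomp (free_alg \<delta> V) k (fscale c p) = fscale c (hcomp (free_alg \<delta> V) k p)"
  by (rule poly_mapping_eqI) (simp add: lookup_hcomp_free_alg)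

lemma hcomp_free_alg_zero: "hcomp (free_alg \<delta> V) k 0 = 0"
  by (rule poly_mapping_eqI) (simp add: lookup_hcomp_free_alg)

lemma hcomp_free_alg_single:
  "hcomp (free_alg \<delta> V) k (Poly_Mapping.single w c) = (if word_degree \<delta> w = k then Poly_Mapping.single w c else 0)"
  by (rule poly_mapping_eqI) (auto simp: lookup_hcomp_free_alg lookup_single when_def)

lemma hcomp_free_alg_closed:
  "p \<in> carrier (free_alg \<delta> V) \<Longrightarrow> hcomp (free_alg \<delta> V) k p \<in> carrier (free_alg \<delta> V)"
  by (auto simp: carrier_free_alg in_keys_iff lookup_hcomp_free_alg split: if_splits)

lemma hcomp_free_alg_mult:
  "hcomp (free_alg \<delta> V) k (p * q)
     = hcomp (free_alg \<delta> V) 0 p * hcomp (free_alg \<delta> V) k q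
     + hcomp (free_alg \<delta> V) 1 p * hcomp (free_alg \<delta> V) (k + 1) q"
proof (rule supported_induct[of p UNIV])
  fix u :: "'a mword" and c
  show "hcomp (free_alg \<delta> V) k (Poly_Mapping.single u c * q)
     = hcomp (free_alg \<delta> V) 0 (Poly_Mapping.single u c) * hcomp (free_alg \<delta> V) k q
     + hcomp (free_alg \<delta> V) 1 (Poly_Mapping.single u c) * hcomp (free_alg \<delta> V) (k + 1) q"
  proof (rule supported_induct[of q UNIV])
    fix v :: "'a mword" and d
    have deg: "word_degree \<delta> (u + v) = word_degree \<delta> u + word_degree \<delta> v"
      by (simp add: word_degree_def)
    show "hcomp (free_alg \<delta> V) k (Poly_Mapping.single u c * Poly_Mapping.single v d)
     = hcomp (free_alg \<delta> V) 0 (Poly_Mapping.single u c) * hcomp (free_alg \<delta> V) k (Poly_Mapping.single v d)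
     + hcomp (free_alg \<delta> V) 1 (Poly_Mapping.single u c) * hcomp (free_alg \<delta> V) (k + 1) (Poly_Mapping.single v d)"
      by (cases "word_degree \<delta> u"; cases "word_degree \<delta> v"; cases k)
        (auto simp: mult_single hcomp_free_alg_single deg)
  qed (simp_all add: hcomp_free_alg_add hcomp_free_alg_zero algebra_simps)
qed (simp_all add: hcomp_free_alg_add hcomp_free_alg_zero algebra_simps)

lemma free_ideal_subspace:
  assumes "ideal I (free_alg \<delta> V)" shows "fs.subspace I"
proof -
  interpret ideal I "free_alg \<delta> V" by fact
  show ?thesis
  proof (rule fs.subspaceI)
    show "0 \<in> I" using additive_subgroup.zero_closed[OF is_additive_subgroup] by simp
    show "p + q \<in> I" if "p \<in> I" "q \<in> I" for p q using additive_subgroup.a_closed[OF is_additive_subgroup that] by simp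
    show "fscale c p \<in> I" if "p \<in> I" for c p
    proof -
      have "fscale c 1 * p \<in> I"
        using I_l_closed[OF that, of "fscale c 1"] by (simp add: free_alg_closed)
      then show ?thesis by (simp add: fscale_mult_left)
    qed
  qed
qed

lemma free_alg_idealI:
  assumes "I \<subseteq> carrier (free_alg \<delta> V)" "fs.subspace I"
    and "\<And>i p. i \<in> I \<Longrightarrow> p \<in> carrier (free_alg \<delta> V) \<Longrightarrow> i * p \<in> I \<and> p * i \<in> I"
  shows "ideal I (free_alg \<delta> V)"
proof (rule idealI[OF ring_free_alg])
  interpret F: ring "free_alg \<delta> V" by (rule ring_free_alg)
  have "a_inv (free_alg \<delta> V) x = - x" if "x \<in> carrier (free_alg \<delta> V)" for x
    using that by (intro F.minus_equality) (use free_alg_closed(2)[OF free_alg_closed(5) that] in auto)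
  then have "inv\<^bsub>add_monoid (free_alg \<delta> V)\<^esub> x = - x" if "x \<in> carrier (free_alg \<delta> V)" for x
    using that by (simp add: a_inv_def del: free_alg_simps)
  then show "subgroup I (add_monoid (free_alg \<delta> V))"
    using assms(1) fs.subspace_add[OF assms(2)] fs.subspace_0[OF assms(2)] fs.subspace_neg[OF assms(2)]
    by (intro subgroup.intro) (auto simp: subset_iff)
qed (use assms(3) in auto)

text \<open>The elements of the ideal whose homogeneous components all lie in the ideal form an ideal
  themselves. It contains the homogeneous generators, hence everything, and so the grading
  descends to the quotient.\<close>

lemma quotient_algebra_free:
  fixes S and \<delta> :: "'a \<Rightarrow> bit" and V defines "I \<equiv> genideal (free_alg \<delta> V) S"
  assumes S: "S \<subseteq> carrier (free_alg \<delta> V)"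
    and h: "\<And>s k. s \<in> S \<Longrightarrow> hcomp (free_alg \<delta> V) k s \<in> {s, 0}"
  shows "quotient_algebra (free_alg \<delta> V) I"
proof -
  let ?F = "free_alg \<delta> V" and ?h = "hcomp (free_alg \<delta> V)"
  interpret F: ring ?F by (rule ring_free_alg)
  interpret I: ideal I ?F unfolding I_def by (rule F.genideal_ideal[OF S])
  have sub: "fs.subspace I" by (rule free_ideal_subspace) (rule I.ideal_axioms)
  have IF: "I \<subseteq> carrier ?F" using I.a_subset .
  have mult: "i * p \<in> I" "p * i \<in> I" if "i \<in> I" "p \<in> carrier ?F" for i p
    using I.I_l_closed[OF that] I.I_r_closed[OF that] by simp_all
  have hI: "?h k i \<in> I" if "i \<in> I" for k i
  proof -
    let ?J = "{p \<in> I. \<forall>k. ?h k p \<in> I}"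
    have "ideal ?J ?F"
    proof (rule free_alg_idealI)
      show "?J \<subseteq> carrier ?F" using IF by auto
      show "fs.subspace ?J" using sub
        by (auto intro!: fs.subspaceI simp: hcomp_free_alg_add hcomp_free_alg_zero hcomp_free_alg_scale
            fs.subspace_add fs.subspace_0 fs.subspace_scale)
      fix i p assume ip: "i \<in> ?J" "p \<in> carrier ?F"
      then show "i * p \<in> ?J \<and> p * i \<in> ?J"
        by (auto simp: mult hcomp_free_alg_mult hcomp_free_alg_closed intro!: fs.subspace_add[OF sub])
    qed
    moreover have "S \<subseteq> ?J"
    proof
      fix s assume s: "s \<in> S"
      then have "s \<in> I" using F.genideal_self[OF S] unfolding I_def by blast
      moreover have "?h k s \<in> I" for k
        using h[OF s, of k] \<open>s \<in> I\<close> fs.subspace_0[OF sub] by (metis insertE singletonD)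
      ultimately show "s \<in> ?J" by blast
    qed
    ultimately have "I \<subseteq> ?J" unfolding I_def by (rule F.genideal_minimal)
    then show ?thesis using that by auto
  qed
  show ?thesis
    by unfold_locales
      (use sub IF in \<open>auto simp: carrier_free_alg[symmetric] free_alg_closed algebra_simps fscale_mult_left
        fscale_mult_right hcomp_free_alg_closed hcomp_free_alg_add hcomp_free_alg_scale mult hI
        intro: fs.subspaceI\<close>)
qed

lemma (in assoc_algebra) foldr_mult_append:
  assumes "\<And>x. x \<in> set xs \<union> set ys \<Longrightarrow> f x \<in> carrier A"
  shows "foldr (\<lambda>x y. f x \<otimes> y) xs \<one> \<in> carrier A"
    and "foldr (\<lambda>x y. f x \<otimes> y) (xs @ ys) \<one> = foldr (\<lambda>x y. f x \<otimes> y) xs \<one> \<otimes> foldr (\<lambda>x y. f x \<otimes> y) ys \<one>"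
proof -
  have closed: "foldr (\<lambda>x y. f x \<otimes> y) zs \<one> \<in> carrier A" if "set zs \<subseteq> set xs \<union> set ys" for zs
    using that by (induction zs) (auto intro!: mult_closed assms)
  show "foldr (\<lambda>x y. f x \<otimes> y) xs \<one> \<in> carrier A" by (rule closed) auto
  have "foldr (\<lambda>x y. f x \<otimes> y) (zs @ ys) \<one> = foldr (\<lambda>x y. f x \<otimes> y) zs \<one> \<otimes> foldr (\<lambda>x y. f x \<otimes> y) ys \<one>"
    if "set zs \<subseteq> set xs \<union> set ys" for zs
    using that by (induction zs) (auto simp: closed mult_assoc assms)
  then show "foldr (\<lambda>x y. f x \<otimes> y) (xs @ ys) \<one> = foldr (\<lambda>x y. f x \<otimes> y) xs \<one> \<otimes> foldr (\<lambda>x y. f x \<otimes> y) ys \<one>"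
    by simp
qed

text \<open>The extension of \<open>f\<close> to words is multiplicative because \<open>M\<close> is associative. Its kernel
  is then an ideal, and contains the ideal generated by the relations as soon as it contains the
  relations.\<close>

lemma alg_lift_free:
  fixes S and \<delta> :: "'a \<Rightarrow> bit" and V defines "I \<equiv> genideal (free_alg \<delta> V) S"
  assumes S: "S \<subseteq> carrier (free_alg \<delta> V)"
    and h: "\<And>s k. s \<in> S \<Longrightarrow> hcomp (free_alg \<delta> V) k s \<in> {s, 0}"
    and M: "assoc_algebra M" and f: "\<And>x. x \<in> V \<Longrightarrow> f x \<in> carrier M"
    and rel: "\<And>s \<psi>. s \<in> S \<Longrightarrow> \<psi> \<in> dual M \<Longrightarrow>
      lincomb (\<lambda>w. \<psi> (foldr (\<lambda>x y. f x \<otimes>\<^bsub>M\<^esub> y) (letters w) \<one>\<^bsub>M\<^esub>)) s = 0"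
  shows linear_map_alg_lift: "linear_map (quot_alg (free_alg \<delta> V) I) M (alg_lift M f)"
    and alg_lift_word: "set xs \<subseteq> V \<Longrightarrow> alg_lift M f (I +>\<^bsub>free_alg \<delta> V\<^esub> Poly_Mapping.single (MWord xs) 1)
      = foldr (\<lambda>x y. f x \<otimes>\<^bsub>M\<^esub> y) xs \<one>\<^bsub>M\<^esub>"
proof -
  let ?F = "free_alg \<delta> V"
  let ?\<phi> = "\<lambda>w. foldr (\<lambda>x y. f x \<otimes>\<^bsub>M\<^esub> y) (letters w) \<one>\<^bsub>M\<^esub>"
  let ?W = "{w :: 'a mword. set (letters w) \<subseteq> V}"
  interpret F: ring ?F by (rule ring_free_alg)
  interpret M: assoc_algebra M by (rule M)
  interpret q: quotient_algebra ?F I unfolding I_def by (rule quotient_algebra_free[OF S h])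
  have \<phi>: "?\<phi> w \<in> carrier M" if "w \<in> ?W" for w
    using that M.foldr_mult_append(1)[of "letters w" "[]" f] f by auto
  have \<phi>_mult: "?\<phi> (u + v) = ?\<phi> u \<otimes>\<^bsub>M\<^esub> ?\<phi> v" if "u \<in> ?W" "v \<in> ?W" for u v
    using that M.foldr_mult_append(2)[of "letters u" "letters v" f] f by auto
  have closed: "comb M ?\<phi> p \<in> carrier M" if "p \<in> carrier ?F" for p
    by (rule M.comb_closed[of ?W]) (use that \<phi> in \<open>auto simp: carrier_free_alg\<close>)
  have dual: "\<psi> (comb M ?\<phi> p) = lincomb (\<lambda>w. \<psi> (?\<phi> w)) p" if "\<psi> \<in> dual M" "p \<in> carrier ?F" for \<psi> p
    by (rule M.dual_comb[of _ ?W]) (use that \<phi> in \<open>auto simp: carrier_free_alg\<close>)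
  have mult: "comb M ?\<phi> (p * q) = comb M ?\<phi> p \<otimes>\<^bsub>M\<^esub> comb M ?\<phi> q"
    if "p \<in> carrier ?F" "q \<in> carrier ?F" for p q
  proof (rule M.dual_separates)
    fix \<psi> assume \<psi>: "\<psi> \<in> dual M"
    have pq: "Poly_Mapping.keys p \<subseteq> ?W" "Poly_Mapping.keys q \<subseteq> ?W"
      using that by (auto simp: carrier_free_alg)
    have \<psi>l: "(\<lambda>x. \<psi> (x \<otimes>\<^bsub>M\<^esub> y)) \<in> dual M" if "y \<in> carrier M" for y
      using linear_map_dual[OF M.linear_mult_left[OF that] \<psi>] .
    have \<psi>r: "(\<lambda>y. \<psi> (x \<otimes>\<^bsub>M\<^esub> y)) \<in> dual M" if "x \<in> carrier M" for x
      using linear_map_dual[OF M.linear_mult_right[OF that] \<psi>] .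
    have "lincomb (\<lambda>w. \<psi> (?\<phi> w)) (p * q) = lincomb (\<lambda>u. lincomb (\<lambda>v. \<psi> (?\<phi> u \<otimes>\<^bsub>M\<^esub> ?\<phi> v)) q) p"
      using pq(1)
    proof (induction p rule: supported_induct)
      case (single u c)
      from pq(2) show ?case
      proof (induction q rule: supported_induct)
        case (single v d)
        then show ?case using \<phi>_mult[OF \<open>u \<in> ?W\<close>, of v] by (simp add: mult_single algebra_simps del: letters_plus)
      qed (simp_all add: lincomb_add algebra_simps)
    qed (simp_all add: lincomb_add algebra_simps)
    also have "\<dots> = lincomb (\<lambda>u. \<psi> (?\<phi> u \<otimes>\<^bsub>M\<^esub> comb M ?\<phi> q)) p"
      unfolding lincomb_def[of _ p]
      by (rule sum.cong) (use pq(1) that in \<open>auto simp: dual[OF \<psi>r] \<phi> subset_iff\<close>)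
    also have "\<dots> = \<psi> (comb M ?\<phi> p \<otimes>\<^bsub>M\<^esub> comb M ?\<phi> q)"
      using dual[OF \<psi>l[OF closed[OF that(2)]] that(1)] by simp
    finally show "\<psi> (comb M ?\<phi> (p * q)) = \<psi> (comb M ?\<phi> p \<otimes>\<^bsub>M\<^esub> comb M ?\<phi> q)"
      using that by (simp add: dual[OF \<psi>] free_alg_closed)
  qed (use that in \<open>auto simp: closed free_alg_closed\<close>)
  let ?K = "{p \<in> carrier ?F. comb M ?\<phi> p = \<zero>\<^bsub>M\<^esub>}"
  have K: "p \<in> ?K \<longleftrightarrow> p \<in> carrier ?F \<and> (\<forall>\<psi>\<in>dual M. lincomb (\<lambda>w. \<psi> (?\<phi> w)) p = 0)" for p
  proof
    assume "p \<in> ?K"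
    then show "p \<in> carrier ?F \<and> (\<forall>\<psi>\<in>dual M. lincomb (\<lambda>w. \<psi> (?\<phi> w)) p = 0)"
      using dual[of _ p] by (auto simp: dual_zero)
  next
    assume *: "p \<in> carrier ?F \<and> (\<forall>\<psi>\<in>dual M. lincomb (\<lambda>w. \<psi> (?\<phi> w)) p = 0)"
    then have "comb M ?\<phi> p = \<zero>\<^bsub>M\<^esub>"
      by (intro M.dual_separates) (auto simp: closed dual dual_zero)
    then show "p \<in> ?K" using * by simp
  qed
  have "ideal ?K ?F"
  proof (rule free_alg_idealI)
    show "fs.subspace ?K"
      by (rule fs.subspaceI) (auto simp only: K free_alg_closed lincomb_add lincomb_scale lincomb_zero add_0_left mult_zero_right)
    show "i * p \<in> ?K \<and> p * i \<in> ?K" if "i \<in> ?K" "p \<in> carrier ?F" for i p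
      using that by (auto simp: mult closed free_alg_closed)
  qed auto
  moreover have "S \<subseteq> ?K"
    using S rel K by blast
  ultimately have "I \<subseteq> ?K" unfolding I_def by (rule F.genideal_minimal)
  then have van: "lincomb (\<lambda>w. \<psi> (?\<phi> w)) i = 0" if "\<psi> \<in> dual M" "i \<in> I" for \<psi> i
    using that K by blast
  show "linear_map (quot_alg ?F I) M (alg_lift M f)"
    unfolding alg_lift_def
    by (rule q.linear_map_lin_lift[where \<phi> = ?\<phi>, OF M.linear_space_axioms carrier_free_alg \<phi> van])
  show "alg_lift M f (I +>\<^bsub>?F\<^esub> Poly_Mapping.single (MWord xs) 1) = foldr (\<lambda>x y. f x \<otimes>\<^bsub>M\<^esub> y) xs \<one>\<^bsub>M\<^esub>"
    if "set xs \<subseteq> V"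
    using q.lin_lift_cls[where \<phi> = ?\<phi>, OF M.linear_space_axioms carrier_free_alg \<phi> van, of "Poly_Mapping.single (MWord xs) 1"]
      \<phi>[of "MWord xs"] that
    by (simp add: alg_lift_def free_alg_closed M.comb_single M.smult_one)
qed

section \<open>Graded tensor products\<close>

lemma functional_ext:
  assumes "\<And>f. functional f \<Longrightarrow> f p = f q" shows "p = q"
proof (rule ccontr)
  assume "p \<noteq> q"
  then have "p - q \<notin> {0}" by simp
  then obtain f where "functional f" "f (p - q) \<noteq> 0"
    using functional_separating[of "{0}" "p - q"] by (auto intro: fs.subspaceI)
  then show False using assms[of f] by (simp add: functional_diff)
qed

lemma UNIV_bit: "(UNIV :: bit set) = {0, 1}"
  by (auto intro: bit.exhaust)

lemma functional_sum: "functional f \<Longrightarrow> f (sum g S) = (\<Sum>i\<in>S. f (g i))"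
  by (induction S rule: infinite_finite_induct) (auto simp: functional_zero functional_def)

lemma functional_single: "functional f \<Longrightarrow> f (Poly_Mapping.single x c) = c * f (Poly_Mapping.single x 1)"
  using functional_eq_lincomb[of f "Poly_Mapping.single x c"] by simp

lemma (in quotient_algebra) dual_cls_sum:
  assumes "\<psi> \<in> dual Q" "\<And>i. i \<in> S \<Longrightarrow> g i \<in> carrier R"
  shows "\<psi> (cls (sum g S)) = (\<Sum>i\<in>S. \<psi> (cls (g i)))"
  using assms(2)
proof (induction S rule: infinite_finite_induct)
  case (insert x F)
  then have "sum g F \<in> carrier R" by (intro fs.subspace_sum[OF R_subspace]) auto
  then show ?case using insert assms(1) by (simp add: dual_add flip: cls_add)
qed (use assms(1) in \<open>simp_all add: dual_zero flip: Q_zero\<close>)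

locale tensor_factors = A: linear_algebra A + B: linear_algebra B
  for A :: "'a superalgebra" and B :: "'b superalgebra"
begin

abbreviation P where "P \<equiv> pre_gtensor A B"
abbreviation I where "I \<equiv> gtensor_ideal A B"
abbreviation T where "T \<equiv> gtensor A B"
abbreviation tens where "tens \<equiv> gtens A B"

lemma carrier_P: "carrier P = {p. Poly_Mapping.keys p \<subseteq> carrier A \<times> carrier B}"
  by (simp add: pre_gtensor_def)

definition scalar_bilinear :: "('a \<times> 'b \<Rightarrow> complex) \<Rightarrow> bool" where
  "scalar_bilinear g \<longleftrightarrow> (\<forall>b\<in>carrier B. (\<lambda>a. g (a, b)) \<in> dual A) \<and> (\<forall>a\<in>carrier A. (\<lambda>b. g (a, b)) \<in> dual B)"

lemma scalar_bilinear_comp: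
  assumes "scalar_bilinear g" "linear_map A A h" "linear_map B B k"
  shows "scalar_bilinear (\<lambda>(a, b). g (h a, k b))"
  unfolding scalar_bilinear_def
proof (intro conjI ballI)
  fix b assume "b \<in> carrier B"
  then have "(\<lambda>a. g (a, k b)) \<in> dual A"
    using assms(1) linear_map_closed[OF assms(3)] by (simp add: scalar_bilinear_def)
  then show "(\<lambda>a. case (a, b) of (a, b) \<Rightarrow> g (h a, k b)) \<in> dual A"
    using linear_map_dual[OF assms(2)] by simp
next
  fix a assume "a \<in> carrier A"
  then have "(\<lambda>b. g (h a, b)) \<in> dual B"
    using assms(1) linear_map_closed[OF assms(2)] by (simp add: scalar_bilinear_def)
  then show "(\<lambda>b. case (a, b) of (a, b) \<Rightarrow> g (h a, k b)) \<in> dual B"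
    using linear_map_dual[OF assms(3)] by simp
qed

lemma scalar_bilinear_sum:
  assumes "\<And>i. i \<in> S \<Longrightarrow> scalar_bilinear (g i)"
  shows "scalar_bilinear (\<lambda>x. \<Sum>i\<in>S. c i * g i x)"
  using assms
  by (auto simp: scalar_bilinear_def dual_def sum.distrib distrib_left sum_distrib_left algebra_simps)

text \<open>The universal property of the tensor product for scalar values. It reduces every statement
  about the ideal of bilinearity relations to a statement about bilinear forms.\<close>

lemma bilinear_rels_vanish:
  assumes "functional f"
  shows "(\<forall>i\<in>I. f i = 0) \<longleftrightarrow> scalar_bilinear (\<lambda>x. f (Poly_Mapping.single x 1))"
    (is "_ \<longleftrightarrow> scalar_bilinear ?g")
proof
  note f = functional_diff[OF assms] functional_single[OF assms, of _ c for c]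
  assume f0: "\<forall>i\<in>I. f i = 0"
  have rel: "f i = 0" if "i \<in> bilinear_rels A B" for i
    using f0 that fs.span_base[of i "bilinear_rels A B"] by (simp add: gtensor_ideal_def)
  have addA: "?g (a \<oplus>\<^bsub>A\<^esub> a', b) = ?g (a, b) + ?g (a', b)"
    if "a \<in> carrier A" "a' \<in> carrier A" "b \<in> carrier B" for a a' b
  proof -
    have "f (Poly_Mapping.single (a \<oplus>\<^bsub>A\<^esub> a', b) 1 - Poly_Mapping.single (a, b) 1 - Poly_Mapping.single (a', b) 1) = 0"
      by (rule rel) (use that in \<open>unfold bilinear_rels_def, blast\<close>)
    then show ?thesis unfolding functional_diff[OF assms] by (simp add: algebra_simps del: diff_diff_eq)
  qed
  have addB: "?g (a, b \<oplus>\<^bsub>B\<^esub> b') = ?g (a, b) + ?g (a, b')"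
    if "a \<in> carrier A" "b' \<in> carrier B" "b \<in> carrier B" for a b' b
  proof -
    have "f (Poly_Mapping.single (a, b \<oplus>\<^bsub>B\<^esub> b') 1 - Poly_Mapping.single (a, b) 1 - Poly_Mapping.single (a, b') 1) = 0"
      by (rule rel) (use that in \<open>unfold bilinear_rels_def, blast\<close>)
    then show ?thesis unfolding functional_diff[OF assms] by (simp add: algebra_simps del: diff_diff_eq)
  qed
  have scA: "?g (c \<odot>\<^bsub>A\<^esub> a, b) = c * ?g (a, b)" if "a \<in> carrier A" "b \<in> carrier B" for a b c
  proof -
    have "f (Poly_Mapping.single (c \<odot>\<^bsub>A\<^esub> a, b) 1 - Poly_Mapping.single (a, b) c) = 0"
      by (rule rel) (use that in \<open>unfold bilinear_rels_def, blast\<close>)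
    then show ?thesis using functional_single[OF assms, of "(a, b)" c] by (simp add: functional_diff[OF assms])
  qed
  have scB: "?g (a, c \<odot>\<^bsub>B\<^esub> b) = c * ?g (a, b)" if "a \<in> carrier A" "b \<in> carrier B" for a b c
  proof -
    have "f (Poly_Mapping.single (a, c \<odot>\<^bsub>B\<^esub> b) 1 - Poly_Mapping.single (a, b) c) = 0"
      by (rule rel) (use that in \<open>unfold bilinear_rels_def, blast\<close>)
    then show ?thesis using functional_single[OF assms, of "(a, b)" c] by (simp add: functional_diff[OF assms])
  qed
  have "0 \<odot>\<^bsub>A\<^esub> \<zero>\<^bsub>A\<^esub> = \<zero>\<^bsub>A\<^esub>"
    by (rule A.dual_separates) (auto simp: dual_smult dual_zero)
  then have zA: "?g (\<zero>\<^bsub>A\<^esub>, b) = 0" if "b \<in> carrier B" for b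
    using scA[of "\<zero>\<^bsub>A\<^esub>" b 0] that by simp
  have "0 \<odot>\<^bsub>B\<^esub> \<zero>\<^bsub>B\<^esub> = \<zero>\<^bsub>B\<^esub>"
    by (rule B.dual_separates) (auto simp: dual_smult dual_zero)
  then have zB: "?g (a, \<zero>\<^bsub>B\<^esub>) = 0" if "a \<in> carrier A" for a
    using scB[of a "\<zero>\<^bsub>B\<^esub>" 0] that by simp
  show "scalar_bilinear ?g"
    by (simp add: scalar_bilinear_def dual_def addA addB scA scB zA zB)
next
  assume g: "scalar_bilinear ?g"
  have "bilinear_rels A B \<subseteq> {p. f p = 0}"
  proof -
    have dA: "(\<lambda>a. ?g (a, b)) \<in> dual A" if "b \<in> carrier B" for b
      using g that by (simp add: scalar_bilinear_def)
    have dB: "(\<lambda>b. ?g (a, b)) \<in> dual B" if "a \<in> carrier A" for a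
      using g that by (simp add: scalar_bilinear_def)
    have sc: "f (Poly_Mapping.single (a, b) c) = c * ?g (a, b)" for a b c
      by (rule functional_single[OF assms])
    show ?thesis
      unfolding bilinear_rels_def
      by (auto simp: functional_diff[OF assms] dual_add[OF dA] dual_add[OF dB] dual_smult[OF dA] dual_smult[OF dB])
        (metis diff_self sc)+
  qed
  moreover have "fs.subspace {p. f p = 0}"
    using assms by (intro fs.subspaceI) (auto simp: functional_def functional_zero)
  ultimately have "I \<subseteq> {p. f p = 0}"
    unfolding gtensor_ideal_def by (intro fs.span_minimal)
  then show "\<forall>i\<in>I. f i = 0" by blast
qed

lemma lincomb_vanish:
  assumes "scalar_bilinear g" "i \<in> I" shows "lincomb g i = 0"
  using bilinear_rels_vanish[of "lincomb g"] assms by simp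

lemma mem_I_iff:
  "p \<in> I \<longleftrightarrow> (\<forall>g. scalar_bilinear g \<longrightarrow> lincomb g p = 0)"
proof
  assume *: "\<forall>g. scalar_bilinear g \<longrightarrow> lincomb g p = 0"
  show "p \<in> I"
  proof (rule ccontr)
    assume "p \<notin> I"
    moreover have "fs.subspace I" by (simp add: gtensor_ideal_def)
    ultimately obtain f where f: "functional f" "\<forall>i\<in>I. f i = 0" "f p \<noteq> 0"
      using functional_separating by blast
    then show False
      using * bilinear_rels_vanish[OF f(1)] functional_eq_lincomb[OF f(1), of p] by simp
  qed
qed (auto simp: lincomb_vanish)

text \<open>The product of two pure tensors, before passing to the quotient.\<close>

definition pure_mult :: "'a \<times> 'b \<Rightarrow> 'a \<times> 'b \<Rightarrow> 'a \<times> 'b \<Rightarrow>\<^sub>0 complex" where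
  "pure_mult x y = (\<Sum>(i, j)\<in>UNIV.
     Poly_Mapping.single (fst x \<otimes>\<^bsub>A\<^esub> hcomp A i (fst y), hcomp B j (snd x) \<otimes>\<^bsub>B\<^esub> snd y) (koszul_sign j i))"

lemma sum_bit: "(\<Sum>i\<in>UNIV. f (i :: bit)) = f 0 + (f 1 :: 'z::comm_monoid_add)"
  by (simp add: UNIV_bit)

lemma sum_bit2: "(\<Sum>(i, j)\<in>UNIV. f (i :: bit) (j :: bit)) = f 0 0 + f 0 1 + (f 1 0 + (f 1 1 :: 'z::comm_monoid_add))"
  by (simp add: UNIV_Times_UNIV[symmetric] UNIV_bit sum.cartesian_product[symmetric] add.assoc del: UNIV_Times_UNIV)

lemma functional_mult:
  assumes "functional f"
  shows "f (p \<otimes>\<^bsub>P\<^esub> q) = lincomb (\<lambda>x. lincomb (\<lambda>y. f (pure_mult x y)) q) p"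
proof -
  have "f (p \<otimes>\<^bsub>P\<^esub> q) = (\<Sum>x\<in>Poly_Mapping.keys p. \<Sum>y\<in>Poly_Mapping.keys q.
      f (\<Sum>i\<in>{0, 1}. \<Sum>j\<in>{0, 1}. Poly_Mapping.single (fst x \<otimes>\<^bsub>A\<^esub> hcomp A i (fst y), hcomp B j (snd x) \<otimes>\<^bsub>B\<^esub> snd y)
        (koszul_sign j i * Poly_Mapping.lookup p x * Poly_Mapping.lookup q y)))"
    by (simp add: pre_gtensor_def functional_sum[OF assms] case_prod_beta)
  also have "\<dots> = (\<Sum>x\<in>Poly_Mapping.keys p. \<Sum>y\<in>Poly_Mapping.keys q.
      Poly_Mapping.lookup p x * (Poly_Mapping.lookup q y * f (pure_mult x y)))"
  proof (intro sum.cong refl)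
    fix x y
    let ?m = "\<lambda>i j. (fst x \<otimes>\<^bsub>A\<^esub> hcomp A i (fst y), hcomp B j (snd x) \<otimes>\<^bsub>B\<^esub> snd y)"
    let ?pq = "Poly_Mapping.lookup p x * Poly_Mapping.lookup q y"
    have "(\<Sum>i\<in>{0, 1}. \<Sum>j\<in>{0, 1}. Poly_Mapping.single (?m i j)
        (koszul_sign j i * Poly_Mapping.lookup p x * Poly_Mapping.lookup q y)) = fscale ?pq (pure_mult x y)"
      by (simp add: pure_mult_def sum_bit2 fs.scale_right_distrib mult.commute mult.left_commute add.assoc)
    then show "f (\<Sum>i\<in>{0, 1}. \<Sum>j\<in>{0, 1}. Poly_Mapping.single (?m i j)
        (koszul_sign j i * Poly_Mapping.lookup p x * Poly_Mapping.lookup q y))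
      = Poly_Mapping.lookup p x * (Poly_Mapping.lookup q y * f (pure_mult x y))"
      using assms by (simp add: functional_def)
  qed
  finally show ?thesis by (simp add: lincomb_def sum_distrib_left)
qed

lemma lincomb_pure_mult:
  "lincomb g (pure_mult x y) = (\<Sum>(i, j)\<in>UNIV. koszul_sign j i *
     g (fst x \<otimes>\<^bsub>A\<^esub> hcomp A i (fst y), hcomp B j (snd x) \<otimes>\<^bsub>B\<^esub> snd y))"
  by (simp add: pure_mult_def sum_bit2 lincomb_add)

lemma functional_hcomp:
  assumes "functional f"
  shows "f (hcomp P k p) = lincomb (\<lambda>x. \<Sum>i\<in>UNIV. f (Poly_Mapping.single (hcomp A i (fst x), hcomp B (k - i) (snd x)) 1)) p"
proof -
  have "f (hcomp P k p) = (\<Sum>x\<in>Poly_Mapping.keys p. \<Sum>i\<in>UNIV. f (Poly_Mapping.single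
      (hcomp A i (fst x), hcomp B (k - i) (snd x)) (Poly_Mapping.lookup p x)))"
    by (simp add: pre_gtensor_def functional_sum[OF assms] case_prod_beta UNIV_bit assms[unfolded functional_def])
  also have "\<dots> = lincomb (\<lambda>x. \<Sum>i\<in>UNIV. f (Poly_Mapping.single (hcomp A i (fst x), hcomp B (k - i) (snd x)) 1)) p"
    unfolding lincomb_def sum_distrib_left
    by (intro sum.cong refl) (rule functional_single[OF assms])
  finally show ?thesis .
qed

text \<open>For a bilinear form \<open>g\<close>, the value of \<open>g\<close> at a product, as a function of one of the
  factors, is a linear combination of bilinear forms, and so is its value at a homogeneous
  component. This makes the relations an ideal compatible with the grading.\<close>

sublocale quotient_algebra P I
proof
  note carrier_P[simp]
  note S = subspace_supported[of "carrier A \<times> carrier B"]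
  show "x \<oplus>\<^bsub>P\<^esub> y = x + y" "\<zero>\<^bsub>P\<^esub> = 0" "c \<odot>\<^bsub>P\<^esub> x = fscale c x" for x y c
    by (simp_all add: pre_gtensor_def)
  show subP: "fs.subspace (carrier P)" using S by simp
  show "fs.subspace I" by (simp add: gtensor_ideal_def)
  have "bilinear_rels A B \<subseteq> carrier P"
    unfolding bilinear_rels_def carrier_P
    by (auto dest!: keys_diff[THEN subsetD] split: if_splits)
  then show "I \<subseteq> carrier P"
    unfolding gtensor_ideal_def using S by (intro fs.span_minimal) simp_all
  show "\<one>\<^bsub>P\<^esub> \<in> carrier P" by (simp add: pre_gtensor_def)
  show "x \<otimes>\<^bsub>P\<^esub> y \<in> carrier P" if "x \<in> carrier P" "y \<in> carrier P" for x y
  proof -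
    have cx: "fst u \<in> carrier A \<and> snd u \<in> carrier B" if "u \<in> Poly_Mapping.keys x" for u
      using \<open>x \<in> carrier P\<close> that by auto
    have cy: "fst u \<in> carrier A \<and> snd u \<in> carrier B" if "u \<in> Poly_Mapping.keys y" for u
      using \<open>y \<in> carrier P\<close> that by auto
    have "x \<otimes>\<^bsub>P\<^esub> y = (\<Sum>u\<in>Poly_Mapping.keys x. \<Sum>v\<in>Poly_Mapping.keys y. \<Sum>i\<in>{0, 1}. \<Sum>j\<in>{0, 1}.
        Poly_Mapping.single (fst u \<otimes>\<^bsub>A\<^esub> hcomp A i (fst v), hcomp B j (snd u) \<otimes>\<^bsub>B\<^esub> snd v)
          (koszul_sign j i * Poly_Mapping.lookup x u * Poly_Mapping.lookup y v))"
      by (simp add: pre_gtensor_def case_prod_beta)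
    also have "\<dots> \<in> {p. Poly_Mapping.keys p \<subseteq> carrier A \<times> carrier B}"
      using cx cy by (intro fs.subspace_sum[OF S]) auto
    finally show ?thesis by simp
  qed
  show "(x + y) \<otimes>\<^bsub>P\<^esub> z = x \<otimes>\<^bsub>P\<^esub> z + y \<otimes>\<^bsub>P\<^esub> z" "fscale c x \<otimes>\<^bsub>P\<^esub> y = fscale c (x \<otimes>\<^bsub>P\<^esub> y)" for x y z c
    by (rule functional_ext, simp add: functional_mult lincomb_add lincomb_scale functional_def)+
  show "z \<otimes>\<^bsub>P\<^esub> (x + y) = z \<otimes>\<^bsub>P\<^esub> x + z \<otimes>\<^bsub>P\<^esub> y" for x y z
    by (rule functional_ext) (simp add: functional_mult lincomb_add functional_def
        lincomb_def[of _ z] distrib_left sum.distrib)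
  show "x \<otimes>\<^bsub>P\<^esub> fscale c y = fscale c (x \<otimes>\<^bsub>P\<^esub> y)" for x y c
    by (rule functional_ext) (simp add: functional_mult lincomb_scale functional_def
        lincomb_def[of _ x] sum_distrib_left mult.left_commute)
  show "hcomp P k (x + y) = hcomp P k x + hcomp P k y" "hcomp P k (fscale c x) = fscale c (hcomp P k x)" for k x y c
    by (rule functional_ext, simp add: functional_hcomp lincomb_add lincomb_scale functional_def)+
  show "hcomp P k x \<in> carrier P" if "x \<in> carrier P" for k x
  proof -
    have cx: "fst u \<in> carrier A \<and> snd u \<in> carrier B" if "u \<in> Poly_Mapping.keys x" for u
      using \<open>x \<in> carrier P\<close> that by auto
    have "hcomp P k x = (\<Sum>u\<in>Poly_Mapping.keys x. \<Sum>i\<in>{0, 1}.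
        Poly_Mapping.single (hcomp A i (fst u), hcomp B (k - i) (snd u)) (Poly_Mapping.lookup x u))"
      by (simp add: pre_gtensor_def case_prod_beta)
    also have "\<dots> \<in> {p. Poly_Mapping.keys p \<subseteq> carrier A \<times> carrier B}"
      using cx by (intro fs.subspace_sum[OF S]) auto
    finally show ?thesis by simp
  qed
  show "i \<otimes>\<^bsub>P\<^esub> y \<in> I" if i: "i \<in> I" and y: "y \<in> carrier P" for i y
    unfolding mem_I_iff
  proof (intro allI impI)
    fix g assume g: "scalar_bilinear g"
    have "lincomb g (i \<otimes>\<^bsub>P\<^esub> y) = lincomb (\<lambda>x. \<Sum>z\<in>Poly_Mapping.keys y. Poly_Mapping.lookup y z *
        (\<Sum>ij\<in>UNIV. koszul_sign (snd ij) (fst ij) *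
          g (fst x \<otimes>\<^bsub>A\<^esub> hcomp A (fst ij) (fst z), hcomp B (snd ij) (snd x) \<otimes>\<^bsub>B\<^esub> snd z))) i"
      by (simp add: functional_mult lincomb_pure_mult lincomb_def[of _ y] case_prod_beta)
    also have "\<dots> = 0"
      using y by (intro lincomb_vanish[OF _ i] scalar_bilinear_sum)
        (intro scalar_bilinear_comp[OF g, unfolded case_prod_beta]
          linear_map_comp[OF B.linear_hcomp B.linear_mult_left] A.linear_mult_left; force)
    finally show "lincomb g (i \<otimes>\<^bsub>P\<^esub> y) = 0" .
  qed
  show "y \<otimes>\<^bsub>P\<^esub> i \<in> I" if i: "i \<in> I" and y: "y \<in> carrier P" for i y
    unfolding mem_I_iff
  proof (intro allI impI)
    fix g assume g: "scalar_bilinear g"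
    have "lincomb g (y \<otimes>\<^bsub>P\<^esub> i) = (\<Sum>z\<in>Poly_Mapping.keys y. Poly_Mapping.lookup y z * lincomb (\<lambda>x.
        (\<Sum>ij\<in>UNIV. koszul_sign (snd ij) (fst ij) *
          g (fst z \<otimes>\<^bsub>A\<^esub> hcomp A (fst ij) (fst x), hcomp B (snd ij) (snd z) \<otimes>\<^bsub>B\<^esub> snd x))) i)"
      by (simp add: functional_mult lincomb_pure_mult lincomb_def[of _ y] case_prod_beta)
    also have "\<dots> = (\<Sum>z\<in>Poly_Mapping.keys y. Poly_Mapping.lookup y z * 0)"
    proof (intro sum.cong refl arg_cong2[where f = "(*)"])
      fix z assume "z \<in> Poly_Mapping.keys y"
      then show "lincomb (\<lambda>x.
        (\<Sum>ij\<in>UNIV. koszul_sign (snd ij) (fst ij) *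
          g (fst z \<otimes>\<^bsub>A\<^esub> hcomp A (fst ij) (fst x), hcomp B (snd ij) (snd z) \<otimes>\<^bsub>B\<^esub> snd x))) i = 0"
        using y by (intro lincomb_vanish[OF _ i] scalar_bilinear_sum)
        (intro scalar_bilinear_comp[OF g, unfolded case_prod_beta]
          linear_map_comp[OF A.linear_hcomp A.linear_mult_right] B.linear_mult_right; force)
    qed
    finally show "lincomb g (y \<otimes>\<^bsub>P\<^esub> i) = 0" by simp
  qed
  show "hcomp P k i \<in> I" if i: "i \<in> I" for k i
    unfolding mem_I_iff
  proof (intro allI impI)
    fix g assume g: "scalar_bilinear g"
    have "lincomb g (hcomp P k i) = lincomb (\<lambda>x. \<Sum>l\<in>UNIV. 1 * g (hcomp A l (fst x), hcomp B (k - l) (snd x))) i"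
      by (simp add: functional_hcomp)
    also have "\<dots> = 0"
      by (intro lincomb_vanish[OF _ i] scalar_bilinear_sum
          scalar_bilinear_comp[OF g, unfolded case_prod_beta] A.linear_hcomp B.linear_hcomp)
    finally show "lincomb g (hcomp P k i) = 0" .
  qed
qed

end

context tensor_factors begin

sublocale T: linear_algebra T
  using linear_algebra_Q by (simp add: gtensor_def)

lemma tens_cls: "tens a b = cls (Poly_Mapping.single (a, b) 1)"
  by (simp add: gtens_def)

lemma single_closed: "a \<in> carrier A \<Longrightarrow> b \<in> carrier B \<Longrightarrow> Poly_Mapping.single (a, b) c \<in> carrier P"
  by (simp add: carrier_P)

lemma tens_closed [simp, intro]: "a \<in> carrier A \<Longrightarrow> b \<in> carrier B \<Longrightarrow> tens a b \<in> carrier T"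
  using cls_closed[OF single_closed, of a b 1] by (simp add: tens_cls gtensor_def)

lemma one_T: "\<one>\<^bsub>T\<^esub> = tens \<one>\<^bsub>A\<^esub> \<one>\<^bsub>B\<^esub>"
  using cls_one by (simp add: tens_cls gtensor_def pre_gtensor_def)

lemma scalar_bilinear_add:
  assumes "scalar_bilinear g"
  shows "a \<in> carrier A \<Longrightarrow> a' \<in> carrier A \<Longrightarrow> b \<in> carrier B \<Longrightarrow> g (a \<oplus>\<^bsub>A\<^esub> a', b) = g (a, b) + g (a', b)"
    and "a \<in> carrier A \<Longrightarrow> b \<in> carrier B \<Longrightarrow> b' \<in> carrier B \<Longrightarrow> g (a, b \<oplus>\<^bsub>B\<^esub> b') = g (a, b) + g (a, b')"
  using assms dual_add[of "\<lambda>a. g (a, b)" A a a'] dual_add[of "\<lambda>b. g (a, b)" B b b']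
  by (auto simp: scalar_bilinear_def)

lemma scalar_bilinear_smult:
  assumes "scalar_bilinear g" "a \<in> carrier A" "b \<in> carrier B"
  shows "g (c \<odot>\<^bsub>A\<^esub> a, b) = c * g (a, b)" and "g (a, c \<odot>\<^bsub>B\<^esub> b) = c * g (a, b)"
  using assms dual_smult[of "\<lambda>a. g (a, b)" A a c] dual_smult[of "\<lambda>b. g (a, b)" B b c]
  by (auto simp: scalar_bilinear_def)

lemma linear_tens_left: "b \<in> carrier B \<Longrightarrow> linear_map A T (\<lambda>a. tens a b)"
proof (rule linear_mapI[OF T.linear_space_axioms A.linear_space_axioms])
  assume b: "b \<in> carrier B"
  show "tens a b \<in> carrier T" if "a \<in> carrier A" for a using that b by simp
  show "tens (a \<oplus>\<^bsub>A\<^esub> a') b = tens a b \<oplus>\<^bsub>T\<^esub> tens a' b" if "a \<in> carrier A" "a' \<in> carrier A" for a a'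
    using that b cls_add[of "Poly_Mapping.single (a, b) 1" "Poly_Mapping.single (a', b) 1"]
    by (simp add: tens_cls gtensor_def cls_eq_iff mem_I_iff lincomb_diff lincomb_add)
      (auto simp: scalar_bilinear_add)
  show "tens (c \<odot>\<^bsub>A\<^esub> a) b = c \<odot>\<^bsub>T\<^esub> tens a b" if "a \<in> carrier A" for a c
    using that b cls_smult[OF single_closed[OF that b, of 1], of c]
    by (simp add: tens_cls gtensor_def cls_eq_iff mem_I_iff lincomb_diff lincomb_add)
      (auto simp: scalar_bilinear_smult)
qed

lemma linear_tens_right: "a \<in> carrier A \<Longrightarrow> linear_map B T (\<lambda>b. tens a b)"
proof (rule linear_mapI[OF T.linear_space_axioms B.linear_space_axioms])
  assume a: "a \<in> carrier A"
  show "tens a b \<in> carrier T" if "b \<in> carrier B" for b using that a by simp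
  show "tens a (b \<oplus>\<^bsub>B\<^esub> b') = tens a b \<oplus>\<^bsub>T\<^esub> tens a b'" if "b \<in> carrier B" "b' \<in> carrier B" for b b'
    using that a cls_add[of "Poly_Mapping.single (a, b) 1" "Poly_Mapping.single (a, b') 1"]
    by (simp add: tens_cls gtensor_def cls_eq_iff mem_I_iff lincomb_diff lincomb_add)
      (auto simp: scalar_bilinear_add)
  show "tens a (c \<odot>\<^bsub>B\<^esub> b) = c \<odot>\<^bsub>T\<^esub> tens a b" if "b \<in> carrier B" for b c
    using that a cls_smult[OF single_closed[OF a that, of 1], of c]
    by (simp add: tens_cls gtensor_def cls_eq_iff mem_I_iff lincomb_diff lincomb_add)
      (auto simp: scalar_bilinear_smult)
qed

lemma dual_tens_mult:
  assumes "\<psi> \<in> dual T" "a \<in> carrier A" "a' \<in> carrier A" "b \<in> carrier B" "b' \<in> carrier B"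
  shows "\<psi> (tens a b \<otimes>\<^bsub>T\<^esub> tens a' b') =
    (\<Sum>(i, j)\<in>UNIV. koszul_sign j i * \<psi> (tens (a \<otimes>\<^bsub>A\<^esub> hcomp A i a') (hcomp B j b \<otimes>\<^bsub>B\<^esub> b')))"
proof -
  let ?p = "\<lambda>a b. Poly_Mapping.single (a, b) (1 :: complex)"
  have \<psi>: "\<psi> \<in> dual Q" using assms(1) by (simp add: gtensor_def)
  have "?p a b \<otimes>\<^bsub>P\<^esub> ?p a' b' = pure_mult (a, b) (a', b')"
    by (rule functional_ext) (simp add: functional_mult)
  then have "\<psi> (tens a b \<otimes>\<^bsub>T\<^esub> tens a' b') = \<psi> (cls (pure_mult (a, b) (a', b')))"
    using assms cls_mult[of "?p a b" "?p a' b'"] by (simp add: single_closed tens_cls gtensor_def)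
  also have "\<dots> = (\<Sum>(i, j)\<in>UNIV. \<psi> (cls (Poly_Mapping.single (a \<otimes>\<^bsub>A\<^esub> hcomp A i a', hcomp B j b \<otimes>\<^bsub>B\<^esub> b') (koszul_sign j i))))"
    unfolding pure_mult_def
    by (subst dual_cls_sum[OF \<psi>]) (use assms in \<open>auto simp: case_prod_beta intro!: single_closed\<close>)
  also have "\<dots> = (\<Sum>(i, j)\<in>UNIV. koszul_sign j i * \<psi> (tens (a \<otimes>\<^bsub>A\<^esub> hcomp A i a') (hcomp B j b \<otimes>\<^bsub>B\<^esub> b')))"
  proof (intro sum.cong refl, safe)
    fix i j
    let ?a = "a \<otimes>\<^bsub>A\<^esub> hcomp A i a'" and ?b = "hcomp B j b \<otimes>\<^bsub>B\<^esub> b'"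
    have "?p ?a ?b \<in> carrier P" using assms by (intro single_closed) auto
    then show "\<psi> (cls (Poly_Mapping.single (?a, ?b) (koszul_sign j i))) = koszul_sign j i * \<psi> (tens ?a ?b)"
      using cls_smult[of "?p ?a ?b" "koszul_sign j i"] dual_smult[OF \<psi> cls_closed, of "?p ?a ?b" "koszul_sign j i"]
      by (simp add: tens_cls)
  qed
  finally show ?thesis .
qed

lemma dual_hcomp_tens:
  assumes "\<psi> \<in> dual T" "a \<in> carrier A" "b \<in> carrier B"
  shows "\<psi> (hcomp T k (tens a b)) = (\<Sum>i\<in>UNIV. \<psi> (tens (hcomp A i a) (hcomp B (k - i) b)))"
proof -
  have \<psi>: "\<psi> \<in> dual Q" using assms(1) by (simp add: gtensor_def)
  have "hcomp P k (Poly_Mapping.single (a, b) 1) = (\<Sum>i\<in>UNIV. Poly_Mapping.single (hcomp A i a, hcomp B (k - i) b) 1)"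
    by (rule functional_ext) (simp add: functional_hcomp functional_sum)
  then have "\<psi> (hcomp T k (tens a b)) = \<psi> (cls (\<Sum>i\<in>UNIV. Poly_Mapping.single (hcomp A i a, hcomp B (k - i) b) 1))"
    using assms cls_hcomp[of "Poly_Mapping.single (a, b) 1" k] by (simp add: single_closed tens_cls gtensor_def)
  also have "\<dots> = (\<Sum>i\<in>UNIV. \<psi> (tens (hcomp A i a) (hcomp B (k - i) b)))"
    by (subst dual_cls_sum[OF \<psi>]) (use assms in \<open>auto simp: tens_cls intro!: single_closed\<close>)
  finally show ?thesis .
qed

text \<open>Pure tensors span the tensor product.\<close>

lemma tens_dual_ext:
  assumes "\<psi> \<in> dual T" "\<psi>' \<in> dual T" "x \<in> carrier T"
    and eq: "\<And>a b. a \<in> carrier A \<Longrightarrow> b \<in> carrier B \<Longrightarrow> \<psi> (tens a b) = \<psi>' (tens a b)"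
  shows "\<psi> x = \<psi>' x"
proof -
  have \<psi>: "\<psi> \<in> dual Q" "\<psi>' \<in> dual Q" using assms by (simp_all add: gtensor_def)
  obtain p where p: "x = cls p" "p \<in> carrier P"
    using assms(3) by (auto simp: gtensor_def cls_carrier)
  then have "Poly_Mapping.keys p \<subseteq> carrier A \<times> carrier B" by (simp add: carrier_P)
  then have "p \<in> carrier P \<and> \<psi> (cls p) = \<psi>' (cls p)"
  proof (induction p rule: supported_induct)
    case zero
    then show ?case using \<psi> by (auto simp: dual_zero R_closed simp flip: Q_zero)
  next
    case (add p q)
    then show ?case using \<psi> by (auto simp: dual_add R_closed simp flip: cls_add)
  next
    case (single x c)
    then obtain a b where x: "x = (a, b)" "a \<in> carrier A" "b \<in> carrier B" by auto
    have "\<psi> (cls (Poly_Mapping.single x c)) = c * \<psi> (tens a b)" if "\<psi> \<in> dual Q" for \<psi>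
      using that x cls_smult[of "Poly_Mapping.single x 1" c] dual_smult[OF that, of "tens a b" c]
      by (simp add: single_closed tens_cls)
    then show ?case using \<psi> eq x by (metis single_closed)
  qed
  then show ?thesis using p by simp
qed

lemma
  assumes M: "linear_space M"
    and l: "\<And>b. b \<in> carrier B \<Longrightarrow> linear_map A M (\<lambda>a. \<beta> a b)"
    and r: "\<And>a. a \<in> carrier A \<Longrightarrow> linear_map B M (\<lambda>b. \<beta> a b)"
  shows linear_map_gtens_lift: "linear_map T M (gtens_lift M \<beta>)"
    and gtens_lift_tens: "a \<in> carrier A \<Longrightarrow> b \<in> carrier B \<Longrightarrow> gtens_lift M \<beta> (tens a b) = \<beta> a b"
proof -
  interpret M: linear_space M by (rule M)
  let ?\<phi> = "\<lambda>(a, b). \<beta> a b"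
  have \<phi>: "?\<phi> x \<in> carrier M" if "x \<in> carrier A \<times> carrier B" for x
    using that linear_map_closed[OF l] by auto
  have van: "lincomb (\<lambda>x. \<psi> (?\<phi> x)) i = 0" if "\<psi> \<in> dual M" "i \<in> I" for \<psi> i
    by (rule lincomb_vanish[OF _ that(2)])
      (use that linear_map_dual[OF l] linear_map_dual[OF r] in \<open>auto simp: scalar_bilinear_def\<close>)
  show "linear_map T M (gtens_lift M \<beta>)"
    using linear_map_lin_lift[where \<phi> = ?\<phi>, OF M carrier_P \<phi> van] by (simp add: gtens_lift_def gtensor_def)
  show "gtens_lift M \<beta> (tens a b) = \<beta> a b" if ab: "a \<in> carrier A" "b \<in> carrier B"
    using lin_lift_cls[where \<phi> = ?\<phi>, OF M carrier_P \<phi> van single_closed[OF ab, of 1]] \<phi>[of "(a, b)"] ab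
    by (simp add: gtens_lift_def tens_cls M.comb_single M.smult_one)
qed

end

text \<open>When the first factor is even, no signs appear in the product of pure tensors. Associativity
  then follows by extending the identity from pure tensors in one argument after the other.\<close>

locale even_tensor = tensor_factors A B + A: assoc_algebra A + B: assoc_algebra B
  for A :: "'a superalgebra" and B :: "'b superalgebra" +
  assumes even_A: "a \<in> carrier A \<Longrightarrow> hcomp A i a = (if i = 0 then a else \<zero>\<^bsub>A\<^esub>)"
    and graded_B: "b \<in> carrier B \<Longrightarrow> hcomp B 0 b \<oplus>\<^bsub>B\<^esub> hcomp B 1 b = b"
begin

lemma tens_zero_left: "b \<in> carrier B \<Longrightarrow> tens \<zero>\<^bsub>A\<^esub> b = \<zero>\<^bsub>T\<^esub>"
  by (rule T.linear_map_zero[OF linear_tens_left A.linear_space_axioms])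

lemma tens_mult:
  assumes "a \<in> carrier A" "a' \<in> carrier A" "b \<in> carrier B" "b' \<in> carrier B"
  shows "tens a b \<otimes>\<^bsub>T\<^esub> tens a' b' = tens (a \<otimes>\<^bsub>A\<^esub> a') (b \<otimes>\<^bsub>B\<^esub> b')"
proof (rule T.dual_separates)
  fix \<psi> assume \<psi>: "\<psi> \<in> dual T"
  have "\<psi> (tens a b \<otimes>\<^bsub>T\<^esub> tens a' b')
    = \<psi> (tens (a \<otimes>\<^bsub>A\<^esub> a') (hcomp B 0 b \<otimes>\<^bsub>B\<^esub> b')) + \<psi> (tens (a \<otimes>\<^bsub>A\<^esub> a') (hcomp B 1 b \<otimes>\<^bsub>B\<^esub> b'))"
    using assms \<psi> by (simp add: dual_tens_mult sum_bit2 even_A koszul_sign_def tens_zero_left dual_zero)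
  also have "\<dots> = \<psi> (tens (a \<otimes>\<^bsub>A\<^esub> a') ((hcomp B 0 b \<oplus>\<^bsub>B\<^esub> hcomp B 1 b) \<otimes>\<^bsub>B\<^esub> b'))"
    using assms \<psi>
    by (simp add: B.mult_add_left dual_add[OF linear_map_dual[OF linear_tens_right]])
  finally show "\<psi> (tens a b \<otimes>\<^bsub>T\<^esub> tens a' b') = \<psi> (tens (a \<otimes>\<^bsub>A\<^esub> a') (b \<otimes>\<^bsub>B\<^esub> b'))"
    using assms by (simp add: graded_B)
qed (use assms in auto)

lemma hcomp_tens:
  assumes "a \<in> carrier A" "b \<in> carrier B"
  shows "hcomp T k (tens a b) = tens a (hcomp B k b)"
  by (rule T.dual_separates)
    (use assms in \<open>auto simp: dual_hcomp_tens sum_bit even_A tens_zero_left dual_zero\<close>)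

sublocale T: assoc_algebra T
proof
  note l = linear_map_dual[OF T.linear_mult_left] and r = linear_map_dual[OF T.linear_mult_right]
  show "x \<otimes>\<^bsub>T\<^esub> y \<otimes>\<^bsub>T\<^esub> z = x \<otimes>\<^bsub>T\<^esub> (y \<otimes>\<^bsub>T\<^esub> z)"
    if x: "x \<in> carrier T" and y: "y \<in> carrier T" and z: "z \<in> carrier T" for x y z
  proof (rule T.dual_separates)
    fix \<psi> assume \<psi>: "\<psi> \<in> dual T"
    have 1: "\<psi> (tens a b \<otimes>\<^bsub>T\<^esub> tens c d \<otimes>\<^bsub>T\<^esub> z) = \<psi> (tens a b \<otimes>\<^bsub>T\<^esub> (tens c d \<otimes>\<^bsub>T\<^esub> z))"
      if "a \<in> carrier A" "b \<in> carrier B" "c \<in> carrier A" "d \<in> carrier B" for a b c d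
      by (rule tens_dual_ext[of "\<lambda>z. \<psi> (tens a b \<otimes>\<^bsub>T\<^esub> tens c d \<otimes>\<^bsub>T\<^esub> z)" "\<lambda>z. \<psi> (tens a b \<otimes>\<^bsub>T\<^esub> (tens c d \<otimes>\<^bsub>T\<^esub> z))", OF _ _ z])
        (use that \<psi> in \<open>auto intro!: r r[OF _ r] simp: tens_mult A.mult_assoc B.mult_assoc\<close>)
    have 2: "\<psi> (tens a b \<otimes>\<^bsub>T\<^esub> y \<otimes>\<^bsub>T\<^esub> z) = \<psi> (tens a b \<otimes>\<^bsub>T\<^esub> (y \<otimes>\<^bsub>T\<^esub> z))"
      if "a \<in> carrier A" "b \<in> carrier B" for a b
      by (rule tens_dual_ext[of "\<lambda>y. \<psi> (tens a b \<otimes>\<^bsub>T\<^esub> y \<otimes>\<^bsub>T\<^esub> z)" "\<lambda>y. \<psi> (tens a b \<otimes>\<^bsub>T\<^esub> (y \<otimes>\<^bsub>T\<^esub> z))", OF _ _ y])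
        (use that \<psi> z in \<open>auto intro!: r[OF _ l] l[OF _ r] 1\<close>)
    show "\<psi> (x \<otimes>\<^bsub>T\<^esub> y \<otimes>\<^bsub>T\<^esub> z) = \<psi> (x \<otimes>\<^bsub>T\<^esub> (y \<otimes>\<^bsub>T\<^esub> z))"
      by (rule tens_dual_ext[of "\<lambda>x. \<psi> (x \<otimes>\<^bsub>T\<^esub> y \<otimes>\<^bsub>T\<^esub> z)" "\<lambda>x. \<psi> (x \<otimes>\<^bsub>T\<^esub> (y \<otimes>\<^bsub>T\<^esub> z))", OF _ _ x])
        (use \<psi> y z in \<open>auto intro!: l l[OF _ l] 2\<close>)
  qed (use x y z in auto)
  show "\<one>\<^bsub>T\<^esub> \<otimes>\<^bsub>T\<^esub> x = x" if "x \<in> carrier T" for x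
  proof (rule T.dual_separates)
    fix \<psi> assume \<psi>: "\<psi> \<in> dual T"
    show "\<psi> (\<one>\<^bsub>T\<^esub> \<otimes>\<^bsub>T\<^esub> x) = \<psi> x"
      by (rule tens_dual_ext[of "\<lambda>x. \<psi> (\<one>\<^bsub>T\<^esub> \<otimes>\<^bsub>T\<^esub> x)" \<psi>, OF _ \<psi> that])
        (use \<psi> in \<open>auto intro!: r simp: one_T tens_mult\<close>)
  qed (use that in auto)
  show "x \<otimes>\<^bsub>T\<^esub> \<one>\<^bsub>T\<^esub> = x" if "x \<in> carrier T" for x
  proof (rule T.dual_separates)
    fix \<psi> assume \<psi>: "\<psi> \<in> dual T"
    show "\<psi> (x \<otimes>\<^bsub>T\<^esub> \<one>\<^bsub>T\<^esub>) = \<psi> x"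
      by (rule tens_dual_ext[of "\<lambda>x. \<psi> (x \<otimes>\<^bsub>T\<^esub> \<one>\<^bsub>T\<^esub>)" \<psi>, OF _ \<psi> that])
        (use \<psi> in \<open>auto intro!: l simp: one_T tens_mult\<close>)
  qed (use that in auto)
qed

end

section \<open>Enveloping algebras and Clifford algebras\<close>

lemma free_gen_mult: "free_gen x * free_gen y = Poly_Mapping.single (MWord [x, y]) 1"
  by (simp add: free_gen_def mult_single plus_mword_def)

lemma one_free: "(1 :: 'x mword \<Rightarrow>\<^sub>0 complex) = Poly_Mapping.single (MWord []) 1"
  by (simp add: zero_mword_def flip: single_one)

lemma linear_rels_closed: "lie.subspace V \<Longrightarrow> linear_rels V \<subseteq> carrier (free_alg \<delta> V)"
  by (auto simp: linear_rels_def intro!: free_alg_closed(2,3) free_gen_closed lie.subspace_add lie.subspace_scale)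

lemma linear_rels_hcomp:
  assumes "s \<in> linear_rels V" shows "hcomp (free_alg (\<lambda>_. d) V) k s \<in> {s, 0}"
proof -
  have g: "hcomp (free_alg (\<lambda>_. d) V) k (free_gen x) = (if d = k then free_gen x else 0)" for x
    by (simp add: free_gen_def hcomp_free_alg_single word_degree_def)
  show ?thesis
    using assms unfolding linear_rels_def
    by (auto simp: hcomp_free_alg_diff hcomp_free_alg_scale g)
qed

subsection \<open>Algebras presented by a vector space and relations\<close>

text \<open>Enveloping algebras and Clifford algebras are both generated by a vector space, subject to
  relations beyond linearity, with all generators of the same degree \<open>\<delta>\<close>.\<close>

locale presented_algebra =
  fixes \<delta> :: bit and V :: "'g::complex_lie_algebra set" and rels :: "('g mword \<Rightarrow>\<^sub>0 complex) set"
  assumes sub: "lie.subspace V"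
    and rels_closed: "rels \<subseteq> carrier (free_alg (\<lambda>_. \<delta>) V)"
    and rels_hcomp: "\<rho> \<in> rels \<Longrightarrow> hcomp (free_alg (\<lambda>_. \<delta>) V) k \<rho> \<in> {\<rho>, 0}"
begin

abbreviation F where "F \<equiv> free_alg (\<lambda>_. \<delta>) V"
abbreviation J where "J \<equiv> genideal F (linear_rels V \<union> rels)"

lemma all_rels_closed: "linear_rels V \<union> rels \<subseteq> carrier F"
  using linear_rels_closed[OF sub] rels_closed by blast

lemma all_rels_hcomp: "\<rho> \<in> linear_rels V \<union> rels \<Longrightarrow> hcomp F k \<rho> \<in> {\<rho>, 0}"
  using linear_rels_hcomp rels_hcomp by blast

sublocale q: quotient_algebra F J
  by (rule quotient_algebra_free[OF all_rels_closed all_rels_hcomp])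

sublocale assoc_algebra "quot_alg F J"
  by (rule q.assoc_algebra_Q) (auto simp: mult.assoc)

abbreviation pgen where "pgen x \<equiv> J +>\<^bsub>F\<^esub> free_gen x"

lemma rels_mem: "\<rho> \<in> linear_rels V \<union> rels \<Longrightarrow> \<rho> \<in> J"
  using ring.genideal_self[OF ring_free_alg all_rels_closed] by blast

lemma rel_eq: "x - y \<in> linear_rels V \<union> rels \<Longrightarrow> q.cls x = q.cls y"
  by (simp only: q.cls_eq_iff rels_mem)

lemma gen_closed [simp, intro]: "x \<in> V \<Longrightarrow> pgen x \<in> carrier (quot_alg F J)"
  by (intro q.cls_closed free_gen_closed)

lemma gen_add: "x \<in> V \<Longrightarrow> y \<in> V \<Longrightarrow> pgen (x + y) = pgen x \<oplus>\<^bsub>quot_alg F J\<^esub> pgen y"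
  unfolding q.cls_add by (rule rel_eq) (auto simp: linear_rels_def diff_diff_eq[symmetric] simp del: diff_diff_eq)

lemma gen_scale: "x \<in> V \<Longrightarrow> pgen (scaleC c x) = c \<odot>\<^bsub>quot_alg F J\<^esub> pgen x"
  by (subst q.cls_smult, erule free_gen_closed, rule rel_eq) (auto simp: linear_rels_def)

lemma word_cls:
  "set xs \<subseteq> V \<Longrightarrow> foldr (\<lambda>x y. pgen x \<otimes>\<^bsub>quot_alg F J\<^esub> y) xs \<one>\<^bsub>quot_alg F J\<^esub> = q.cls (Poly_Mapping.single (MWord xs) 1)"
proof (induction xs)
  case Nil
  then show ?case using q.cls_one by (simp add: one_free)
next
  case (Cons x xs)
  then have "pgen x \<otimes>\<^bsub>quot_alg F J\<^esub> q.cls (Poly_Mapping.single (MWord xs) 1)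
      = q.cls (free_gen x * Poly_Mapping.single (MWord xs) 1)"
    by (subst q.cls_mult) (auto simp: free_gen_closed free_alg_closed)
  then show ?case using Cons by (simp add: free_gen_def mult_single plus_mword_def)
qed

lemma
  assumes M: "assoc_algebra M" and f: "\<And>x. x \<in> V \<Longrightarrow> f x \<in> carrier M"
    and f_add: "\<And>x y. x \<in> V \<Longrightarrow> y \<in> V \<Longrightarrow> f (x + y) = f x \<oplus>\<^bsub>M\<^esub> f y"
    and f_scale: "\<And>c x. x \<in> V \<Longrightarrow> f (scaleC c x) = c \<odot>\<^bsub>M\<^esub> f x"
    and f_rel: "\<And>\<rho> \<psi>. \<rho> \<in> rels \<Longrightarrow> \<psi> \<in> dual M \<Longrightarrow>
      lincomb (\<lambda>w. \<psi> (foldr (\<lambda>x y. f x \<otimes>\<^bsub>M\<^esub> y) (letters w) \<one>\<^bsub>M\<^esub>)) \<rho> = 0"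
  shows linear_map_lift: "linear_map (quot_alg F J) M (alg_lift M f)"
    and lift_word: "set xs \<subseteq> V \<Longrightarrow>
      alg_lift M f (foldr (\<lambda>x y. pgen x \<otimes>\<^bsub>quot_alg F J\<^esub> y) xs \<one>\<^bsub>quot_alg F J\<^esub>) = foldr (\<lambda>x y. f x \<otimes>\<^bsub>M\<^esub> y) xs \<one>\<^bsub>M\<^esub>"
proof -
  interpret M: assoc_algebra M by (rule M)
  have rel: "lincomb (\<lambda>w. \<psi> (foldr (\<lambda>x y. f x \<otimes>\<^bsub>M\<^esub> y) (letters w) \<one>\<^bsub>M\<^esub>)) \<rho> = 0"
    if "\<rho> \<in> linear_rels V \<union> rels" and \<psi>: "\<psi> \<in> dual M" for \<rho> \<psi>
    using that(1)
  proof
    assume "\<rho> \<in> linear_rels V"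
    then show ?thesis
      unfolding linear_rels_def
      by (auto simp: lincomb_diff lincomb_scale free_gen_def f_add f_scale f dual_add[OF \<psi>] dual_smult[OF \<psi>])
  qed (rule f_rel[OF _ \<psi>])
  note L = linear_map_alg_lift[OF all_rels_closed all_rels_hcomp M f rel]
    alg_lift_word[OF all_rels_closed all_rels_hcomp M f rel]
  show "linear_map (quot_alg F J) M (alg_lift M f)" by (rule L(1))
  show "set xs \<subseteq> V \<Longrightarrow>
      alg_lift M f (foldr (\<lambda>x y. pgen x \<otimes>\<^bsub>quot_alg F J\<^esub> y) xs \<one>\<^bsub>quot_alg F J\<^esub>) = foldr (\<lambda>x y. f x \<otimes>\<^bsub>M\<^esub> y) xs \<one>\<^bsub>M\<^esub>"
    by (simp only: word_cls L(2))
qed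

end


subsection \<open>Enveloping algebras\<close>

locale enveloping =
  fixes a :: "'g::complex_lie_algebra set"
  assumes subalgebra: "lie_subalgebra a"
begin

abbreviation U where "U \<equiv> env_alg a"

abbreviation bracket_rels where
  "bracket_rels \<equiv> {free_gen x * free_gen y - free_gen y * free_gen x - free_gen (lie_bracket x y) | x y. x \<in> a \<and> y \<in> a}"

lemma bracket: "x \<in> a \<Longrightarrow> y \<in> a \<Longrightarrow> lie_bracket x y \<in> a"
  using subalgebra by (auto simp: lie_subalgebra_def)

lemma hcomp_trivial: "hcomp (free_alg (\<lambda>_. 0) a) i p = (if i = 0 then p else 0)"
  by (rule poly_mapping_eqI) (auto simp: lookup_hcomp_free_alg word_degree_def)

sublocale presented_algebra 0 a bracket_rels
  rewrites "quot_alg (free_alg (\<lambda>_. 0) a) (genideal (free_alg (\<lambda>_. 0) a) (linear_rels a \<union> bracket_rels)) = env_alg a"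
    and "\<And>x. genideal (free_alg (\<lambda>_. 0) a) (linear_rels a \<union> bracket_rels) +>\<^bsub>free_alg (\<lambda>_. 0) a\<^esub> free_gen x = env_gen a x"
proof -
  show "presented_algebra 0 a bracket_rels"
  proof
    show "lie.subspace a" using subalgebra by (simp add: lie_subalgebra_def)
    show "bracket_rels \<subseteq> carrier (free_alg (\<lambda>_. 0) a)"
      by (auto intro!: free_alg_closed(2,4) free_gen_closed bracket)
  qed (simp add: hcomp_trivial)
qed (simp_all add: env_alg_def env_gen_def env_ideal_def)

lemma gen_bracket:
  assumes "x \<in> a" "y \<in> a"
  shows "env_gen a x \<otimes>\<^bsub>U\<^esub> env_gen a y = env_gen a y \<otimes>\<^bsub>U\<^esub> env_gen a x \<oplus>\<^bsub>U\<^esub> env_gen a (lie_bracket x y)"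
proof -
  have "q.cls (free_gen x * free_gen y) = q.cls (free_gen y * free_gen x + free_gen (lie_bracket x y))"
    by (rule rel_eq) (use assms in \<open>auto simp: diff_diff_eq[symmetric] simp del: diff_diff_eq\<close>)
  then show ?thesis
    using assms by (simp add: env_gen_def env_ideal_def q.cls_mult q.cls_add free_gen_closed)
qed

lemma even: "x \<in> carrier U \<Longrightarrow> hcomp U i x = (if i = 0 then x else \<zero>\<^bsub>U\<^esub>)"
proof -
  assume "x \<in> carrier U"
  then obtain p where "x = q.cls p" "p \<in> carrier (free_alg (\<lambda>_. 0) a)"
    by (auto simp: q.cls_carrier)
  then show ?thesis using q.cls_hcomp[of p i] q.Q_zero by (simp add: hcomp_trivial)
qed

lemma
  assumes M: "assoc_algebra M" and f: "\<And>x. x \<in> a \<Longrightarrow> f x \<in> carrier M"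
    and f_add: "\<And>x y. x \<in> a \<Longrightarrow> y \<in> a \<Longrightarrow> f (x + y) = f x \<oplus>\<^bsub>M\<^esub> f y"
    and f_scale: "\<And>c x. x \<in> a \<Longrightarrow> f (scaleC c x) = c \<odot>\<^bsub>M\<^esub> f x"
    and f_bracket: "\<And>x y. x \<in> a \<Longrightarrow> y \<in> a \<Longrightarrow> f x \<otimes>\<^bsub>M\<^esub> f y = f y \<otimes>\<^bsub>M\<^esub> f x \<oplus>\<^bsub>M\<^esub> f (lie_bracket x y)"
  shows linear_map_env_lift: "linear_map U M (alg_lift M f)"
    and env_lift_gen: "x \<in> a \<Longrightarrow> alg_lift M f (env_gen a x) = f x"
    and env_lift_one: "alg_lift M f \<one>\<^bsub>U\<^esub> = \<one>\<^bsub>M\<^esub>"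
proof -
  interpret M: assoc_algebra M by (rule M)
  have rel: "lincomb (\<lambda>w. \<psi> (foldr (\<lambda>x y. f x \<otimes>\<^bsub>M\<^esub> y) (letters w) \<one>\<^bsub>M\<^esub>)) \<rho> = 0"
    if rel: "\<rho> \<in> bracket_rels" and \<psi>: "\<psi> \<in> dual M" for \<rho> \<psi>
  proof -
    obtain x y where \<rho>: "\<rho> = free_gen x * free_gen y - free_gen y * free_gen x - free_gen (lie_bracket x y)"
      and xy: "x \<in> a" "y \<in> a" using rel by auto
    show ?thesis
      unfolding \<rho> free_gen_mult
      using \<psi> xy by (simp add: lincomb_diff free_gen_def f bracket f_bracket[OF xy] dual_add)
  qed
  note L = linear_map_lift[OF M f f_add f_scale rel] lift_word[OF M f f_add f_scale rel]
  show "linear_map U M (alg_lift M f)" by (rule L(1))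
  show "x \<in> a \<Longrightarrow> alg_lift M f (env_gen a x) = f x"
    using L(2)[of "[x]"] f[of x] by simp
  show "alg_lift M f \<one>\<^bsub>U\<^esub> = \<one>\<^bsub>M\<^esub>"
    using L(2)[of "[]"] by simp
qed

end


subsection \<open>Clifford algebras\<close>

locale clifford =
  fixes B :: "'g::complex_lie_algebra \<Rightarrow> 'g \<Rightarrow> complex" and V :: "'g set"
  assumes subspace: "lie.subspace V"
begin

abbreviation C where "C \<equiv> cliff_alg B V"
abbreviation gen where "gen \<equiv> cliff_gen B V"
abbreviation clifford_mult (infixl "\<cdot>" 70) where "x \<cdot> y \<equiv> x \<otimes>\<^bsub>C\<^esub> y"

abbreviation clifford_rels where
  "clifford_rels \<equiv> {free_gen v * free_gen w + free_gen w * free_gen v - fscale (2 * B v w) 1 | v w. v \<in> V \<and> w \<in> V}"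

lemma word_degree_one: "word_degree (\<lambda>_. 1) w = of_nat (length (letters w))"
proof -
  have "sum_list (map (\<lambda>_. 1) xs) = (of_nat (length xs) :: bit)" for xs :: "'x list"
    by (induction xs) auto
  then show ?thesis by (simp add: word_degree_def)
qed

sublocale presented_algebra 1 V clifford_rels
  rewrites "quot_alg (free_alg (\<lambda>_. 1) V) (genideal (free_alg (\<lambda>_. 1) V) (linear_rels V \<union> clifford_rels)) = C"
    and "\<And>x. genideal (free_alg (\<lambda>_. 1) V) (linear_rels V \<union> clifford_rels) +>\<^bsub>free_alg (\<lambda>_. 1) V\<^esub> free_gen x = gen x"
proof -
  show "presented_algebra 1 V clifford_rels"
  proof
    show "clifford_rels \<subseteq> carrier (free_alg (\<lambda>_. 1) V)"
      by (auto intro!: free_alg_closed(1,2,3,4,6) free_gen_closed)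
    show "hcomp (free_alg (\<lambda>_. 1) V) k \<rho> \<in> {\<rho>, 0}" if rel: "\<rho> \<in> clifford_rels" for k \<rho>
    proof -
      obtain v w where "\<rho> = free_gen v * free_gen w + free_gen w * free_gen v - fscale (2 * B v w) 1"
        using rel by auto
      then show ?thesis
        by (cases k) (simp_all add: free_gen_mult hcomp_free_alg_add hcomp_free_alg_diff one_free
          hcomp_free_alg_single word_degree_one)
    qed
  qed (rule subspace)
qed (simp_all add: cliff_alg_def cliff_gen_def cliff_ideal_def)

lemma gen_anticommute:
  assumes "v \<in> V" "w \<in> V"
  shows "gen v \<cdot> gen w \<oplus>\<^bsub>C\<^esub> gen w \<cdot> gen v = (2 * B v w) \<odot>\<^bsub>C\<^esub> \<one>\<^bsub>C\<^esub>"
proof -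
  have "q.cls (free_gen v * free_gen w + free_gen w * free_gen v) = q.cls (fscale (2 * B v w) 1)"
    by (rule rel_eq) (use assms in auto)
  then show ?thesis
    using assms q.cls_one q.cls_smult[OF q.R_one]
    by (simp add: cliff_gen_def cliff_ideal_def q.cls_mult q.cls_add free_gen_closed)
qed

definition word where "word xs = foldr (\<lambda>x y. gen x \<cdot> y) xs \<one>\<^bsub>C\<^esub>"

text \<open>All generators are odd, so the degree of a word is the parity of its length.\<close>

lemma hcomp_word:
  assumes "set xs \<subseteq> V"
  shows "hcomp C k (word xs) = (if of_nat (length xs) = k then word xs else \<zero>\<^bsub>C\<^esub>)"
proof -
  have w: "word xs = q.cls (Poly_Mapping.single (MWord xs) 1)"
    unfolding word_def by (rule word_cls[OF assms])
  have "Poly_Mapping.single (MWord xs) 1 \<in> carrier (free_alg (\<lambda>_. 1) V)"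
    using assms by (simp add: free_alg_closed)
  from q.cls_hcomp[OF this, of k] show ?thesis
    using q.Q_zero by (simp add: w hcomp_free_alg_single word_degree_one)
qed

lemma graded: "x \<in> carrier C \<Longrightarrow> hcomp C 0 x \<oplus>\<^bsub>C\<^esub> hcomp C 1 x = x"
proof -
  assume "x \<in> carrier C"
  then obtain p where p: "x = q.cls p" "p \<in> carrier (free_alg (\<lambda>_. 1) V)"
    by (auto simp: q.cls_carrier)
  have "hcomp (free_alg (\<lambda>_. 1) V) 0 p + hcomp (free_alg (\<lambda>_. 1) V) 1 p = p"
    by (rule poly_mapping_eqI) (auto simp: lookup_add lookup_hcomp_free_alg)
  then show ?thesis using p by (simp add: q.cls_hcomp q.cls_add)
qed

lemma
  assumes M: "assoc_algebra M" and f: "\<And>x. x \<in> V \<Longrightarrow> f x \<in> carrier M"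
    and f_add: "\<And>x y. x \<in> V \<Longrightarrow> y \<in> V \<Longrightarrow> f (x + y) = f x \<oplus>\<^bsub>M\<^esub> f y"
    and f_scale: "\<And>c x. x \<in> V \<Longrightarrow> f (scaleC c x) = c \<odot>\<^bsub>M\<^esub> f x"
    and f_rel: "\<And>x y. x \<in> V \<Longrightarrow> y \<in> V \<Longrightarrow> f x \<otimes>\<^bsub>M\<^esub> f y \<oplus>\<^bsub>M\<^esub> f y \<otimes>\<^bsub>M\<^esub> f x = (2 * B x y) \<odot>\<^bsub>M\<^esub> \<one>\<^bsub>M\<^esub>"
  shows linear_map_cliff_lift: "linear_map C M (alg_lift M f)"
    and cliff_lift_word: "set xs \<subseteq> V \<Longrightarrow> alg_lift M f (word xs) = foldr (\<lambda>x y. f x \<otimes>\<^bsub>M\<^esub> y) xs \<one>\<^bsub>M\<^esub>"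
proof -
  interpret M: assoc_algebra M by (rule M)
  have rel: "lincomb (\<lambda>w. \<psi> (foldr (\<lambda>x y. f x \<otimes>\<^bsub>M\<^esub> y) (letters w) \<one>\<^bsub>M\<^esub>)) \<rho> = 0"
    if rel: "\<rho> \<in> clifford_rels" and \<psi>: "\<psi> \<in> dual M" for \<rho> \<psi>
  proof -
    obtain x y where \<rho>: "\<rho> = free_gen x * free_gen y + free_gen y * free_gen x - fscale (2 * B x y) 1"
      and xy: "x \<in> V" "y \<in> V" using rel by auto
    have "\<psi> (f x \<otimes>\<^bsub>M\<^esub> f y) + \<psi> (f y \<otimes>\<^bsub>M\<^esub> f x) = 2 * B x y * \<psi> \<one>\<^bsub>M\<^esub>"
      using arg_cong[OF f_rel[OF xy], of \<psi>] \<psi> f xy by (simp add: dual_add dual_smult)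
    then show ?thesis
      using xy by (simp add: \<rho> free_gen_mult lincomb_diff lincomb_add one_free f)
  qed
  show "linear_map C M (alg_lift M f)"
    by (rule linear_map_lift[OF M f f_add f_scale rel])
  show "set xs \<subseteq> V \<Longrightarrow> alg_lift M f (word xs) = foldr (\<lambda>x y. f x \<otimes>\<^bsub>M\<^esub> y) xs \<one>\<^bsub>M\<^esub>"
    unfolding word_def by (rule lift_word[OF M f f_add f_scale rel])
qed

lemma word_simps:
  "word [] = \<one>\<^bsub>C\<^esub>"
  "u \<in> V \<Longrightarrow> word [u] = gen u"
  "u \<in> V \<Longrightarrow> v \<in> V \<Longrightarrow> word [u, v] = gen u \<cdot> gen v"
  "u \<in> V \<Longrightarrow> v \<in> V \<Longrightarrow> w \<in> V \<Longrightarrow> word [u, v, w] = gen u \<cdot> gen v \<cdot> gen w"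
  by (simp_all add: word_def mult_assoc)

end

section \<open>The Killing form\<close>

lemma bracket_zero [simp]: "lie_bracket 0 x = 0" "lie_bracket x 0 = 0"
  for x :: "'g::complex_lie_algebra"
  using bracket_scaleC_left[of 0 0 x] bracket_scaleC_right[of x 0 0] by simp_all

lemma bracket_swap: "lie_bracket y x = - lie_bracket x y"
  for x y :: "'g::complex_lie_algebra"
proof -
  have "0 = lie_bracket (x + y) (x + y)" by (simp only: bracket_self)
  also have "\<dots> = lie_bracket x y + lie_bracket y x"
    by (subst bracket_add_left) (simp add: bracket_add_right bracket_self)
  finally have "lie_bracket x y + lie_bracket y x = 0" by (rule sym)
  then show ?thesis by (simp add: eq_neg_iff_add_eq_0 add.commute)
qed

lemma bracket_derivation:
  "lie_bracket x (lie_bracket y z) = lie_bracket (lie_bracket x y) z + lie_bracket y (lie_bracket x z)"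
  for x y z :: "'g::complex_lie_algebra"
proof -
  have y: "lie_bracket y (lie_bracket z x) = - lie_bracket y (lie_bracket x z)"
    using bracket_scaleC_right[of y "-1" "lie_bracket x z"] by (simp add: bracket_swap[of x z])
  have z: "lie_bracket z (lie_bracket x y) = - lie_bracket (lie_bracket x y) z"
    by (rule bracket_swap)
  have "lie_bracket x (lie_bracket y z) - (lie_bracket (lie_bracket x y) z + lie_bracket y (lie_bracket x z)) = 0"
    using jacobi[of x y z] unfolding y z by (simp add: algebra_simps)
  then show ?thesis by simp
qed

abbreviation lie_linear :: "('g::complex_lie_algebra \<Rightarrow> 'g) \<Rightarrow> bool" where
  "lie_linear f \<equiv> module_hom scaleC scaleC f"

lemma lie_linearI:
  "(\<And>x y. f (x + y) = f x + f y) \<Longrightarrow> (\<And>c x. f (scaleC c x) = scaleC c (f x)) \<Longrightarrow> lie_linear f"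
  by (intro module_hom.intro module_hom_axioms.intro lie.module_axioms)

lemma lie_linear_bracket: "lie_linear (lie_bracket x)"
  by (intro lie_linearI) (simp_all add: bracket_add_right bracket_scaleC_right)

lemma lie_linear_comp: "lie_linear f \<Longrightarrow> lie_linear g \<Longrightarrow> lie_linear (\<lambda>x. f (g x))"
  by (intro lie_linearI) (simp_all add: module_hom.add module_hom.scale)

lemma lie_trace_eq:
  assumes "finite_dim (UNIV :: 'g::complex_lie_algebra set)"
  obtains E :: "'g::complex_lie_algebra set" where "finite E" "lie.independent E" "lie.span E = UNIV"
    "\<And>f. lie_trace f = (\<Sum>b\<in>E. lie.representation E (f b) b)"
proof -
  define E :: "'g set" where "E = (SOME E. lie.independent E \<and> lie.span E = UNIV)"
  obtain E0 :: "'g set" where "lie.independent E0" "UNIV \<subseteq> lie.span E0"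
    by (rule lie.maximal_independent_subset[of UNIV]) auto
  then have "\<exists>E :: 'g set. lie.independent E \<and> lie.span E = UNIV" by blast
  then have E: "lie.independent E \<and> lie.span E = UNIV"
    unfolding E_def by (rule someI_ex)
  obtain S :: "'g set" where S: "finite S" "lie.span S = UNIV"
    using assms by (auto simp: finite_dim_def)
  have "finite E"
    using lie.independent_span_bound[OF S(1), of E] E S(2) by auto
  moreover have "lie_trace f = (\<Sum>b\<in>E. lie.representation E (f b) b)" for f
    unfolding lie_trace_def E_def by (simp add: Let_def)
  ultimately show thesis using that E by blast
qed

lemma lie_trace_add:
  assumes "finite_dim (UNIV :: 'g::complex_lie_algebra set)"
  shows "lie_trace (\<lambda>z :: 'g. f z + g z) = lie_trace f + lie_trace g"
proof -
  obtain E :: "'g set" where E: "finite E" "lie.independent E" "lie.span E = UNIV"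
    "\<And>f. lie_trace f = (\<Sum>b\<in>E. lie.representation E (f b) b)"
    using lie_trace_eq[OF assms] by blast
  then show ?thesis by (simp add: lie.representation_add sum.distrib)
qed

lemma lie_trace_scale:
  assumes "finite_dim (UNIV :: 'g::complex_lie_algebra set)"
  shows "lie_trace (\<lambda>z :: 'g. scaleC c (f z)) = c * lie_trace f"
proof -
  obtain E :: "'g set" where E: "finite E" "lie.independent E" "lie.span E = UNIV"
    "\<And>f. lie_trace f = (\<Sum>b\<in>E. lie.representation E (f b) b)"
    using lie_trace_eq[OF assms] by blast
  then show ?thesis by (simp add: lie.representation_scale sum_distrib_left)
qed

text \<open>Both traces are the sum over all pairs of basis elements of the products of matrix entries
  of \<open>f\<close> and \<open>g\<close>.\<close>

lemma lie_trace_commute: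
  assumes fd: "finite_dim (UNIV :: 'g::complex_lie_algebra set)"
    and f: "lie_linear (f :: 'g \<Rightarrow> 'g)" and g: "lie_linear (g :: 'g \<Rightarrow> 'g)"
  shows "lie_trace (\<lambda>z. f (g z)) = lie_trace (\<lambda>z. g (f z))"
proof -
  obtain E :: "'g set" where E: "finite E" "lie.independent E" "lie.span E = UNIV"
    "\<And>f. lie_trace f = (\<Sum>b\<in>E. lie.representation E (f b) b)"
    using lie_trace_eq[OF fd] by blast
  let ?r = "lie.representation E"
  have expand: "?r (f (g b)) b = (\<Sum>c\<in>E. ?r (g b) c * ?r (f c) b)" if f: "lie_linear f" for f g :: "'g \<Rightarrow> 'g" and b
  proof -
    have "g b = (\<Sum>c\<in>E. scaleC (?r (g b) c) c)"
      using lie.sum_representation_eq[OF E(2) _ E(1) subset_refl, of "g b"] E(3) by simp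
    then have "f (g b) = f (\<Sum>c\<in>E. scaleC (?r (g b) c) c)" by simp
    also have "\<dots> = (\<Sum>c\<in>E. scaleC (?r (g b) c) (f c))"
      by (simp add: module_hom.sum[OF f] module_hom.scale[OF f])
    finally have fg: "f (g b) = (\<Sum>c\<in>E. scaleC (?r (g b) c) (f c))" .
    show ?thesis
      unfolding fg using E by (simp add: lie.representation_sum lie.representation_scale)
  qed
  have "lie_trace (\<lambda>z. f (g z)) = (\<Sum>b\<in>E. \<Sum>c\<in>E. ?r (g b) c * ?r (f c) b)"
    by (simp add: E(4) expand[OF f])
  also have "\<dots> = (\<Sum>b\<in>E. \<Sum>c\<in>E. ?r (f b) c * ?r (g c) b)"
    by (subst sum.swap) (simp add: mult.commute)
  also have "\<dots> = lie_trace (\<lambda>z. g (f z))"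
    by (simp add: E(4) expand[OF g])
  finally show ?thesis .
qed

locale invariant_form =
  fixes B :: "'g::complex_lie_algebra \<Rightarrow> 'g \<Rightarrow> complex"
  assumes B_add: "B (x + y) z = B x z + B y z"
    and B_scale: "B (scaleC c x) y = c * B x y"
    and B_commute: "B x y = B y x"
    and B_invariant: "B (lie_bracket x y) z = B x (lie_bracket y z)"
begin

lemma B_add_right: "B z (x + y) = B z x + B z y"
  and B_scale_right: "B x (scaleC c y) = c * B x y"
  using B_add[of x y z] B_scale[of c y x] B_commute[of "x + y" z] B_commute[of x z] B_commute[of y z]
    B_commute[of "scaleC c y" x] B_commute[of y x] by simp_all

lemma B_zero [simp]: "B 0 x = 0" "B x 0 = 0"
  using B_scale[of 0 0 x] B_scale_right[of x 0 0] by simp_all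

lemma B_uminus: "B (- x) y = - B x y" "B x (- y) = - B x y"
  using B_scale[of "-1" x y] B_scale_right[of x "-1" y] by simp_all

lemma B_sum: "B (sum f S) x = (\<Sum>i\<in>S. B (f i) x)"
  by (induction S rule: infinite_finite_induct) (simp_all add: B_add)

end

text \<open>Invariance comes from \<open>tr(YXZ) = tr(XZY)\<close>, where \<open>X\<close>, \<open>Y\<close>, \<open>Z\<close> are the adjoint maps
  of \<open>x\<close>, \<open>y\<close>, \<open>z\<close>.\<close>

lemma invariant_form_killing:
  assumes fd: "finite_dim (UNIV :: 'g::complex_lie_algebra set)"
  shows "invariant_form (killing_form :: 'g \<Rightarrow> 'g \<Rightarrow> complex)"
proof
  fix x y z :: 'g and c
  show "killing_form (x + y) z = killing_form x z + killing_form y z"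
    by (simp add: killing_form_def bracket_add_left lie_trace_add[OF fd])
  show "killing_form (scaleC c x) y = c * killing_form x y"
    by (simp add: killing_form_def bracket_scaleC_left lie_trace_scale[OF fd])
  show "killing_form x y = killing_form y x"
    unfolding killing_form_def by (rule lie_trace_commute[OF fd lie_linear_bracket lie_linear_bracket])
  let ?xyz = "\<lambda>v. lie_bracket x (lie_bracket y (lie_bracket z v))"
  let ?yxz = "\<lambda>v. lie_bracket y (lie_bracket x (lie_bracket z v))"
  let ?xzy = "\<lambda>v. lie_bracket x (lie_bracket z (lie_bracket y v))"
  have "killing_form (lie_bracket x y) z + lie_trace ?yxz = lie_trace ?xyz"
    unfolding killing_form_def
    by (simp add: lie_trace_add[OF fd, symmetric] bracket_derivation[symmetric])
  moreover have "killing_form x (lie_bracket y z) + lie_trace ?xzy = lie_trace ?xyz"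
    unfolding killing_form_def
    by (simp add: lie_trace_add[OF fd, symmetric] bracket_add_right[symmetric] bracket_derivation[symmetric])
  moreover have "lie_trace ?yxz = lie_trace ?xzy"
    by (rule lie_trace_commute[OF fd lie_linear_bracket lie_linear_comp[OF lie_linear_bracket lie_linear_bracket]])
  ultimately show "killing_form (lie_bracket x y) z = killing_form x (lie_bracket y z)"
    by (metis add_right_cancel)
qed


section \<open>Contractions over orthonormal bases\<close>

definition linear_on :: "'g::complex_lie_algebra set \<Rightarrow> ('g \<Rightarrow> complex) \<Rightarrow> bool" where
  "linear_on V \<phi> \<longleftrightarrow> (\<forall>x\<in>V. \<forall>y\<in>V. \<phi> (x + y) = \<phi> x + \<phi> y) \<and> (\<forall>c. \<forall>x\<in>V. \<phi> (scaleC c x) = c * \<phi> x)"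

definition bilinear_on :: "'g::complex_lie_algebra set \<Rightarrow> ('g \<Rightarrow> 'g \<Rightarrow> complex) \<Rightarrow> bool" where
  "bilinear_on V F \<longleftrightarrow> (\<forall>y\<in>V. linear_on V (\<lambda>x. F x y)) \<and> (\<forall>x\<in>V. linear_on V (\<lambda>y. F x y))"

definition trilinear_on :: "'g::complex_lie_algebra set \<Rightarrow> ('g \<Rightarrow> 'g \<Rightarrow> 'g \<Rightarrow> complex) \<Rightarrow> bool" where
  "trilinear_on V G \<longleftrightarrow> (\<forall>v\<in>V. \<forall>w\<in>V. linear_on V (\<lambda>u. G u v w)
     \<and> linear_on V (\<lambda>u. G v u w) \<and> linear_on V (\<lambda>u. G v w u))"

definition orthonormal_set :: "('g::complex_lie_algebra \<Rightarrow> 'g \<Rightarrow> complex) \<Rightarrow> 'g set \<Rightarrow> 'g set \<Rightarrow> bool" where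
  "orthonormal_set B V E \<longleftrightarrow> finite E \<and> lie.span E = V \<and> (\<forall>e\<in>E. \<forall>e'\<in>E. B e e' = (if e = e' then 1 else 0))"

lemma orthonormal_basis_set:
  assumes "orthonormal_basis B V Ws"
  shows "distinct Ws" "orthonormal_set B V (set Ws)"
proof -
  have B: "B (Ws ! i) (Ws ! j) = (if i = j then 1 else 0)" if "i < length Ws" "j < length Ws" for i j
    using assms that by (simp add: orthonormal_basis_def)
  show d: "distinct Ws"
    unfolding distinct_conv_nth
  proof (intro allI impI)
    fix i j assume ij: "i < length Ws" "j < length Ws" "i \<noteq> j"
    show "Ws ! i \<noteq> Ws ! j" using B[of i i] B[of i j] ij by auto
  qed
  show "orthonormal_set B V (set Ws)"
    unfolding orthonormal_set_def
  proof (intro conjI ballI)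
    show "lie.span (set Ws) = V" using assms by (simp add: orthonormal_basis_def)
    fix e e' assume "e \<in> set Ws" "e' \<in> set Ws"
    then show "B e e' = (if e = e' then 1 else 0)"
      using B d by (auto simp: in_set_conv_nth nth_eq_iff_index_eq)
  qed simp
qed

lemma sum_nth_distinct:
  assumes "distinct xs" shows "(\<Sum>i<length xs. f (xs ! i)) = (\<Sum>x\<in>set xs. f x)"
  using sum.reindex_bij_betw[OF bij_betw_nth[OF assms refl refl], of f] by simp

context invariant_form begin

lemma linear_on_zero: "linear_on V \<phi> \<Longrightarrow> lie.subspace V \<Longrightarrow> \<phi> 0 = 0"
proof -
  assume "linear_on V \<phi>" "lie.subspace V"
  then have "\<phi> (scaleC 0 0) = 0 * \<phi> 0"
    using lie.subspace_0 unfolding linear_on_def by blast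
  then show ?thesis by simp
qed

lemma linear_on_sum:
  assumes "linear_on V \<phi>" "lie.subspace V" "\<And>i. i \<in> S \<Longrightarrow> f i \<in> V"
  shows "\<phi> (sum f S) = (\<Sum>i\<in>S. \<phi> (f i))"
  using assms(3)
proof (induction S rule: infinite_finite_induct)
  case (insert x F)
  then show ?case
    using assms(1) lie.subspace_sum[OF assms(2), of F f] by (simp add: linear_on_def)
qed (use linear_on_zero[OF assms(1,2)] in simp_all)

lemma orthonormal_expand:
  assumes E: "orthonormal_set B V E" and v: "v \<in> V"
  shows "v = (\<Sum>e\<in>E. scaleC (B v e) e)"
proof -
  have fin: "finite E" and on: "\<And>e e'. e \<in> E \<Longrightarrow> e' \<in> E \<Longrightarrow> B e e' = (if e = e' then 1 else 0)"
    using E by (auto simp: orthonormal_set_def)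
  have "v \<in> range (\<lambda>c. \<Sum>e\<in>E. scaleC (c e) e)"
    using v E unfolding orthonormal_set_def lie.span_finite[OF fin, symmetric] by simp
  then obtain c where c: "v = (\<Sum>e\<in>E. scaleC (c e) e)" by blast
  have "B v e = c e" if "e \<in> E" for e
  proof -
    have "B v e = (\<Sum>e'\<in>E. if e' = e then c e' else 0)"
      unfolding c B_sum B_scale using on that by (intro sum.cong) auto
    also have "\<dots> = c e" using fin that by (simp add: sum.delta)
    finally show ?thesis .
  qed
  then show ?thesis using c by simp
qed

lemma orthonormal_subset: "orthonormal_set B V E \<Longrightarrow> E \<subseteq> V"
  and orthonormal_subspace: "orthonormal_set B V E \<Longrightarrow> lie.subspace V"
  by (auto simp: orthonormal_set_def lie.span_base)

lemma linear_on_expand: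
  assumes E: "orthonormal_set B V E" and \<phi>: "linear_on V \<phi>" and v: "v \<in> V"
  shows "\<phi> v = (\<Sum>e\<in>E. B v e * \<phi> e)"
proof -
  note EV = orthonormal_subset[OF E] and V = orthonormal_subspace[OF E]
  have "\<phi> v = \<phi> (\<Sum>e\<in>E. scaleC (B v e) e)" using orthonormal_expand[OF E v] by simp
  also have "\<dots> = (\<Sum>e\<in>E. \<phi> (scaleC (B v e) e))"
    by (rule linear_on_sum[OF \<phi> V]) (use EV lie.subspace_scale[OF V] in auto)
  finally show ?thesis using \<phi> EV by (simp add: linear_on_def subset_iff)
qed

text \<open>Both sides equal the sum of \<open>B e e' * F e e'\<close> over all \<open>e\<close> in \<open>E\<close> and \<open>e'\<close>
  in \<open>E'\<close>.\<close>

lemma contraction_basis_independent: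
  assumes E: "orthonormal_set B V E" and E': "orthonormal_set B V E'" and F: "bilinear_on V F"
  shows "(\<Sum>e\<in>E. F e e) = (\<Sum>e\<in>E'. F e e)"
proof -
  have "(\<Sum>e\<in>E. F e e) = (\<Sum>e\<in>E. \<Sum>e'\<in>E'. B e e' * F e e')"
    using F orthonormal_subset[OF E] by (intro sum.cong refl linear_on_expand[OF E']) (auto simp: bilinear_on_def)
  also have "\<dots> = (\<Sum>e'\<in>E'. \<Sum>e\<in>E. B e' e * F e e')"
    by (subst sum.swap) (simp add: B_commute)
  also have "\<dots> = (\<Sum>e'\<in>E'. F e' e')"
    using F orthonormal_subset[OF E'] by (intro sum.cong refl linear_on_expand[OF E, symmetric]) (auto simp: bilinear_on_def)
  finally show ?thesis .
qed

lemma B_ad_skew: "B (lie_bracket x y) z = - B (lie_bracket x z) y"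
proof -
  have "B (lie_bracket x y) z = B z (lie_bracket x y)" by (rule B_commute)
  also have "\<dots> = B (lie_bracket z x) y" by (rule B_invariant[symmetric])
  also have "\<dots> = - B (lie_bracket x z) y" by (subst bracket_swap) (rule B_uminus)
  finally show ?thesis .
qed

text \<open>The matrix of the adjoint map of \<open>X\<close> in the basis \<open>E\<close> is skew.\<close>

lemma contraction_invariant:
  assumes E: "orthonormal_set B V E" and F: "bilinear_on V F" and X: "\<And>v. v \<in> V \<Longrightarrow> lie_bracket X v \<in> V"
  shows "(\<Sum>e\<in>E. F (lie_bracket X e) e) = - (\<Sum>e\<in>E. F e (lie_bracket X e))"
proof -
  note EV = orthonormal_subset[OF E]
  have "(\<Sum>e\<in>E. F (lie_bracket X e) e) = (\<Sum>e\<in>E. \<Sum>e'\<in>E. B (lie_bracket X e) e' * F e' e)"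
    using F X EV by (intro sum.cong refl linear_on_expand[OF E]) (auto simp: bilinear_on_def)
  also have "\<dots> = (\<Sum>e'\<in>E. \<Sum>e\<in>E. - (B (lie_bracket X e') e * F e' e))"
    by (subst sum.swap, intro sum.cong refl) (subst B_ad_skew, simp)
  also have "\<dots> = - (\<Sum>e'\<in>E. \<Sum>e\<in>E. B (lie_bracket X e') e * F e' e)"
    by (simp add: sum_negf)
  also have "(\<Sum>e'\<in>E. \<Sum>e\<in>E. B (lie_bracket X e') e * F e' e) = (\<Sum>e'\<in>E. F e' (lie_bracket X e'))"
    using F X EV by (intro sum.cong refl linear_on_expand[OF E, symmetric]) (auto simp: bilinear_on_def)
  finally show ?thesis .
qed

text \<open>The alternating trilinear form whose contraction with triple products of generators gives the
  cubic term of the Dirac operator.\<close>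

definition structure_form where "structure_form u v w = B (lie_bracket u v) w"

lemma structure_form_swap: "structure_form v u w = - structure_form u v w" "structure_form u w v = - structure_form u v w"
proof -
  show "structure_form v u w = - structure_form u v w"
    using bracket_swap[of u v] by (simp add: structure_form_def B_uminus)
  show "structure_form u w v = - structure_form u v w"
    unfolding structure_form_def by (rule B_ad_skew)
qed

lemma structure_form_trilinear: "trilinear_on UNIV structure_form"
  by (simp add: trilinear_on_def linear_on_def structure_form_def bracket_add_left bracket_add_right
      bracket_scaleC_left bracket_scaleC_right B_add B_scale B_add_right B_scale_right)

lemma structure_form_invariant:
  "structure_form (lie_bracket X u) v w + structure_form u (lie_bracket X v) w + structure_form u v (lie_bracket X w) = 0"
  using B_ad_skew[of X "lie_bracket u v" w] B_commute[of "lie_bracket X w"]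
  by (simp add: structure_form_def bracket_derivation[of X u v] B_add)

text \<open>Summing over all triples, rather than over increasing ones, makes independence of the basis and
  invariance visible slot by slot.\<close>

definition cubic_sum :: "'g set \<Rightarrow> ('g \<Rightarrow> 'g \<Rightarrow> 'g \<Rightarrow> complex) \<Rightarrow> complex" where
  "cubic_sum E G = (\<Sum>u\<in>E. \<Sum>v\<in>E. \<Sum>w\<in>E. structure_form u v w * G u v w)"

lemma linear_on_times:
  assumes "linear_on V p"
  shows "linear_on V (\<lambda>x. p x * c)" "linear_on V (\<lambda>x. c * p x)"
  using assms by (simp_all add: linear_on_def distrib_left distrib_right mult.left_commute)

lemma linear_on_mono: "linear_on V p \<Longrightarrow> W \<subseteq> V \<Longrightarrow> linear_on W p"
  unfolding linear_on_def by blast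

lemma trilinear_slots:
  assumes "trilinear_on V G" "a \<in> V" "b \<in> V"
  shows "bilinear_on V (\<lambda>u u'. structure_form u a b * G u' a b)"
    "bilinear_on V (\<lambda>u u'. structure_form a u b * G a u' b)"
    "bilinear_on V (\<lambda>u u'. structure_form a b u * G a b u')"
proof -
  have f: "linear_on V (\<lambda>u. structure_form u a b)" "linear_on V (\<lambda>u. structure_form a u b)"
    "linear_on V (\<lambda>u. structure_form a b u)"
    using structure_form_trilinear by (auto simp: trilinear_on_def intro: linear_on_mono[OF _ subset_UNIV])
  show "bilinear_on V (\<lambda>u u'. structure_form u a b * G u' a b)"
    "bilinear_on V (\<lambda>u u'. structure_form a u b * G a u' b)"
    "bilinear_on V (\<lambda>u u'. structure_form a b u * G a b u')"
    using assms by (auto simp: bilinear_on_def trilinear_on_def intro!: linear_on_times f)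
qed

lemma cubic_sum_basis_independent:
  assumes E: "orthonormal_set B V E" and E': "orthonormal_set B V E'" and G: "trilinear_on V G"
  shows "cubic_sum E G = cubic_sum E' G"
proof -
  let ?h = "\<lambda>u v w. structure_form u v w * G u v w"
  have EV: "u \<in> E \<Longrightarrow> u \<in> V" "u \<in> E' \<Longrightarrow> u \<in> V" for u
    using orthonormal_subset[OF E] orthonormal_subset[OF E'] by auto
  note c = contraction_basis_independent[OF E E']
  have "cubic_sum E G = (\<Sum>u\<in>E. \<Sum>v\<in>E. \<Sum>w\<in>E'. ?h u v w)"
    unfolding cubic_sum_def by (intro sum.cong refl c trilinear_slots(3)[OF G] EV)
  also have "\<dots> = (\<Sum>u\<in>E. \<Sum>w\<in>E'. \<Sum>v\<in>E. ?h u v w)"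
    by (intro sum.cong refl sum.swap)
  also have "\<dots> = (\<Sum>u\<in>E. \<Sum>w\<in>E'. \<Sum>v\<in>E'. ?h u v w)"
    by (intro sum.cong refl c trilinear_slots(2)[OF G] EV)
  also have "\<dots> = (\<Sum>w\<in>E'. \<Sum>v\<in>E'. \<Sum>u\<in>E. ?h u v w)"
    by (subst sum.swap) (intro sum.cong refl sum.swap)
  also have "\<dots> = (\<Sum>w\<in>E'. \<Sum>v\<in>E'. \<Sum>u\<in>E'. ?h u v w)"
    by (intro sum.cong refl c trilinear_slots(1)[OF G] EV)
  also have "\<dots> = (\<Sum>u\<in>E'. \<Sum>v\<in>E'. \<Sum>w\<in>E'. ?h u v w)"
    by (subst sum.swap, subst (2) sum.swap) (subst sum.swap, intro sum.cong refl sum.swap)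
  finally show ?thesis by (simp add: cubic_sum_def)
qed

text \<open>In each slot the adjoint map can be moved from \<open>G\<close> onto the structure form at the cost of a
  sign. The three terms then add up to the action of \<open>X\<close> on the structure form, which vanishes by
  the Jacobi identity.\<close>

lemma cubic_sum_invariant:
  assumes E: "orthonormal_set B V E" and G: "trilinear_on V G" and X: "\<And>v. v \<in> V \<Longrightarrow> lie_bracket X v \<in> V"
  shows "cubic_sum E (\<lambda>u v w. G (lie_bracket X u) v w + G u (lie_bracket X v) w + G u v (lie_bracket X w)) = 0"
proof -
  let ?f = structure_form and ?X = "lie_bracket X"
  have EV: "u \<in> E \<Longrightarrow> u \<in> V" for u using orthonormal_subset[OF E] by auto
  note inv = contraction_invariant[OF E _ X]
  have 1: "(\<Sum>u\<in>E. \<Sum>v\<in>E. \<Sum>w\<in>E. ?f u v w * G (?X u) v w) = - (\<Sum>u\<in>E. \<Sum>v\<in>E. \<Sum>w\<in>E. ?f (?X u) v w * G u v w)"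
  proof -
    have sw: "(\<Sum>u\<in>E. \<Sum>v\<in>E. \<Sum>w\<in>E. k u v w) = (\<Sum>v\<in>E. \<Sum>w\<in>E. \<Sum>u\<in>E. k u v w)" for k :: "_ \<Rightarrow> _ \<Rightarrow> _ \<Rightarrow> complex"
      by (subst sum.swap) (intro sum.cong refl sum.swap)
    have "(\<Sum>u\<in>E. ?f u v w * G (?X u) v w) = - (\<Sum>u\<in>E. ?f (?X u) v w * G u v w)" if "v \<in> E" "w \<in> E" for v w
      using inv[OF trilinear_slots(1)[OF G EV[OF that(1)] EV[OF that(2)]]] by simp
    then show ?thesis
      unfolding sw[of "\<lambda>u v w. ?f u v w * G (?X u) v w"] sw[of "\<lambda>u v w. ?f (?X u) v w * G u v w"]
      by (simp add: sum_negf)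
  qed
  have 2: "(\<Sum>u\<in>E. \<Sum>v\<in>E. \<Sum>w\<in>E. ?f u v w * G u (?X v) w) = - (\<Sum>u\<in>E. \<Sum>v\<in>E. \<Sum>w\<in>E. ?f u (?X v) w * G u v w)"
  proof -
    have sw: "(\<Sum>u\<in>E. \<Sum>v\<in>E. \<Sum>w\<in>E. k u v w) = (\<Sum>u\<in>E. \<Sum>w\<in>E. \<Sum>v\<in>E. k u v w)" for k :: "_ \<Rightarrow> _ \<Rightarrow> _ \<Rightarrow> complex"
      by (intro sum.cong refl sum.swap)
    have "(\<Sum>v\<in>E. ?f u v w * G u (?X v) w) = - (\<Sum>v\<in>E. ?f u (?X v) w * G u v w)" if "u \<in> E" "w \<in> E" for u w
      using inv[OF trilinear_slots(2)[OF G EV[OF that(1)] EV[OF that(2)]]] by simp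
    then show ?thesis
      unfolding sw[of "\<lambda>u v w. ?f u v w * G u (?X v) w"] sw[of "\<lambda>u v w. ?f u (?X v) w * G u v w"]
      by (simp add: sum_negf)
  qed
  have 3: "(\<Sum>u\<in>E. \<Sum>v\<in>E. \<Sum>w\<in>E. ?f u v w * G u v (?X w)) = - (\<Sum>u\<in>E. \<Sum>v\<in>E. \<Sum>w\<in>E. ?f u v (?X w) * G u v w)"
  proof -
    have "(\<Sum>w\<in>E. ?f u v w * G u v (?X w)) = - (\<Sum>w\<in>E. ?f u v (?X w) * G u v w)" if "u \<in> E" "v \<in> E" for u v
      using inv[OF trilinear_slots(3)[OF G EV[OF that(1)] EV[OF that(2)]]] by simp
    then show ?thesis by (simp add: sum_negf)
  qed
  have "cubic_sum E (\<lambda>u v w. G (?X u) v w + G u (?X v) w + G u v (?X w))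
      = - (\<Sum>u\<in>E. \<Sum>v\<in>E. \<Sum>w\<in>E. (?f (?X u) v w + ?f u (?X v) w + ?f u v (?X w)) * G u v w)"
    unfolding cubic_sum_def distrib_left distrib_right sum.distrib 1 2 3 by simp
  then show ?thesis by (simp add: structure_form_invariant)
qed

end

lemma sum_pairs_eq:
  fixes h :: "nat \<Rightarrow> nat \<Rightarrow> complex"
  assumes "\<And>i j. i < m \<Longrightarrow> j < m \<Longrightarrow> h i j = h j i" "\<And>i. i < m \<Longrightarrow> h i i = 0"
  shows "2 * (\<Sum>(i, j)\<in>{(i, j). i < j \<and> j < m}. h i j) = (\<Sum>i<m. \<Sum>j<m. h i j)"
  using assms
proof (induction m)
  case (Suc m)
  have set: "{(i, j). i < j \<and> j < Suc m} = {(i, j). i < j \<and> j < m} \<union> (\<lambda>i. (i, m)) ` {..<m}"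
    by (auto simp: less_Suc_eq)
  have fin: "finite {(i, j). i < j \<and> j < (m::nat)}"
    by (rule finite_subset[of _ "{..<m} \<times> {..<m}"]) auto
  have "(\<Sum>(i, j)\<in>{(i, j). i < j \<and> j < Suc m}. h i j)
      = (\<Sum>(i, j)\<in>{(i, j). i < j \<and> j < m}. h i j) + (\<Sum>i<m. h i m)"
    unfolding set by (subst sum.union_disjoint) (auto simp: fin sum.reindex inj_on_def)
  moreover have "(\<Sum>i<Suc m. \<Sum>j<Suc m. h i j) = (\<Sum>i<m. \<Sum>j<m. h i j) + 2 * (\<Sum>i<m. h i m)"
    using Suc.prems by (simp add: sum.distrib)
  ultimately show ?case using Suc by (simp add: distrib_left)
qed simp

lemma sum_triples_eq:
  fixes h :: "nat \<Rightarrow> nat \<Rightarrow> nat \<Rightarrow> complex"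
  assumes "\<And>i j k. i < m \<Longrightarrow> j < m \<Longrightarrow> k < m \<Longrightarrow> h i j k = h j i k"
    and "\<And>i j k. i < m \<Longrightarrow> j < m \<Longrightarrow> k < m \<Longrightarrow> h i j k = h i k j"
    and "\<And>i k. i < m \<Longrightarrow> k < m \<Longrightarrow> h i i k = 0"
  shows "6 * (\<Sum>(i, j, k)\<in>{(i, j, k). i < j \<and> j < k \<and> k < m}. h i j k) = (\<Sum>i<m. \<Sum>j<m. \<Sum>k<m. h i j k)"
  using assms
proof (induction m)
  case (Suc m)
  have set: "{(i, j, k). i < j \<and> j < k \<and> k < Suc m}
      = {(i, j, k). i < j \<and> j < k \<and> k < m} \<union> (\<lambda>(i, j). (i, j, m)) ` {(i, j). i < j \<and> j < m}"
    by (auto simp: less_Suc_eq image_iff)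
  have fin: "finite {(i, j). i < j \<and> j < (m::nat)}"
    by (rule finite_subset[of _ "{..<m} \<times> {..<m}"]) auto
  have fin3: "finite {(i, j, k). i < j \<and> j < k \<and> k < (m::nat)}"
    by (rule finite_subset[of _ "{..<m} \<times> {..<m} \<times> {..<m}"]) auto
  have "(\<Sum>(i, j, k)\<in>{(i, j, k). i < j \<and> j < k \<and> k < Suc m}. h i j k)
      = (\<Sum>(i, j, k)\<in>{(i, j, k). i < j \<and> j < k \<and> k < m}. h i j k) + (\<Sum>(i, j)\<in>{(i, j). i < j \<and> j < m}. h i j m)"
    unfolding set by (subst sum.union_disjoint) (auto simp: fin fin3 sum.reindex inj_on_def case_prod_beta)
  moreover have "2 * (\<Sum>(i, j)\<in>{(i, j). i < j \<and> j < m}. h i j m) = (\<Sum>i<m. \<Sum>j<m. h i j m)"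
    by (rule sum_pairs_eq) (use Suc.prems in auto)
  moreover have "(\<Sum>i<Suc m. \<Sum>j<Suc m. \<Sum>k<Suc m. h i j k)
      = (\<Sum>i<m. \<Sum>j<m. \<Sum>k<m. h i j k) + 3 * (\<Sum>i<m. \<Sum>j<m. h i j m)"
  proof -
    have z: "h i m m = 0" "h m i m = 0" "h m m i = 0" if "i \<le> m" for i
      using Suc.prems(1)[of i m m] Suc.prems(2)[of m i m] Suc.prems(3)[of m i] that by auto
    have s: "h i m j = h i j m" "h m i j = h i j m" if "i < m" "j < m" for i j
      using Suc.prems(1)[of m i j] Suc.prems(2)[of i m j] that by auto
    show ?thesis by (simp add: sum.distrib z s)
  qed
  ultimately show ?case using Suc by (simp add: distrib_left)
qed (auto intro!: sum.neutral)

section \<open>The spin action\<close>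

context linear_algebra begin

lemma dual_left: "\<psi> \<in> dual A \<Longrightarrow> y \<in> carrier A \<Longrightarrow> (\<lambda>x. \<psi> (x \<otimes> y)) \<in> dual A"
  and dual_right: "\<psi> \<in> dual A \<Longrightarrow> x \<in> carrier A \<Longrightarrow> (\<lambda>y. \<psi> (x \<otimes> y)) \<in> dual A"
  and dual_hcomp: "\<psi> \<in> dual A \<Longrightarrow> (\<lambda>x. \<psi> (hcomp A k x)) \<in> dual A"
  using linear_map_dual[OF linear_mult_left] linear_map_dual[OF linear_mult_right] linear_map_dual[OF linear_hcomp]
  by blast+

end

locale spin = clifford B V + invariant_form B
  for B :: "'g::complex_lie_algebra \<Rightarrow> 'g \<Rightarrow> complex" and V :: "'g set"
begin

lemma linear_on_gen: "\<psi> \<in> dual C \<Longrightarrow> linear_on V (\<lambda>v. \<psi> (gen v))"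
  by (simp add: linear_on_def gen_add gen_scale dual_add dual_smult)

lemma bilinear_on_gen:
  assumes "\<psi> \<in> dual C" shows "bilinear_on V (\<lambda>u v. \<psi> (gen u \<cdot> gen v))"
  unfolding bilinear_on_def
proof (intro conjI ballI)
  fix v assume v: "v \<in> V"
  show "linear_on V (\<lambda>u. \<psi> (gen u \<cdot> gen v))"
    using linear_on_gen[OF dual_left[OF assms gen_closed[OF v]]] .
  show "linear_on V (\<lambda>u. \<psi> (gen v \<cdot> gen u))"
    using linear_on_gen[OF dual_right[OF assms gen_closed[OF v]]] .
qed

lemma trilinear_on_gen:
  assumes \<psi>: "\<psi> \<in> dual C" shows "trilinear_on V (\<lambda>u v w. \<psi> (gen u \<cdot> gen v \<cdot> gen w))"
  unfolding trilinear_on_def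
proof (intro conjI ballI)
  fix v w assume vw: "v \<in> V" "w \<in> V"
  have b: "bilinear_on V (\<lambda>u v. \<psi> (gen u \<cdot> gen v \<cdot> gen w))"
    using bilinear_on_gen[OF dual_left[OF \<psi> gen_closed[OF vw(2)]]] .
  show "linear_on V (\<lambda>u. \<psi> (gen u \<cdot> gen v \<cdot> gen w))"
    "linear_on V (\<lambda>u. \<psi> (gen v \<cdot> gen u \<cdot> gen w))"
    using b vw by (simp_all add: bilinear_on_def)
  show "linear_on V (\<lambda>u. \<psi> (gen v \<cdot> gen w \<cdot> gen u))"
    using linear_on_gen[OF dual_right[OF \<psi> mult_closed[OF gen_closed[OF vw(1)] gen_closed[OF vw(2)]]]] .
qed

lemma gen_swap:
  assumes "\<psi> \<in> dual C" "v \<in> V" "w \<in> V"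
  shows "\<psi> (gen v \<cdot> gen w) = 2 * B v w * \<psi> \<one>\<^bsub>C\<^esub> - \<psi> (gen w \<cdot> gen v)"
  using arg_cong[OF gen_anticommute[OF assms(2,3)], of \<psi>] assms
  by (simp add: dual_add dual_smult algebra_simps)

lemma gen_swap_left:
  assumes "\<psi> \<in> dual C" "v \<in> V" "w \<in> V" "c \<in> carrier C"
  shows "\<psi> (gen v \<cdot> gen w \<cdot> c) = 2 * B v w * \<psi> c - \<psi> (gen w \<cdot> gen v \<cdot> c)"
  using gen_swap[OF dual_left[OF assms(1,4)] assms(2,3)] assms by simp

lemma gen_swap_right:
  assumes "\<psi> \<in> dual C" "v \<in> V" "w \<in> V" "c \<in> carrier C"
  shows "\<psi> (c \<cdot> gen v \<cdot> gen w) = 2 * B v w * \<psi> c - \<psi> (c \<cdot> gen w \<cdot> gen v)"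
  using gen_swap[OF dual_right[OF assms(1,4)] assms(2,3)] assms by (simp add: mult_assoc)

text \<open>Generators attached to orthogonal vectors anticommute and the structure form is alternating,
  so their product is symmetric in the three indices and each increasing triple is counted six
  times in the full sum.\<close>

lemma sum_cubic_indices:
  assumes Ws: "orthonormal_basis B V Ws" and \<psi>: "\<psi> \<in> dual C"
  shows "(\<Sum>(i, j, k)\<in>{(i, j, k). i < j \<and> j < k \<and> k < length Ws}.
      B (lie_bracket (Ws ! i) (Ws ! j)) (Ws ! k) * \<psi> (gen (Ws ! i) \<cdot> gen (Ws ! j) \<cdot> gen (Ws ! k)))
    = cubic_sum (set Ws) (\<lambda>u v w. \<psi> (gen u \<cdot> gen v \<cdot> gen w)) / 6"
proof -
  note d = orthonormal_basis_set[OF Ws]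
  have WV: "Ws ! i \<in> V" if "i < length Ws" for i
    using that orthonormal_subset[OF d(2)] by auto
  have on: "B (Ws ! i) (Ws ! j) = (if i = j then 1 else 0)" if "i < length Ws" "j < length Ws" for i j
    using Ws that by (simp add: orthonormal_basis_def)
  let ?G = "\<lambda>u v w. \<psi> (gen u \<cdot> gen v \<cdot> gen w)"
  define h where "h i j k = structure_form (Ws ! i) (Ws ! j) (Ws ! k) * ?G (Ws ! i) (Ws ! j) (Ws ! k)" for i j k
  have diag: "structure_form x x y = 0" "structure_form y x x = 0" for x y
    using structure_form_swap(2)[of y x x] by (simp_all add: structure_form_def bracket_self)
  have "6 * (\<Sum>(i, j, k)\<in>{(i, j, k). i < j \<and> j < k \<and> k < length Ws}. h i j k)
      = (\<Sum>i<length Ws. \<Sum>j<length Ws. \<Sum>k<length Ws. h i j k)"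
  proof (rule sum_triples_eq)
    show "h i j k = h j i k" if "i < length Ws" "j < length Ws" "k < length Ws" for i j k
    proof (cases "i = j")
      case False
      then have "?G (Ws ! i) (Ws ! j) (Ws ! k) = - ?G (Ws ! j) (Ws ! i) (Ws ! k)"
        using gen_swap_left[OF \<psi> WV[OF that(1)] WV[OF that(2)], of "gen (Ws ! k)"] that by (simp add: WV on)
      then show ?thesis
        unfolding h_def by (subst structure_form_swap(1)) simp
    qed simp
    show "h i j k = h i k j" if "i < length Ws" "j < length Ws" "k < length Ws" for i j k
    proof (cases "j = k")
      case False
      then have "?G (Ws ! i) (Ws ! j) (Ws ! k) = - ?G (Ws ! i) (Ws ! k) (Ws ! j)"
        using gen_swap_right[OF \<psi> WV[OF that(2)] WV[OF that(3)], of "gen (Ws ! i)"] that by (simp add: WV on)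
      then show ?thesis
        unfolding h_def by (subst structure_form_swap(2)) simp
    qed simp
    show "h i i k = 0" for i k by (simp add: h_def diag)
  qed
  also have "\<dots> = cubic_sum (set Ws) ?G"
    unfolding cubic_sum_def h_def by (simp add: sum_nth_distinct[OF d(1), symmetric])
  finally show ?thesis by (simp add: h_def structure_form_def mult.commute[of _ 6])
qed

context
  fixes Es
  assumes Es: "orthonormal_basis B V Es"
begin

abbreviation \<alpha> where "\<alpha> \<equiv> spin_alpha B V Es"

private lemma E: "orthonormal_set B V (set Es)" and E_mem: "e \<in> set Es \<Longrightarrow> e \<in> V" "i < length Es \<Longrightarrow> Es ! i \<in> V"
proof -
  show E: "orthonormal_set B V (set Es)" by (rule orthonormal_basis_set(2)[OF Es])
  show "e \<in> set Es \<Longrightarrow> e \<in> V" "i < length Es \<Longrightarrow> Es ! i \<in> V"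
    using orthonormal_subset[OF E] by auto
qed

lemma alpha_closed [simp, intro]: "\<alpha> X \<in> carrier C"
  unfolding spin_alpha_def so_to_cliff_def by (rule finsum_closed) (auto simp: E_mem)

text \<open>For distinct indices both the coefficients and the products \<open>Z\<^sub>iZ\<^sub>j\<close> are antisymmetric, so the
  defining sum over \<open>i < j\<close> is half of the full sum; with the factor \<open>1/2\<close> in the definition this
  gives \<open>1/4\<close>. Summing over \<open>i\<close> then reassembles the vector \<open>[X, Z\<^sub>j]\<close>.\<close>

lemma dual_alpha:
  assumes \<psi>: "\<psi> \<in> dual C" and X: "\<And>v. v \<in> V \<Longrightarrow> lie_bracket X v \<in> V"
  shows "\<psi> (\<alpha> X) = (\<Sum>e\<in>set Es. \<psi> (gen (lie_bracket X e) \<cdot> gen e)) / 4"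
proof -
  note d = orthonormal_basis_set[OF Es]
  define h where "h i j = ad_matrix B Es X i j * \<psi> (gen (Es ! i) \<cdot> gen (Es ! j))" for i j
  have "\<psi> (\<alpha> X) = (\<Sum>(i, j)\<in>{(i, j). i < j \<and> j < length Es}. h i j / 2)"
    unfolding spin_alpha_def so_to_cliff_def h_def
    by (subst dual_finsum[OF \<psi>]) (auto simp: E_mem dual_smult[OF \<psi>] intro!: sum.cong)
  also have "\<dots> = (\<Sum>(i, j)\<in>{(i, j). i < j \<and> j < length Es}. h i j) / 2"
    by (simp add: sum_divide_distrib case_prod_beta)
  also have "\<dots> = (2 * (\<Sum>(i, j)\<in>{(i, j). i < j \<and> j < length Es}. h i j)) / 4"
    by simp
  also have "2 * (\<Sum>(i, j)\<in>{(i, j). i < j \<and> j < length Es}. h i j) = (\<Sum>i<length Es. \<Sum>j<length Es. h i j)"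
  proof (rule sum_pairs_eq)
    have skew: "ad_matrix B Es X i j = - ad_matrix B Es X j i" for i j
      unfolding ad_matrix_def by (rule B_ad_skew)
    then have zero: "ad_matrix B Es X i i = 0" for i
      using skew[of i i] by (metis eq_neg_iff_add_eq_0 mult_2 mult_eq_0_iff zero_neq_numeral)
    show "h i j = h j i" if "i < length Es" "j < length Es" for i j
    proof (cases "i = j")
      case False
      then have "B (Es ! i) (Es ! j) = 0" using Es that by (simp add: orthonormal_basis_def)
      then show ?thesis
        using gen_swap[OF \<psi> E_mem(2)[OF that(1)] E_mem(2)[OF that(2)]] skew[of i j] by (simp add: h_def)
    qed simp
    show "h i i = 0" for i by (simp add: h_def zero)
  qed
  also have "(\<Sum>i<length Es. \<Sum>j<length Es. h i j)
      = (\<Sum>e'\<in>set Es. \<Sum>e\<in>set Es. B (lie_bracket X e') e * \<psi> (gen e \<cdot> gen e'))"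
    unfolding h_def ad_matrix_def
    by (subst sum.swap) (simp add: sum_nth_distinct[OF d(1), symmetric])
  also have "\<dots> = (\<Sum>e'\<in>set Es. \<psi> (gen (lie_bracket X e') \<cdot> gen e'))"
    using bilinear_on_gen[OF \<psi>] X E_mem(1)
    by (intro sum.cong refl linear_on_expand[OF E, symmetric]) (auto simp: bilinear_on_def)
  finally show ?thesis .
qed

lemma alpha_add:
  assumes "\<And>v. v \<in> V \<Longrightarrow> lie_bracket X v \<in> V" "\<And>v. v \<in> V \<Longrightarrow> lie_bracket Y v \<in> V"
  shows "\<alpha> (X + Y) = \<alpha> X \<oplus>\<^bsub>C\<^esub> \<alpha> Y"
proof (rule dual_separates)
  fix \<psi> assume \<psi>: "\<psi> \<in> dual C"
  have XY: "lie_bracket (X + Y) v \<in> V" if "v \<in> V" for v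
    using assms that by (simp add: bracket_add_left lie.subspace_add[OF subspace])
  show "\<psi> (\<alpha> (X + Y)) = \<psi> (\<alpha> X \<oplus>\<^bsub>C\<^esub> \<alpha> Y)"
    using assms E_mem(1) \<psi>
    by (simp add: dual_alpha[OF \<psi> XY] dual_alpha[OF \<psi> assms(1)] dual_alpha[OF \<psi> assms(2)] dual_add
        bracket_add_left gen_add mult_add_left sum.distrib add_divide_distrib)
qed auto

lemma alpha_scale:
  assumes "\<And>v. v \<in> V \<Longrightarrow> lie_bracket X v \<in> V"
  shows "\<alpha> (scaleC c X) = c \<odot>\<^bsub>C\<^esub> \<alpha> X"
proof (rule dual_separates)
  fix \<psi> assume \<psi>: "\<psi> \<in> dual C"
  have cX: "lie_bracket (scaleC c X) v \<in> V" if "v \<in> V" for v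
    using assms that by (simp add: bracket_scaleC_left lie.subspace_scale[OF subspace])
  show "\<psi> (\<alpha> (scaleC c X)) = \<psi> (c \<odot>\<^bsub>C\<^esub> \<alpha> X)"
    using assms E_mem(1) \<psi>
    by (simp add: dual_alpha[OF \<psi> cX] dual_alpha[OF \<psi> assms(1)] dual_smult
        bracket_scaleC_left gen_scale mult_smult_left sum_distrib_left)
qed auto

text \<open>Moving \<open>v\<close> to the left through \<open>[X, e] e\<close> produces \<open>2 B(e, v) [X, e]\<close> and
  \<open>-2 B([X, e], v) e = 2 B([X, v], e) e\<close>. After summation over \<open>e\<close> each of them is
  \<open>2 [X, v]\<close>, and the factor \<open>1/4\<close> turns their sum into \<open>[X, v]\<close>.\<close>

lemma alpha_commutator:
  assumes X: "\<And>v. v \<in> V \<Longrightarrow> lie_bracket X v \<in> V" and v: "v \<in> V"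
  shows "\<alpha> X \<cdot> gen v = gen v \<cdot> \<alpha> X \<oplus>\<^bsub>C\<^esub> gen (lie_bracket X v)"
proof (rule dual_separates)
  fix \<psi> assume \<psi>: "\<psi> \<in> dual C"
  have move: "\<psi> (gen (lie_bracket X e) \<cdot> gen e \<cdot> gen v)
      = \<psi> (gen v \<cdot> (gen (lie_bracket X e) \<cdot> gen e))
        + 2 * (B (lie_bracket X v) e * \<psi> (gen e)) + 2 * (B v e * \<psi> (gen (lie_bracket X e)))"
    if "e \<in> set Es" for e
  proof -
    have "\<psi> (gen (lie_bracket X e) \<cdot> gen e \<cdot> gen v)
        = 2 * B e v * \<psi> (gen (lie_bracket X e)) - \<psi> (gen (lie_bracket X e) \<cdot> gen v \<cdot> gen e)"
      by (rule gen_swap_right[OF \<psi>]) (use X v that E_mem in auto)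
    also have "\<psi> (gen (lie_bracket X e) \<cdot> gen v \<cdot> gen e)
        = 2 * B (lie_bracket X e) v * \<psi> (gen e) - \<psi> (gen v \<cdot> gen (lie_bracket X e) \<cdot> gen e)"
      by (rule gen_swap_left[OF \<psi>]) (use X v that E_mem in auto)
    finally show ?thesis
      using X v that E_mem B_ad_skew[of X e v] by (simp add: B_commute[of e v] mult_assoc)
  qed
  have "\<psi> (\<alpha> X \<cdot> gen v) = (\<Sum>e\<in>set Es. \<psi> (gen (lie_bracket X e) \<cdot> gen e \<cdot> gen v)) / 4"
    using dual_alpha[OF dual_left[OF \<psi>] X] v by simp
  also have "\<dots> = (\<Sum>e\<in>set Es. \<psi> (gen v \<cdot> (gen (lie_bracket X e) \<cdot> gen e))) / 4
      + (\<Sum>e\<in>set Es. B (lie_bracket X v) e * \<psi> (gen e)) / 2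
      + (\<Sum>e\<in>set Es. B v e * \<psi> (gen (lie_bracket X e))) / 2"
    by (simp add: move sum.distrib sum_distrib_left[symmetric] add_divide_distrib)
  also have "(\<Sum>e\<in>set Es. \<psi> (gen v \<cdot> (gen (lie_bracket X e) \<cdot> gen e))) / 4 = \<psi> (gen v \<cdot> \<alpha> X)"
    using dual_alpha[OF dual_right[OF \<psi>] X] v by simp
  also have "(\<Sum>e\<in>set Es. B (lie_bracket X v) e * \<psi> (gen e)) = \<psi> (gen (lie_bracket X v))"
    by (rule linear_on_expand[OF E linear_on_gen[OF \<psi>] X[OF v], symmetric])
  also have "(\<Sum>e\<in>set Es. B v e * \<psi> (gen (lie_bracket X e))) = \<psi> (gen (lie_bracket X v))"
  proof (rule linear_on_expand[OF E _ v, symmetric])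
    show "linear_on V (\<lambda>v. \<psi> (gen (lie_bracket X v)))"
      using X \<psi> by (simp add: linear_on_def bracket_add_right bracket_scaleC_right gen_add gen_scale dual_add dual_smult)
  qed
  finally show "\<psi> (\<alpha> X \<cdot> gen v) = \<psi> (gen v \<cdot> \<alpha> X \<oplus>\<^bsub>C\<^esub> gen (lie_bracket X v))"
    using \<psi> X v by (simp add: dual_add)
qed (use X v in auto)

lemma dual_alpha_pair:
  assumes \<psi>: "\<psi> \<in> dual C" and X: "\<And>v. v \<in> V \<Longrightarrow> lie_bracket X v \<in> V" and "u \<in> V" "v \<in> V"
  shows "\<psi> (\<alpha> X \<cdot> (gen u \<cdot> gen v)) = \<psi> (gen u \<cdot> gen v \<cdot> \<alpha> X)
     + \<psi> (gen (lie_bracket X u) \<cdot> gen v) + \<psi> (gen u \<cdot> gen (lie_bracket X v))"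
proof -
  have "\<alpha> X \<cdot> (gen u \<cdot> gen v) = (\<alpha> X \<cdot> gen u) \<cdot> gen v"
    using assms by (simp add: mult_assoc)
  also have "\<dots> = gen u \<cdot> (\<alpha> X \<cdot> gen v) \<oplus>\<^bsub>C\<^esub> gen (lie_bracket X u) \<cdot> gen v"
    using assms by (simp add: alpha_commutator[of X u] mult_assoc mult_add_left)
  also have "\<dots> = (gen u \<cdot> gen v \<cdot> \<alpha> X \<oplus>\<^bsub>C\<^esub> gen u \<cdot> gen (lie_bracket X v)) \<oplus>\<^bsub>C\<^esub> gen (lie_bracket X u) \<cdot> gen v"
    using assms by (simp add: alpha_commutator[of X v] mult_assoc mult_add_right)
  finally show ?thesis using assms by (simp add: dual_add)
qed

lemma dual_alpha_triple:
  assumes \<psi>: "\<psi> \<in> dual C" and X: "\<And>v. v \<in> V \<Longrightarrow> lie_bracket X v \<in> V" and uvw: "u \<in> V" "v \<in> V" "w \<in> V"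
  shows "\<psi> (\<alpha> X \<cdot> (gen u \<cdot> gen v \<cdot> gen w)) = \<psi> (gen u \<cdot> gen v \<cdot> gen w \<cdot> \<alpha> X)
     + (\<psi> (gen (lie_bracket X u) \<cdot> gen v \<cdot> gen w) + \<psi> (gen u \<cdot> gen (lie_bracket X v) \<cdot> gen w)
     + \<psi> (gen u \<cdot> gen v \<cdot> gen (lie_bracket X w)))"
proof -
  have "\<psi> (\<alpha> X \<cdot> (gen u \<cdot> gen v \<cdot> gen w)) = \<psi> (\<alpha> X \<cdot> (gen u \<cdot> gen v) \<cdot> gen w)"
    using uvw by (simp add: mult_assoc)
  also have "\<dots> = \<psi> (gen u \<cdot> gen v \<cdot> \<alpha> X \<cdot> gen w)
     + \<psi> (gen (lie_bracket X u) \<cdot> gen v \<cdot> gen w) + \<psi> (gen u \<cdot> gen (lie_bracket X v) \<cdot> gen w)"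
    using dual_alpha_pair[OF dual_left[OF \<psi>, of "gen w"] X uvw(1,2)] uvw by simp
  also have "gen u \<cdot> gen v \<cdot> \<alpha> X \<cdot> gen w
      = gen u \<cdot> gen v \<cdot> gen w \<cdot> \<alpha> X \<oplus>\<^bsub>C\<^esub> gen u \<cdot> gen v \<cdot> gen (lie_bracket X w)"
    using uvw X by (simp add: alpha_commutator[of X w] mult_assoc mult_add_right)
  finally show ?thesis using uvw X \<psi> by (simp add: dual_add)
qed

text \<open>By the commutator with generators, the commutator of \<open>\<alpha> X\<close> with
  \<open>\<alpha> Y = 1/4 \<Sum>\<^sub>e [Y, e] e\<close> is \<open>1/4\<close> of the sum of \<open>[X, [Y, e]] e + [Y, e] [X, e]\<close>. Skewness
  of \<open>X\<close> replaces the second term by \<open>- [Y, [X, e]] e\<close>.\<close>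

lemma alpha_bracket:
  assumes X: "\<And>v. v \<in> V \<Longrightarrow> lie_bracket X v \<in> V" and Y: "\<And>v. v \<in> V \<Longrightarrow> lie_bracket Y v \<in> V"
  shows "\<alpha> X \<cdot> \<alpha> Y = \<alpha> Y \<cdot> \<alpha> X \<oplus>\<^bsub>C\<^esub> \<alpha> (lie_bracket X Y)"
proof (rule dual_separates)
  fix \<psi> assume \<psi>: "\<psi> \<in> dual C"
  let ?XY = "lie_bracket X Y"
  have ad: "lie_bracket ?XY v = lie_bracket X (lie_bracket Y v) - lie_bracket Y (lie_bracket X v)" for v
    using bracket_derivation[of X Y v] by simp
  have XY: "lie_bracket ?XY v \<in> V" if "v \<in> V" for v
    using that X Y by (simp add: ad lie.subspace_diff[OF subspace])
  have lin: "bilinear_on V (\<lambda>u v. \<psi> (gen (lie_bracket Y u) \<cdot> gen v))"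
  proof -
    have "linear_on V (\<lambda>u. \<phi> (lie_bracket Y u))" if "linear_on V \<phi>" for \<phi>
      using that Y by (simp add: linear_on_def bracket_add_right bracket_scaleC_right)
    from this[OF linear_on_gen[OF dual_left[OF \<psi> gen_closed]]] show ?thesis
      using bilinear_on_gen[OF \<psi>] Y by (simp add: bilinear_on_def)
  qed
  have diff: "\<psi> (gen (u - v) \<cdot> gen w) = \<psi> (gen u \<cdot> gen w) - \<psi> (gen v \<cdot> gen w)"
    if "u \<in> V" "v \<in> V" "w \<in> V" for u v w
  proof -
    have "linear_on V (\<lambda>u. \<psi> (gen u \<cdot> gen w))"
      using bilinear_on_gen[OF \<psi>] that by (simp add: bilinear_on_def)
    moreover have "u - v \<in> V" using that by (simp add: lie.subspace_diff[OF subspace])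
    ultimately have "\<psi> (gen ((u - v) + v) \<cdot> gen w) = \<psi> (gen (u - v) \<cdot> gen w) + \<psi> (gen v \<cdot> gen w)"
      using that(2) unfolding linear_on_def by blast
    then show ?thesis by simp
  qed
  have "4 * \<psi> (\<alpha> X \<cdot> \<alpha> Y) = (\<Sum>e\<in>set Es. \<psi> (\<alpha> X \<cdot> (gen (lie_bracket Y e) \<cdot> gen e)))"
    by (simp add: dual_alpha[OF dual_right[OF \<psi>] Y])
  also have "\<dots> = (\<Sum>e\<in>set Es. \<psi> (gen (lie_bracket Y e) \<cdot> gen e \<cdot> \<alpha> X))
      + (\<Sum>e\<in>set Es. \<psi> (gen (lie_bracket X (lie_bracket Y e)) \<cdot> gen e))
      + (\<Sum>e\<in>set Es. \<psi> (gen (lie_bracket Y e) \<cdot> gen (lie_bracket X e)))"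
    by (simp add: dual_alpha_pair[OF \<psi> X] Y E_mem sum.distrib)
  also have "(\<Sum>e\<in>set Es. \<psi> (gen (lie_bracket Y e) \<cdot> gen e \<cdot> \<alpha> X)) = 4 * \<psi> (\<alpha> Y \<cdot> \<alpha> X)"
    by (simp add: dual_alpha[OF dual_left[OF \<psi>] Y])
  also have "(\<Sum>e\<in>set Es. \<psi> (gen (lie_bracket Y e) \<cdot> gen (lie_bracket X e)))
      = - (\<Sum>e\<in>set Es. \<psi> (gen (lie_bracket Y (lie_bracket X e)) \<cdot> gen e))"
    using contraction_invariant[OF E lin X] by simp
  also have "4 * \<psi> (\<alpha> Y \<cdot> \<alpha> X) + (\<Sum>e\<in>set Es. \<psi> (gen (lie_bracket X (lie_bracket Y e)) \<cdot> gen e))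
      + - (\<Sum>e\<in>set Es. \<psi> (gen (lie_bracket Y (lie_bracket X e)) \<cdot> gen e))
      = 4 * (\<psi> (\<alpha> Y \<cdot> \<alpha> X) + \<psi> (\<alpha> ?XY))"
    by (simp add: dual_alpha[OF \<psi> XY] ad diff X Y E_mem sum_subtractf)
  finally have "\<psi> (\<alpha> X \<cdot> \<alpha> Y) = \<psi> (\<alpha> Y \<cdot> \<alpha> X) + \<psi> (\<alpha> ?XY)"
    by (simp only: mult_cancel_left) simp
  then show "\<psi> (\<alpha> X \<cdot> \<alpha> Y) = \<psi> (\<alpha> Y \<cdot> \<alpha> X \<oplus>\<^bsub>C\<^esub> \<alpha> ?XY)"
    using \<psi> by (simp add: dual_add)
qed auto

lemma alpha_even:
  assumes X: "\<And>v. v \<in> V \<Longrightarrow> lie_bracket X v \<in> V"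
  shows "hcomp C k (\<alpha> X) = (if k = 0 then \<alpha> X else \<zero>\<^bsub>C\<^esub>)"
proof (rule dual_separates)
  fix \<psi> assume \<psi>: "\<psi> \<in> dual C"
  have "hcomp C k (gen u \<cdot> gen v) = (if k = 0 then gen u \<cdot> gen v else \<zero>\<^bsub>C\<^esub>)" if "u \<in> V" "v \<in> V" for u v
    using hcomp_word[of "[u, v]" k] that by (simp add: word_simps)
  then show "\<psi> (hcomp C k (\<alpha> X)) = \<psi> (if k = 0 then \<alpha> X else \<zero>\<^bsub>C\<^esub>)"
    by (simp add: dual_alpha[OF dual_hcomp[OF \<psi>] X] dual_alpha[OF \<psi> X] X E_mem dual_zero[OF \<psi>])
qed auto

end

end

lemma dual_plus: "f \<in> dual A \<Longrightarrow> g \<in> dual A \<Longrightarrow> (\<lambda>x. f x + g x) \<in> dual A"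
  and dual_times: "f \<in> dual A \<Longrightarrow> (\<lambda>x. c * f x) \<in> dual A"
  by (simp_all add: dual_def distrib_left mult.left_commute)

section \<open>Cubic Dirac operators\<close>

context spin begin

text \<open>The triples with exactly one entry in \<open>Y\<close> contribute three equal sums, because a vector of
  \<open>Y\<close> can be moved past the orthogonal vectors of \<open>Z\<close>. On those with exactly two
  entries in \<open>Y\<close> the structure form vanishes.\<close>

lemma cubic_sum_union:
  fixes Z Y
  assumes \<psi>: "\<psi> \<in> dual C" and fin: "finite Z" "finite Y" and ZY: "Z \<subseteq> V" "Y \<subseteq> V"
    and orth: "\<And>z y. z \<in> Z \<Longrightarrow> y \<in> Y \<Longrightarrow> B z y = 0" "Z \<inter> Y = {}"
    and zero: "\<And>y y' z. y \<in> Y \<Longrightarrow> y' \<in> Y \<Longrightarrow> z \<in> Z \<Longrightarrow> structure_form y y' z = 0"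
  defines "G \<equiv> \<lambda>u v w. \<psi> (gen u \<cdot> gen v \<cdot> gen w)"
  shows "cubic_sum (Z \<union> Y) G = cubic_sum Z G + cubic_sum Y G
    + 3 * (\<Sum>z\<in>Z. \<Sum>z'\<in>Z. \<Sum>y\<in>Y. structure_form z z' y * G z z' y)"
proof -
  let ?h = "\<lambda>u v w. structure_form u v w * G u v w"
  have sw1: "?h v u w = ?h u v w" if "u \<in> Z" "v \<in> Y" "w \<in> Z \<union> Y" for u v w
  proof -
    have "G u v w = - G v u w"
      unfolding G_def using gen_swap_left[OF \<psi>, of u v "gen w"] orth(1)[OF that(1,2)] that ZY by auto
    then show ?thesis by (subst structure_form_swap(1)) simp
  qed
  have sw2: "?h w v u = ?h w u v" if "u \<in> Z" "v \<in> Y" "w \<in> Z \<union> Y" for u v w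
  proof -
    have "G w u v = - G w v u"
      unfolding G_def using gen_swap_right[OF \<psi>, of u v "gen w"] orth(1)[OF that(1,2)] that ZY by auto
    then show ?thesis by (subst structure_form_swap(2)) simp
  qed
  have z: "?h y y' z = 0" "?h y z y' = 0" "?h z y y' = 0" if "y \<in> Y" "y' \<in> Y" "z \<in> Z" for y y' z
  proof -
    show yyz: "?h y y' z = 0" using zero[OF that] by simp
    show "?h y z y' = 0" using sw2[of z y' y] yyz that by simp
    then show "?h z y y' = 0" using sw1[of z y y'] that by simp
  qed
  have e: "?h z y z' = ?h z z' y" "?h y z z' = ?h z z' y" if "z \<in> Z" "z' \<in> Z" "y \<in> Y" for z z' y
  proof -
    show zyz: "?h z y z' = ?h z z' y" using sw2[of z' y z] that by simp
    show "?h y z z' = ?h z z' y" using sw1[of z y z'] zyz that by simp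
  qed
  have U: "(\<Sum>u\<in>Z \<union> Y. f u) = (\<Sum>u\<in>Z. f u) + (\<Sum>u\<in>Y. f u)" for f :: "'g \<Rightarrow> complex"
    by (rule sum.union_disjoint[OF fin orth(2)])
  have zyz: "(\<Sum>z\<in>Z. \<Sum>y\<in>Y. \<Sum>z'\<in>Z. ?h z y z') = (\<Sum>z\<in>Z. \<Sum>z'\<in>Z. \<Sum>y\<in>Y. ?h z z' y)"
    by (subst sum.swap) (simp add: e)
  have yzz: "(\<Sum>y\<in>Y. \<Sum>z\<in>Z. \<Sum>z'\<in>Z. ?h y z z') = (\<Sum>z\<in>Z. \<Sum>z'\<in>Z. \<Sum>y\<in>Y. ?h z z' y)"
    by (subst sum.swap, subst (2) sum.swap) (simp add: e)
  show ?thesis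
    unfolding cubic_sum_def U sum.distrib zyz yzz by (simp add: z)
qed

end

text \<open>The algebra \<open>U(a) \<otimes> C(V)\<close>.\<close>

locale dirac = U: enveloping a + spin B V
  for a :: "'g::complex_lie_algebra set" and B :: "'g \<Rightarrow> 'g \<Rightarrow> complex" and V :: "'g set"
begin

sublocale t: even_tensor "env_alg a" "cliff_alg B V"
  by unfold_locales (simp_all add: U.even graded)

lemma env_cliff: "env_cliff B a V = t.T" and ec_tens: "ec_tens B a V = t.tens"
  by (simp_all add: env_cliff_def ec_tens_def)

abbreviation ug where "ug \<equiv> env_gen a"
abbreviation one_U where "one_U \<equiv> \<one>\<^bsub>env_alg a\<^esub>"

lemma dual_tens_left: "\<psi> \<in> dual t.T \<Longrightarrow> c \<in> carrier C \<Longrightarrow> (\<lambda>u. \<psi> (t.tens u c)) \<in> dual (env_alg a)"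
  and dual_tens_right: "\<psi> \<in> dual t.T \<Longrightarrow> u \<in> carrier (env_alg a) \<Longrightarrow> (\<lambda>c. \<psi> (t.tens u c)) \<in> dual C"
  using linear_map_dual[OF t.linear_tens_left] linear_map_dual[OF t.linear_tens_right] by blast+

lemma bilinear_on_tens:
  assumes "V \<subseteq> a" "\<psi> \<in> dual t.T"
  shows "bilinear_on V (\<lambda>u v. \<psi> (t.tens (ug u) (gen v)))"
  unfolding bilinear_on_def
proof (intro conjI ballI)
  fix v assume v: "v \<in> V"
  have "ug v \<in> carrier (env_alg a)" using assms v by auto
  then show "linear_on V (\<lambda>x. \<psi> (t.tens (ug v) (gen x)))"
    by (rule linear_on_gen[OF dual_tens_right[OF assms(2)]])
  note d = dual_tens_left[OF assms(2) gen_closed[OF v]]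
  show "linear_on V (\<lambda>x. \<psi> (t.tens (ug x) (gen v)))"
    using assms(1) by (auto simp: linear_on_def U.gen_add U.gen_scale dual_add[OF d] dual_smult[OF d] subset_iff)
qed

context
  fixes b Ws
  assumes V: "V = orth_compl B a b" and Ws: "orthonormal_basis B V Ws"
begin

lemma V_subset: "V \<subseteq> a"
  unfolding V orth_compl_def by auto

lemma Ws_mem: "i < length Ws \<Longrightarrow> Ws ! i \<in> V" "w \<in> set Ws \<Longrightarrow> w \<in> V"
  using orthonormal_subset[OF orthonormal_basis_set(2)[OF Ws]] by auto

lemma cubic_dirac_closed: "cubic_dirac B a b Ws \<in> carrier t.T"
  and dual_cubic_dirac: "\<psi> \<in> dual t.T \<Longrightarrow> \<psi> (cubic_dirac B a b Ws) =
    (\<Sum>w\<in>set Ws. \<psi> (t.tens (ug w) (gen w)))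
    - cubic_sum (set Ws) (\<lambda>u v w. \<psi> (t.tens one_U (gen u \<cdot> gen v \<cdot> gen w))) / 12"
proof -
  define S where "S = {(i, j, k). i < j \<and> j < k \<and> k < length Ws}"
  define q where "q = (\<lambda>(i, j, k). B (lie_bracket (Ws ! i) (Ws ! j)) (Ws ! k) \<odot>\<^bsub>t.T\<^esub>
     t.tens one_U (gen (Ws ! i) \<cdot> gen (Ws ! j) \<cdot> gen (Ws ! k)))"
  define l where "l k = t.tens (ug (Ws ! k)) (gen (Ws ! k))" for k
  have D: "cubic_dirac B a b Ws = finsum t.T l {..<length Ws} \<ominus>\<^bsub>t.T\<^esub> (1/2) \<odot>\<^bsub>t.T\<^esub> finsum t.T q S"
    unfolding cubic_dirac_def Let_def V[symmetric] env_cliff ec_tens S_def q_def l_def ..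
  have l: "l k \<in> carrier t.T" if "k \<in> {..<length Ws}" for k
    using that Ws_mem(1)[of k] V_subset by (auto simp: l_def subset_iff)
  have q: "q x \<in> carrier t.T" if "x \<in> S" for x
    using that Ws_mem by (auto simp: q_def S_def)
  have fl: "finsum t.T l {..<length Ws} \<in> carrier t.T" and fq: "finsum t.T q S \<in> carrier t.T"
    using l q by (auto intro!: t.T.finsum_closed)
  show "cubic_dirac B a b Ws \<in> carrier t.T"
    unfolding D using fl fq by (intro t.T.minus_closed) auto
  assume \<psi>: "\<psi> \<in> dual t.T"
  note \<phi> = dual_tens_right[OF \<psi> U.one_closed]
  have "\<psi> (cubic_dirac B a b Ws) = (\<Sum>k<length Ws. \<psi> (l k)) - (1/2) * (\<Sum>x\<in>S. \<psi> (q x))"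
  proof -
    have "\<psi> (finsum t.T l {..<length Ws}) = (\<Sum>k<length Ws. \<psi> (l k))"
      by (rule t.T.dual_finsum[OF \<psi> l])
    moreover have "\<psi> (finsum t.T q S) = (\<Sum>x\<in>S. \<psi> (q x))"
      by (rule t.T.dual_finsum[OF \<psi> q])
    ultimately show ?thesis
      unfolding D using fl fq by (simp add: t.T.dual_minus[OF \<psi>] dual_smult[OF \<psi>])
  qed
  also have "(\<Sum>k<length Ws. \<psi> (l k)) = (\<Sum>w\<in>set Ws. \<psi> (t.tens (ug w) (gen w)))"
    unfolding l_def by (rule sum_nth_distinct[OF orthonormal_basis_set(1)[OF Ws]])
  also have "(\<Sum>x\<in>S. \<psi> (q x)) = (\<Sum>(i, j, k)\<in>S. B (lie_bracket (Ws ! i) (Ws ! j)) (Ws ! k) *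
     \<psi> (t.tens one_U (gen (Ws ! i) \<cdot> gen (Ws ! j) \<cdot> gen (Ws ! k))))"
    by (rule sum.cong[OF refl]) (auto simp: q_def S_def Ws_mem dual_smult[OF \<psi>])
  also have "\<dots> = cubic_sum (set Ws) (\<lambda>u v w. \<psi> (t.tens one_U (gen u \<cdot> gen v \<cdot> gen w))) / 6"
    unfolding S_def by (rule sum_cubic_indices[OF Ws \<phi>])
  finally show "\<psi> (cubic_dirac B a b Ws) =
    (\<Sum>w\<in>set Ws. \<psi> (t.tens (ug w) (gen w)))
    - cubic_sum (set Ws) (\<lambda>u v w. \<psi> (t.tens one_U (gen u \<cdot> gen v \<cdot> gen w))) / 12"
    by simp
qed

lemma cubic_dirac_odd: "hcomp t.T k (cubic_dirac B a b Ws) = (if k = 1 then cubic_dirac B a b Ws else \<zero>\<^bsub>t.T\<^esub>)"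
proof (rule t.T.dual_separates)
  fix \<psi> assume \<psi>: "\<psi> \<in> dual t.T"
  have g: "hcomp C k (gen u) = (if k = 1 then gen u else \<zero>\<^bsub>C\<^esub>)" if "u \<in> V" for u
    using hcomp_word[of "[u]" k] that by (simp add: word_simps)
  have ggg: "hcomp C k (gen u \<cdot> gen v \<cdot> gen w) = (if k = 1 then gen u \<cdot> gen v \<cdot> gen w else \<zero>\<^bsub>C\<^esub>)"
    if "u \<in> V" "v \<in> V" "w \<in> V" for u v w
    using hcomp_word[of "[u, v, w]" k] that by (simp add: word_simps)
  have ug: "ug w \<in> carrier (env_alg a)" if "w \<in> V" for w using that V_subset by auto
  show "\<psi> (hcomp t.T k (cubic_dirac B a b Ws)) = \<psi> (if k = 1 then cubic_dirac B a b Ws else \<zero>\<^bsub>t.T\<^esub>)"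
    using dual_zero[OF dual_tens_right[OF \<psi>]]
    by (simp add: dual_cubic_dirac[OF t.T.dual_hcomp[OF \<psi>]] dual_cubic_dirac[OF \<psi>] t.hcomp_tens g ggg
        Ws_mem ug cubic_sum_def dual_zero[OF \<psi>])
qed (use cubic_dirac_closed in auto)

text \<open>Commuting with the diagonal element replaces each basis vector in turn by its bracket with
  \<open>X\<close>: in the first factor by the relations of the enveloping algebra, in the second by the spin
  action. The linear and the cubic part of the operator are contractions with invariant forms, so
  both vanish after this replacement.\<close>

lemma diagonal_commutes:
  assumes Es: "orthonormal_basis B V Es" and X: "X \<in> a" "\<And>v. v \<in> V \<Longrightarrow> lie_bracket X v \<in> V"
  defines "d \<equiv> t.tens (ug X) \<one>\<^bsub>C\<^esub> \<oplus>\<^bsub>t.T\<^esub> t.tens one_U (spin_alpha B V Es X)"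
  shows "d \<otimes>\<^bsub>t.T\<^esub> cubic_dirac B a b Ws = cubic_dirac B a b Ws \<otimes>\<^bsub>t.T\<^esub> d"
proof (rule t.T.dual_separates)
  note alpha_closed[OF Es, simp, intro]
  let ?\<alpha> = "spin_alpha B V Es X" and ?X = "lie_bracket X"
  show "d \<otimes>\<^bsub>t.T\<^esub> cubic_dirac B a b Ws \<in> carrier t.T" "cubic_dirac B a b Ws \<otimes>\<^bsub>t.T\<^esub> d \<in> carrier t.T"
    using cubic_dirac_closed X by (auto simp: d_def)
  have d: "d \<in> carrier t.T" using X by (auto simp: d_def)
  fix \<psi> assume \<psi>: "\<psi> \<in> dual t.T"
  have mem: "u \<in> V" "u \<in> a" "?X u \<in> V" "?X u \<in> a" if "u \<in> set Ws" for u
    using Ws_mem(2)[OF that] V_subset X by auto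
  have linear: "\<psi> (d \<otimes>\<^bsub>t.T\<^esub> t.tens (ug u) (gen u)) = \<psi> (t.tens (ug u) (gen u) \<otimes>\<^bsub>t.T\<^esub> d)
      + (\<psi> (t.tens (ug (?X u)) (gen u)) + \<psi> (t.tens (ug u) (gen (?X u))))" if "u \<in> set Ws" for u
  proof -
    note m = mem[OF that]
    have "ug X \<otimes>\<^bsub>env_alg a\<^esub> ug u = ug u \<otimes>\<^bsub>env_alg a\<^esub> ug X \<oplus>\<^bsub>env_alg a\<^esub> ug (?X u)"
      by (rule U.gen_bracket[OF X(1) m(2)])
    moreover have "?\<alpha> \<cdot> gen u = gen u \<cdot> ?\<alpha> \<oplus>\<^bsub>C\<^esub> gen (?X u)"
      by (rule alpha_commutator[OF Es X(2) m(1)])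
    ultimately show ?thesis
      using m X(1) by (simp add: d_def t.T.mult_add_left t.T.mult_add_right dual_add[OF \<psi>] t.tens_mult
          dual_add[OF dual_tens_left[OF \<psi>]] dual_add[OF dual_tens_right[OF \<psi>]])
  qed
  let ?G = "\<lambda>u v w. \<psi> (t.tens one_U (gen u \<cdot> gen v \<cdot> gen w))"
  have cubic: "\<psi> (d \<otimes>\<^bsub>t.T\<^esub> t.tens one_U (gen u \<cdot> gen v \<cdot> gen w))
      = \<psi> (t.tens one_U (gen u \<cdot> gen v \<cdot> gen w) \<otimes>\<^bsub>t.T\<^esub> d)
        + (?G (?X u) v w + ?G u (?X v) w + ?G u v (?X w))"
    if "u \<in> set Ws" "v \<in> set Ws" "w \<in> set Ws" for u v w
    using mem that X(1) dual_alpha_triple[OF Es dual_tens_right[OF \<psi> U.one_closed] X(2), of u v w]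
    by (simp add: d_def t.T.mult_add_left t.T.mult_add_right dual_add[OF \<psi>] t.tens_mult)
  have G: "trilinear_on V ?G"
    by (rule trilinear_on_gen[OF dual_tens_right[OF \<psi> U.one_closed]])
  have E: "orthonormal_set B V (set Ws)" by (rule orthonormal_basis_set(2)[OF Ws])
  have "\<psi> (d \<otimes>\<^bsub>t.T\<^esub> cubic_dirac B a b Ws) = \<psi> (cubic_dirac B a b Ws \<otimes>\<^bsub>t.T\<^esub> d)
      + ((\<Sum>u\<in>set Ws. \<psi> (t.tens (ug (?X u)) (gen u))) + (\<Sum>u\<in>set Ws. \<psi> (t.tens (ug u) (gen (?X u)))))
      - cubic_sum (set Ws) (\<lambda>u v w. ?G (?X u) v w + ?G u (?X v) w + ?G u v (?X w)) / 12"
    unfolding dual_cubic_dirac[OF t.T.dual_left[OF \<psi> d]] dual_cubic_dirac[OF t.T.dual_right[OF \<psi> d]]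
    by (simp add: linear cubic cubic_sum_def sum.distrib distrib_left add_divide_distrib)
  also have "\<dots> = \<psi> (cubic_dirac B a b Ws \<otimes>\<^bsub>t.T\<^esub> d)"
    using cubic_sum_invariant[OF E G X(2)] contraction_invariant[OF E bilinear_on_tens[OF V_subset \<psi>] X(2)]
    by simp
  finally show "\<psi> (d \<otimes>\<^bsub>t.T\<^esub> cubic_dirac B a b Ws) = \<psi> (cubic_dirac B a b Ws \<otimes>\<^bsub>t.T\<^esub> d)" .
qed

end

end

section \<open>Dirac operators of a pair of compatible decompositions\<close>

text \<open>Here \<open>b\<close> stands for \<open>r \<inter> r'\<close> and \<open>t\<close> for \<open>r \<inter> s'\<close>. The second
  decomposition enters through the orthogonal complements of \<open>b\<close> in \<open>r\<close> and in the whole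
  algebra. Of the two bases of \<open>s\<close>, \<open>Zs\<close> serves for \<open>D(g, r)\<close> and \<open>Es\<close> for the spin
  action.\<close>

locale dirac_pair = invariant_form B
  for B :: "'g::complex_lie_algebra \<Rightarrow> 'g \<Rightarrow> complex" +
  fixes r s t b :: "'g set" and Zs Es Ys Ws :: "'g list"
  assumes r: "lie_subalgebra r"
    and s: "s = orth_compl B UNIV r"
    and t: "t = orth_compl B r b"
    and st: "subspace_sum s t = orth_compl B UNIV b"
    and Zs: "orthonormal_basis B s Zs" and Es: "orthonormal_basis B s Es"
    and Ys: "orthonormal_basis B t Ys" and Ws: "orthonormal_basis B (subspace_sum s t) Ws"
begin

lemma Z: "orthonormal_set B s (set Zs)" and E: "orthonormal_set B s (set Es)"
  and Y: "orthonormal_set B t (set Ys)" and W: "orthonormal_set B (subspace_sum s t) (set Ws)"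
  by (rule orthonormal_basis_set(2)[OF Zs] orthonormal_basis_set(2)[OF Es]
      orthonormal_basis_set(2)[OF Ys] orthonormal_basis_set(2)[OF Ws])+

lemma subspace_s: "lie.subspace s" and subspace_t: "lie.subspace t"
  and subspace_st: "lie.subspace (subspace_sum s t)"
  using orthonormal_subspace[OF Z] orthonormal_subspace[OF Y] orthonormal_subspace[OF W] .

lemma t_sub_r: "t \<subseteq> r"
  unfolding t orth_compl_def by auto

lemma s_sub: "s \<subseteq> subspace_sum s t"
proof
  fix x assume "x \<in> s"
  then have "x + 0 \<in> subspace_sum s t"
    using lie.subspace_0[OF subspace_t] unfolding subspace_sum_def by blast
  then show "x \<in> subspace_sum s t" by simp
qed

lemma t_sub: "t \<subseteq> subspace_sum s t"
proof
  fix x assume "x \<in> t"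
  then have "0 + x \<in> subspace_sum s t"
    using lie.subspace_0[OF subspace_s] unfolding subspace_sum_def by blast
  then show "x \<in> subspace_sum s t" by simp
qed

lemma B_sr: "x \<in> s \<Longrightarrow> y \<in> r \<Longrightarrow> B x y = 0"
  by (simp add: s orth_compl_def)

lemma bracket_r: "x \<in> r \<Longrightarrow> y \<in> r \<Longrightarrow> lie_bracket x y \<in> r"
  using r by (simp add: lie_subalgebra_def)

lemma bracket_rs: "x \<in> r \<Longrightarrow> v \<in> s \<Longrightarrow> lie_bracket x v \<in> s"
  unfolding s orth_compl_def
proof (safe, simp)
  fix y assume "x \<in> r" "y \<in> r" "\<forall>y\<in>r. B v y = 0"
  then show "B (lie_bracket x v) y = 0"
    using B_ad_skew[of x v y] bracket_r[of x y] B_commute[of v] by simp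
qed

text \<open>The three Dirac operators live in \<open>U(g) \<otimes> C(s)\<close>, \<open>U(r) \<otimes> C(t)\<close> and
  \<open>U(g) \<otimes> C(s \<oplus> t)\<close>, which appear below as \<open>gs.t.T\<close>, \<open>rt.t.T\<close> and \<open>gst.t.T\<close>.\<close>

sublocale gs: dirac UNIV B s
  by unfold_locales (simp_all add: lie_subalgebra_def subspace_s)

sublocale rt: dirac r B t
  by unfold_locales (simp_all add: r subspace_t)

sublocale gst: dirac UNIV B "subspace_sum s t"
  by unfold_locales (simp_all add: subspace_st)

abbreviation Big where "Big \<equiv> big_alg B s t"
abbreviation big where "big \<equiv> big_tens B s t"
abbreviation \<alpha> where "\<alpha> \<equiv> spin_alpha B s Es"

sublocale big: tensor_factors "gtensor (env_alg (UNIV :: 'g set)) (cliff_alg B s)" "cliff_alg B t"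
  by (rule tensor_factors.intro[OF gs.t.T.linear_algebra_axioms rt.linear_algebra_axioms])

lemma big_simps: "Big = big.T" "big = big.tens"
  by (simp_all add: big_alg_def big_tens_def env_cliff_def)

definition diag where "diag X = gs.t.tens (env_gen UNIV X) \<one>\<^bsub>cliff_alg B s\<^esub> \<oplus>\<^bsub>gs.t.T\<^esub> gs.t.tens \<one>\<^bsub>env_alg UNIV\<^esub> (\<alpha> X)"

lemma alpha_closed: "\<alpha> X \<in> carrier (cliff_alg B s)"
  by (rule gs.alpha_closed[OF Es])

lemma diag_closed: "diag X \<in> carrier gs.t.T"
  unfolding diag_def using alpha_closed by auto

lemma diag_even: "X \<in> r \<Longrightarrow> hcomp gs.t.T k (diag X) = (if k = 0 then diag X else \<zero>\<^bsub>gs.t.T\<^esub>)"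
proof (rule gs.t.T.dual_separates)
  assume X: "X \<in> r"
  fix \<psi> assume \<psi>: "\<psi> \<in> dual gs.t.T"
  have one: "hcomp (cliff_alg B s) k \<one>\<^bsub>cliff_alg B s\<^esub> = (if k = 0 then \<one>\<^bsub>cliff_alg B s\<^esub> else \<zero>\<^bsub>cliff_alg B s\<^esub>)"
    using gs.hcomp_word[of "[]" k] by (simp add: gs.word_simps)
  note al = gs.alpha_even[OF Es bracket_rs[OF X]]
  show "\<psi> (hcomp gs.t.T k (diag X)) = \<psi> (if k = 0 then diag X else \<zero>\<^bsub>gs.t.T\<^esub>)"
    using alpha_closed[of X] dual_zero[OF gs.dual_tens_right[OF \<psi>]]
    by (simp add: diag_def gs.t.T.hcomp_add gs.t.hcomp_tens one al dual_add[OF \<psi>] dual_zero[OF \<psi>])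
qed (use diag_closed in auto)

lemma
  shows linear_map_diag_env: "linear_map (env_alg r) gs.t.T (diag_env B s Es)"
    and diag_env_gen: "X \<in> r \<Longrightarrow> diag_env B s Es (env_gen r X) = diag X"
    and diag_env_one: "diag_env B s Es \<one>\<^bsub>env_alg r\<^esub> = \<one>\<^bsub>gs.t.T\<^esub>"
proof -
  have lift: "diag_env B s Es = alg_lift gs.t.T diag"
    by (simp add: diag_env_def diag_def[abs_def] gs.env_cliff gs.ec_tens)
  have add: "diag (x + y) = diag x \<oplus>\<^bsub>gs.t.T\<^esub> diag y" if "x \<in> r" "y \<in> r" for x y
  proof (rule gs.t.T.dual_separates)
    fix \<psi> assume \<psi>: "\<psi> \<in> dual gs.t.T"
    have "\<alpha> (x + y) = \<alpha> x \<oplus>\<^bsub>cliff_alg B s\<^esub> \<alpha> y"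
      by (rule gs.alpha_add[OF Es]) (use that bracket_rs in auto)
    then show "\<psi> (diag (x + y)) = \<psi> (diag x \<oplus>\<^bsub>gs.t.T\<^esub> diag y)"
      by (simp add: diag_def alpha_closed gs.U.gen_add dual_add[OF \<psi>] dual_add[OF gs.dual_tens_right[OF \<psi>]]
          dual_add[OF gs.dual_tens_left[OF \<psi>]])
  qed (use diag_closed in auto)
  have scale: "diag (scaleC c x) = c \<odot>\<^bsub>gs.t.T\<^esub> diag x" if "x \<in> r" for c x
  proof (rule gs.t.T.dual_separates)
    fix \<psi> assume \<psi>: "\<psi> \<in> dual gs.t.T"
    have "\<alpha> (scaleC c x) = c \<odot>\<^bsub>cliff_alg B s\<^esub> \<alpha> x"
      by (rule gs.alpha_scale[OF Es]) (use that bracket_rs in auto)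
    then show "\<psi> (diag (scaleC c x)) = \<psi> (c \<odot>\<^bsub>gs.t.T\<^esub> diag x)"
      by (simp add: diag_def alpha_closed gs.U.gen_scale dual_add[OF \<psi>] dual_smult[OF \<psi>]
          dual_smult[OF gs.dual_tens_right[OF \<psi>]] dual_smult[OF gs.dual_tens_left[OF \<psi>]] distrib_left)
  qed (use diag_closed in auto)
  have bracket: "diag x \<otimes>\<^bsub>gs.t.T\<^esub> diag y = diag y \<otimes>\<^bsub>gs.t.T\<^esub> diag x \<oplus>\<^bsub>gs.t.T\<^esub> diag (lie_bracket x y)"
    if "x \<in> r" "y \<in> r" for x y
  proof (rule gs.t.T.dual_separates)
    fix \<psi> assume \<psi>: "\<psi> \<in> dual gs.t.T"
    have a: "\<alpha> x \<otimes>\<^bsub>cliff_alg B s\<^esub> \<alpha> y = \<alpha> y \<otimes>\<^bsub>cliff_alg B s\<^esub> \<alpha> x \<oplus>\<^bsub>cliff_alg B s\<^esub> \<alpha> (lie_bracket x y)"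
      by (rule gs.alpha_bracket[OF Es]) (use that bracket_rs in auto)
    have u: "env_gen UNIV x \<otimes>\<^bsub>env_alg UNIV\<^esub> env_gen UNIV y
        = env_gen UNIV y \<otimes>\<^bsub>env_alg UNIV\<^esub> env_gen UNIV x \<oplus>\<^bsub>env_alg UNIV\<^esub> env_gen UNIV (lie_bracket x y)"
      by (rule gs.U.gen_bracket) auto
    show "\<psi> (diag x \<otimes>\<^bsub>gs.t.T\<^esub> diag y) = \<psi> (diag y \<otimes>\<^bsub>gs.t.T\<^esub> diag x \<oplus>\<^bsub>gs.t.T\<^esub> diag (lie_bracket x y))"
      by (simp add: diag_def alpha_closed gs.t.T.mult_add_left gs.t.T.mult_add_right gs.t.tens_mult dual_add[OF \<psi>]
          a u dual_add[OF gs.dual_tens_right[OF \<psi>]] dual_add[OF gs.dual_tens_left[OF \<psi>]])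
  qed (use diag_closed in auto)
  show "linear_map (env_alg r) gs.t.T (diag_env B s Es)"
    unfolding lift
    by (rule rt.U.linear_map_env_lift[OF gs.t.T.assoc_algebra_axioms diag_closed add scale bracket])
  show "X \<in> r \<Longrightarrow> diag_env B s Es (env_gen r X) = diag X"
    unfolding lift
    by (rule rt.U.env_lift_gen[OF gs.t.T.assoc_algebra_axioms diag_closed add scale bracket])
  show "diag_env B s Es \<one>\<^bsub>env_alg r\<^esub> = \<one>\<^bsub>gs.t.T\<^esub>"
    unfolding lift
    by (rule rt.U.env_lift_one[OF gs.t.T.assoc_algebra_axioms diag_closed add scale bracket])
qed

lemma
  shows linear_map_diag_emb: "linear_map rt.t.T big.T (diag_emb B s t Es)"
    and diag_emb_tens: "u \<in> carrier (env_alg r) \<Longrightarrow> c \<in> carrier (cliff_alg B t) \<Longrightarrow>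
      diag_emb B s t Es (rt.t.tens u c) = big.tens (diag_env B s Es u) c"
proof -
  have e: "diag_emb B s t Es = gtens_lift big.T (\<lambda>u c. big.tens (diag_env B s Es u) c)"
    by (simp add: diag_emb_def big_simps)
  have l: "linear_map (env_alg r) big.T (\<lambda>u. big.tens (diag_env B s Es u) c)" if "c \<in> carrier (cliff_alg B t)" for c
    by (rule linear_map_comp[OF linear_map_diag_env big.linear_tens_left[OF that]])
  have r: "linear_map (cliff_alg B t) big.T (\<lambda>c. big.tens (diag_env B s Es u) c)" if "u \<in> carrier (env_alg r)" for u
    by (rule big.linear_tens_right) (rule linear_map_closed[OF linear_map_diag_env that])
  show "linear_map rt.t.T big.T (diag_emb B s t Es)"
    unfolding e by (rule rt.t.linear_map_gtens_lift[OF big.T.linear_space_axioms l r])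
  show "u \<in> carrier (env_alg r) \<Longrightarrow> c \<in> carrier (cliff_alg B t) \<Longrightarrow>
      diag_emb B s t Es (rt.t.tens u c) = big.tens (diag_env B s Es u) c"
    unfolding e by (rule rt.t.gtens_lift_tens[OF big.T.linear_space_axioms l r])
qed

lemma first_emb_tens: "first_emb B s t x = big.tens x \<one>\<^bsub>cliff_alg B t\<^esub>"
  by (simp add: first_emb_def big_simps)

abbreviation D_gr where "D_gr \<equiv> cubic_dirac B UNIV r Zs"
abbreviation D_r where "D_r \<equiv> cubic_dirac B r b Ys"

lemma D_gr_closed: "D_gr \<in> carrier gs.t.T"
  by (rule gs.cubic_dirac_closed[OF s Zs])

lemma D_r_closed: "D_r \<in> carrier rt.t.T"
  by (rule rt.cubic_dirac_closed[OF t Ys])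

text \<open>The operator is odd in \<open>C(s)\<close>, so passing it across the odd element \<open>c\<close> of \<open>C(t)\<close> costs a
  sign, while the even element \<open>x\<close> commutes with it.\<close>

lemma graded_commutator:
  assumes "x \<in> carrier gs.t.T" and even: "\<And>k. hcomp gs.t.T k x = (if k = 0 then x else \<zero>\<^bsub>gs.t.T\<^esub>)"
    and comm: "x \<otimes>\<^bsub>gs.t.T\<^esub> D_gr = D_gr \<otimes>\<^bsub>gs.t.T\<^esub> x"
    and "c \<in> carrier (cliff_alg B t)" and odd: "\<And>k. hcomp (cliff_alg B t) k c = (if k = 1 then c else \<zero>\<^bsub>cliff_alg B t\<^esub>)"
    and \<psi>: "\<psi> \<in> dual big.T"
  shows "\<psi> (big.tens x c \<otimes>\<^bsub>big.T\<^esub> first_emb B s t D_gr) = - \<psi> (first_emb B s t D_gr \<otimes>\<^bsub>big.T\<^esub> big.tens x c)"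
proof -
  have one: "hcomp (cliff_alg B t) k \<one>\<^bsub>cliff_alg B t\<^esub> = (if k = 0 then \<one>\<^bsub>cliff_alg B t\<^esub> else \<zero>\<^bsub>cliff_alg B t\<^esub>)" for k
    using rt.hcomp_word[of "[]" k] by (simp add: rt.word_simps)
  have z: "\<psi> (big.tens \<zero>\<^bsub>gs.t.T\<^esub> c) = 0" if "c \<in> carrier (cliff_alg B t)" for c
    using dual_zero[OF linear_map_dual[OF big.linear_tens_left[OF that] \<psi>]] .
  have z': "\<psi> (big.tens x \<zero>\<^bsub>cliff_alg B t\<^esub>) = 0" if "x \<in> carrier gs.t.T" for x
    using dual_zero[OF linear_map_dual[OF big.linear_tens_right[OF that] \<psi>]] .
  note odd_D = gs.cubic_dirac_odd[OF s Zs]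
  have "\<psi> (big.tens x c \<otimes>\<^bsub>big.T\<^esub> first_emb B s t D_gr) = - \<psi> (big.tens (x \<otimes>\<^bsub>gs.t.T\<^esub> D_gr) c)"
    using assms D_gr_closed
    by (simp add: first_emb_tens big.dual_tens_mult big.sum_bit2 odd odd_D koszul_sign_def z z'
        gs.t.T.mult_zero_r rt.mult_zero_l)
  moreover have "\<psi> (first_emb B s t D_gr \<otimes>\<^bsub>big.T\<^esub> big.tens x c) = \<psi> (big.tens (D_gr \<otimes>\<^bsub>gs.t.T\<^esub> x) c)"
    using assms D_gr_closed
    by (simp add: first_emb_tens big.dual_tens_mult big.sum_bit2 even one koszul_sign_def z z'
        gs.t.T.mult_zero_r rt.mult_zero_l)
  ultimately show ?thesis using comm by simp
qed

text \<open>Both orders of the product are linear in the operator of \<open>r\<close>, which is a combination of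
  terms \<open>y \<otimes> y\<close> and \<open>1 \<otimes> uvw\<close>. Their images under the diagonal embedding are tensors of an
  even element that commutes with \<open>D(g, r)\<close> and an odd element of \<open>C(t)\<close>.\<close>

theorem anticommute:
  "first_emb B s t D_gr \<otimes>\<^bsub>Big\<^esub> diag_emb B s t Es D_r \<oplus>\<^bsub>Big\<^esub> diag_emb B s t Es D_r \<otimes>\<^bsub>Big\<^esub> first_emb B s t D_gr = \<zero>\<^bsub>Big\<^esub>"
  unfolding big_simps
proof (rule big.T.dual_separates)
  let ?D = "first_emb B s t D_gr"
  have D: "?D \<in> carrier big.T" using D_gr_closed by (auto simp: first_emb_tens)
  have D': "diag_emb B s t Es D_r \<in> carrier big.T" by (rule linear_map_closed[OF linear_map_diag_emb D_r_closed])
  show "?D \<otimes>\<^bsub>big.T\<^esub> diag_emb B s t Es D_r \<oplus>\<^bsub>big.T\<^esub> diag_emb B s t Es D_r \<otimes>\<^bsub>big.T\<^esub> ?D \<in> carrier big.T"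
    using D D' by auto
  show "\<zero>\<^bsub>big.T\<^esub> \<in> carrier big.T" by auto
  fix \<psi> assume \<psi>: "\<psi> \<in> dual big.T"
  have l: "(\<lambda>y. \<psi> (?D \<otimes>\<^bsub>big.T\<^esub> diag_emb B s t Es y)) \<in> dual rt.t.T"
    by (rule linear_map_dual[OF linear_map_diag_emb big.T.dual_right[OF \<psi> D]])
  have r: "(\<lambda>y. \<psi> (diag_emb B s t Es y \<otimes>\<^bsub>big.T\<^esub> ?D)) \<in> dual rt.t.T"
    by (rule linear_map_dual[OF linear_map_diag_emb big.T.dual_left[OF \<psi> D]])
  note Yt = rt.Ws_mem(2)[OF t Ys]
  have linear: "\<psi> (diag_emb B s t Es (rt.t.tens (env_gen r y) (cliff_gen B t y)) \<otimes>\<^bsub>big.T\<^esub> ?D)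
      = - \<psi> (?D \<otimes>\<^bsub>big.T\<^esub> diag_emb B s t Es (rt.t.tens (env_gen r y) (cliff_gen B t y)))" if "y \<in> set Ys" for y
  proof -
    have y: "y \<in> t" "y \<in> r" using Yt[OF that] t_sub_r by auto
    have comm: "diag y \<otimes>\<^bsub>gs.t.T\<^esub> D_gr = D_gr \<otimes>\<^bsub>gs.t.T\<^esub> diag y"
      unfolding diag_def by (rule gs.diagonal_commutes[OF s Zs Es UNIV_I bracket_rs[OF y(2)]])
    have "hcomp (cliff_alg B t) k (cliff_gen B t y) = (if k = 1 then cliff_gen B t y else \<zero>\<^bsub>cliff_alg B t\<^esub>)" for k
      using rt.hcomp_word[of "[y]" k] y by (simp add: rt.word_simps)
    from graded_commutator[OF diag_closed diag_even[OF y(2)] comm rt.gen_closed[OF y(1)] this \<psi>]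
    show ?thesis using y by (simp add: diag_emb_tens diag_env_gen)
  qed
  have cubic: "\<psi> (diag_emb B s t Es (rt.t.tens \<one>\<^bsub>env_alg r\<^esub> c) \<otimes>\<^bsub>big.T\<^esub> ?D)
      = - \<psi> (?D \<otimes>\<^bsub>big.T\<^esub> diag_emb B s t Es (rt.t.tens \<one>\<^bsub>env_alg r\<^esub> c))"
    if uvw: "u \<in> set Ys" "v \<in> set Ys" "w \<in> set Ys"
      and c: "c = cliff_gen B t u \<otimes>\<^bsub>cliff_alg B t\<^esub> cliff_gen B t v \<otimes>\<^bsub>cliff_alg B t\<^esub> cliff_gen B t w" for u v w c
  proof -
    have cw: "c = rt.word [u, v, w]" and cc: "c \<in> carrier (cliff_alg B t)"
      using uvw Yt by (auto simp: c rt.word_simps)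
    have odd: "hcomp (cliff_alg B t) k c = (if k = 1 then c else \<zero>\<^bsub>cliff_alg B t\<^esub>)" for k
      using rt.hcomp_word[of "[u, v, w]" k] uvw Yt unfolding cw by simp
    have "hcomp (cliff_alg B s) k \<one>\<^bsub>cliff_alg B s\<^esub> = (if k = 0 then \<one>\<^bsub>cliff_alg B s\<^esub> else \<zero>\<^bsub>cliff_alg B s\<^esub>)" for k
      using gs.hcomp_word[of "[]" k] by (simp add: gs.word_simps)
    then have even: "hcomp gs.t.T k \<one>\<^bsub>gs.t.T\<^esub> = (if k = 0 then \<one>\<^bsub>gs.t.T\<^esub> else \<zero>\<^bsub>gs.t.T\<^esub>)" for k
      using gs.t.T.linear_map_zero[OF gs.t.linear_tens_right gs.linear_space_axioms, of "\<one>\<^bsub>env_alg UNIV\<^esub>"]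
      by (simp add: gs.t.one_T gs.t.hcomp_tens)
    have comm: "\<one>\<^bsub>gs.t.T\<^esub> \<otimes>\<^bsub>gs.t.T\<^esub> D_gr = D_gr \<otimes>\<^bsub>gs.t.T\<^esub> \<one>\<^bsub>gs.t.T\<^esub>"
      using D_gr_closed by simp
    from graded_commutator[OF gs.t.T.one_closed even comm cc odd \<psi>]
    show ?thesis using cc by (simp add: diag_emb_tens diag_env_one)
  qed
  have "\<psi> (diag_emb B s t Es D_r \<otimes>\<^bsub>big.T\<^esub> ?D) = - \<psi> (?D \<otimes>\<^bsub>big.T\<^esub> diag_emb B s t Es D_r)"
    unfolding rt.dual_cubic_dirac[OF t Ys l] rt.dual_cubic_dirac[OF t Ys r]
    by (simp add: linear cubic cubic_sum_def sum_negf)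
  then show "\<psi> (?D \<otimes>\<^bsub>big.T\<^esub> diag_emb B s t Es D_r \<oplus>\<^bsub>big.T\<^esub> diag_emb B s t Es D_r \<otimes>\<^bsub>big.T\<^esub> ?D) = \<psi> \<zero>\<^bsub>big.T\<^esub>"
    using D D' \<psi> by (simp add: dual_add dual_zero)
qed

end

context dirac_pair begin

abbreviation cW where "cW \<equiv> cliff_gen B (subspace_sum s t)"
abbreviation CW where "CW \<equiv> cliff_alg B (subspace_sum s t)"
abbreviation incl where "incl \<equiv> cliff_incl B (subspace_sum s t)"

lemma
  assumes "V \<subseteq> subspace_sum s t" and V: "lie.subspace V"
  shows linear_map_incl: "linear_map (cliff_alg B V) CW incl"
    and incl_one: "incl \<one>\<^bsub>cliff_alg B V\<^esub> = \<one>\<^bsub>CW\<^esub>"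
    and incl_gen: "u \<in> V \<Longrightarrow> incl (cliff_gen B V u) = cW u"
    and incl_gen2: "u \<in> V \<Longrightarrow> v \<in> V \<Longrightarrow> incl (cliff_gen B V u \<otimes>\<^bsub>cliff_alg B V\<^esub> cliff_gen B V v) = cW u \<otimes>\<^bsub>CW\<^esub> cW v"
    and incl_gen3: "u \<in> V \<Longrightarrow> v \<in> V \<Longrightarrow> w \<in> V \<Longrightarrow>
      incl (cliff_gen B V u \<otimes>\<^bsub>cliff_alg B V\<^esub> cliff_gen B V v \<otimes>\<^bsub>cliff_alg B V\<^esub> cliff_gen B V w)
        = cW u \<otimes>\<^bsub>CW\<^esub> cW v \<otimes>\<^bsub>CW\<^esub> cW w"
proof -
  interpret v: clifford B V by unfold_locales (rule V)
  have VW: "u \<in> V \<Longrightarrow> u \<in> subspace_sum s t" for u using assms(1) by blast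
  note lift = gst.assoc_algebra_axioms gst.gen_closed[OF VW] gst.gen_add[OF VW VW] gst.gen_scale[OF VW]
    gst.gen_anticommute[OF VW VW]
  show "linear_map (cliff_alg B V) CW incl"
    unfolding cliff_incl_def by (rule v.linear_map_cliff_lift[OF lift])
  have word: "set xs \<subseteq> V \<Longrightarrow> incl (v.word xs) = gst.word xs" for xs
    unfolding cliff_incl_def gst.word_def by (rule v.cliff_lift_word[OF lift])
  show "incl \<one>\<^bsub>cliff_alg B V\<^esub> = \<one>\<^bsub>CW\<^esub>"
    using word[of "[]"] by (simp add: v.word_simps gst.word_simps)
  show "u \<in> V \<Longrightarrow> incl (cliff_gen B V u) = cW u"
    using word[of "[u]"] VW by (simp add: v.word_simps gst.word_simps)
  show "u \<in> V \<Longrightarrow> v \<in> V \<Longrightarrow> incl (cliff_gen B V u \<otimes>\<^bsub>cliff_alg B V\<^esub> cliff_gen B V v) = cW u \<otimes>\<^bsub>CW\<^esub> cW v"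
    using word[of "[u, v]"] VW by (simp add: v.word_simps gst.word_simps)
  show "u \<in> V \<Longrightarrow> v \<in> V \<Longrightarrow> w \<in> V \<Longrightarrow>
      incl (cliff_gen B V u \<otimes>\<^bsub>cliff_alg B V\<^esub> cliff_gen B V v \<otimes>\<^bsub>cliff_alg B V\<^esub> cliff_gen B V w)
        = cW u \<otimes>\<^bsub>CW\<^esub> cW v \<otimes>\<^bsub>CW\<^esub> cW w"
    using word[of "[u, v, w]"] VW by (simp add: v.word_simps gst.word_simps)
qed

text \<open>The map is the lift, in the last factor, of lifts in the first two. That these depend linearly
  on the last factor can be checked on pure tensors.\<close>

lemma
  shows linear_map_merge: "linear_map big.T gst.t.T (merge_iso B s t)"
    and merge_tens: "u \<in> carrier (env_alg UNIV) \<Longrightarrow> c \<in> carrier (cliff_alg B s) \<Longrightarrow> e \<in> carrier (cliff_alg B t) \<Longrightarrow>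
      merge_iso B s t (big.tens (gs.t.tens u c) e) = gst.t.tens u (incl c \<otimes>\<^bsub>CW\<^esub> incl e)"
proof -
  note incl_s = linear_map_incl[OF s_sub subspace_s] and incl_t = linear_map_incl[OF t_sub subspace_t]
  define \<beta> where "\<beta> e u c = gst.t.tens u (incl c \<otimes>\<^bsub>CW\<^esub> incl e)" for e u c
  define \<gamma> where "\<gamma> x e = gtens_lift gst.t.T (\<beta> e) x" for x e
  have merge: "merge_iso B s t = gtens_lift gst.t.T \<gamma>"
    by (simp add: merge_iso_def \<gamma>_def[abs_def] \<beta>_def[abs_def] gst.env_cliff gst.ec_tens)
  have prod: "incl c \<otimes>\<^bsub>CW\<^esub> incl e \<in> carrier CW" if "c \<in> carrier (cliff_alg B s)" "e \<in> carrier (cliff_alg B t)" for c e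
    using that linear_map_closed[OF incl_s] linear_map_closed[OF incl_t] by auto
  have \<beta>u: "linear_map (env_alg UNIV) gst.t.T (\<lambda>u. \<beta> e u c)"
    if "c \<in> carrier (cliff_alg B s)" "e \<in> carrier (cliff_alg B t)" for c e
    unfolding \<beta>_def by (rule gst.t.linear_tens_left[OF prod[OF that]])
  have \<beta>c: "linear_map (cliff_alg B s) gst.t.T (\<lambda>c. \<beta> e u c)"
    if "u \<in> carrier (env_alg UNIV)" "e \<in> carrier (cliff_alg B t)" for u e
    unfolding \<beta>_def using that linear_map_closed[OF incl_t]
    by (intro linear_map_comp[OF linear_map_comp[OF incl_s gst.linear_mult_left] gst.t.linear_tens_right])
  have \<beta>e: "linear_map (cliff_alg B t) gst.t.T (\<lambda>e. \<beta> e u c)"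
    if "u \<in> carrier (env_alg UNIV)" "c \<in> carrier (cliff_alg B s)" for u c
    unfolding \<beta>_def using that linear_map_closed[OF incl_s]
    by (intro linear_map_comp[OF linear_map_comp[OF incl_t gst.linear_mult_right] gst.t.linear_tens_right])
  have \<gamma>x: "linear_map gs.t.T gst.t.T (\<lambda>x. \<gamma> x e)" if "e \<in> carrier (cliff_alg B t)" for e
    unfolding \<gamma>_def by (rule gs.t.linear_map_gtens_lift[OF gst.t.T.linear_space_axioms \<beta>u[OF _ that] \<beta>c[OF _ that]])
  have \<gamma>_tens: "\<gamma> (gs.t.tens u c) e = \<beta> e u c"
    if "u \<in> carrier (env_alg UNIV)" "c \<in> carrier (cliff_alg B s)" "e \<in> carrier (cliff_alg B t)" for u c e
    unfolding \<gamma>_def by (rule gs.t.gtens_lift_tens[OF gst.t.T.linear_space_axioms \<beta>u[OF _ that(3)] \<beta>c[OF _ that(3)] that(1,2)])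
  note closed = linear_map_closed[OF \<gamma>x]
  have \<gamma>e: "linear_map (cliff_alg B t) gst.t.T (\<lambda>e. \<gamma> x e)" if x: "x \<in> carrier gs.t.T" for x
  proof (rule linear_mapI[OF gst.t.T.linear_space_axioms rt.linear_space_axioms])
    show "\<gamma> x e \<in> carrier gst.t.T" if "e \<in> carrier (cliff_alg B t)" for e using closed[OF that x] .
    show "\<gamma> x (e \<oplus>\<^bsub>cliff_alg B t\<^esub> e') = \<gamma> x e \<oplus>\<^bsub>gst.t.T\<^esub> \<gamma> x e'"
      if e: "e \<in> carrier (cliff_alg B t)" "e' \<in> carrier (cliff_alg B t)" for e e'
    proof (rule gst.t.T.dual_separates)
      fix \<psi> assume \<psi>: "\<psi> \<in> dual gst.t.T"
      note \<gamma>\<psi> = linear_map_dual[OF \<gamma>x \<psi>]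
      have "\<psi> (\<gamma> x (e \<oplus>\<^bsub>cliff_alg B t\<^esub> e')) = \<psi> (\<gamma> x e) + \<psi> (\<gamma> x e')"
        by (rule gs.t.tens_dual_ext[OF _ dual_plus[OF \<gamma>\<psi> \<gamma>\<psi>] x])
          (use e in \<open>auto intro: \<gamma>\<psi> simp: \<gamma>_tens dual_add[OF linear_map_dual[OF \<beta>e \<psi>]]\<close>)
      then show "\<psi> (\<gamma> x (e \<oplus>\<^bsub>cliff_alg B t\<^esub> e')) = \<psi> (\<gamma> x e \<oplus>\<^bsub>gst.t.T\<^esub> \<gamma> x e')"
        using closed[OF _ x] e by (simp add: dual_add[OF \<psi>])
    qed (use closed x e in auto)
    show "\<gamma> x (k \<odot>\<^bsub>cliff_alg B t\<^esub> e) = k \<odot>\<^bsub>gst.t.T\<^esub> \<gamma> x e" if e: "e \<in> carrier (cliff_alg B t)" for k e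
    proof (rule gst.t.T.dual_separates)
      fix \<psi> assume \<psi>: "\<psi> \<in> dual gst.t.T"
      note \<gamma>\<psi> = linear_map_dual[OF \<gamma>x \<psi>]
      have "\<psi> (\<gamma> x (k \<odot>\<^bsub>cliff_alg B t\<^esub> e)) = k * \<psi> (\<gamma> x e)"
        by (rule gs.t.tens_dual_ext[OF _ dual_times[OF \<gamma>\<psi>] x])
          (use e in \<open>auto intro: \<gamma>\<psi> simp: \<gamma>_tens dual_smult[OF linear_map_dual[OF \<beta>e \<psi>]]\<close>)
      then show "\<psi> (\<gamma> x (k \<odot>\<^bsub>cliff_alg B t\<^esub> e)) = \<psi> (k \<odot>\<^bsub>gst.t.T\<^esub> \<gamma> x e)"
        using closed[OF _ x] e by (simp add: dual_smult[OF \<psi>])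
    qed (use closed x e in auto)
  qed
  show "linear_map big.T gst.t.T (merge_iso B s t)"
    unfolding merge by (rule big.linear_map_gtens_lift[OF gst.t.T.linear_space_axioms \<gamma>x \<gamma>e])
  show "u \<in> carrier (env_alg UNIV) \<Longrightarrow> c \<in> carrier (cliff_alg B s) \<Longrightarrow> e \<in> carrier (cliff_alg B t) \<Longrightarrow>
      merge_iso B s t (big.tens (gs.t.tens u c) e) = gst.t.tens u (incl c \<otimes>\<^bsub>CW\<^esub> incl e)"
    unfolding merge
    by (subst big.gtens_lift_tens[OF gst.t.T.linear_space_axioms \<gamma>x \<gamma>e]) (auto simp: \<gamma>_tens \<beta>_def)
qed

lemma orthonormal_union: "orthonormal_set B (subspace_sum s t) (set Zs \<union> set Ys)" "set Zs \<inter> set Ys = {}"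
proof -
  note z = gs.Ws_mem(2)[OF s Zs] and y = rt.Ws_mem(2)[OF t Ys]
  have zy: "B e e' = 0" "B e' e = 0" if "e \<in> set Zs" "e' \<in> set Ys" for e e'
    using B_sr[of e e'] z[OF that(1)] y[OF that(2)] t_sub_r B_commute[of e' e] by auto
  show disj: "set Zs \<inter> set Ys = {}"
  proof (rule ccontr)
    assume "set Zs \<inter> set Ys \<noteq> {}"
    then obtain e where "e \<in> set Zs" "e \<in> set Ys" by blast
    then show False using zy(1)[of e e] Z by (auto simp: orthonormal_set_def)
  qed
  have "lie.span (set Zs \<union> set Ys) = subspace_sum s t"
    using Z Y lie.span_Un[of "set Zs" "set Ys"] by (auto simp: orthonormal_set_def subspace_sum_def)
  then show "orthonormal_set B (subspace_sum s t) (set Zs \<union> set Ys)"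
    using Z Y zy disj unfolding orthonormal_set_def by auto
qed

text \<open>Computed in the basis of \<open>s \<oplus> t\<close> that joins the bases of \<open>s\<close> and \<open>t\<close>, the left hand
  side differs from the sum of the operators for these two bases by the cubic terms with exactly
  one entry \<open>y\<close> in \<open>t\<close>. They make up the products of \<open>\<alpha> y\<close> with \<open>y\<close>, where
  \<open>\<alpha> y\<close> is what the diagonal embedding adds to \<open>y\<close>.\<close>

theorem decomposition:
  "cubic_dirac B UNIV b Ws = merge_iso B s t (first_emb B s t D_gr \<oplus>\<^bsub>Big\<^esub> diag_emb B s t Es D_r)"
  unfolding big_simps
proof (rule gst.t.T.dual_separates)
  let ?D = "first_emb B s t D_gr" and ?D' = "diag_emb B s t Es D_r"
  have D: "?D \<in> carrier big.T" using D_gr_closed by (auto simp: first_emb_tens)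
  have D': "?D' \<in> carrier big.T" by (rule linear_map_closed[OF linear_map_diag_emb D_r_closed])
  show "merge_iso B s t (?D \<oplus>\<^bsub>big.T\<^esub> ?D') \<in> carrier gst.t.T"
    using linear_map_closed[OF linear_map_merge] D D' by auto
  show "cubic_dirac B UNIV b Ws \<in> carrier gst.t.T"
    by (rule gst.cubic_dirac_closed[OF st Ws])
  fix \<psi> assume \<psi>: "\<psi> \<in> dual gst.t.T"
  note m = linear_map_dual[OF linear_map_merge \<psi>]
  let ?one = "\<one>\<^bsub>env_alg UNIV\<^esub>" and ?ug = "env_gen UNIV"
  define G where "G u v w = \<psi> (gst.t.tens ?one (cW u \<otimes>\<^bsub>CW\<^esub> cW v \<otimes>\<^bsub>CW\<^esub> cW w))" for u v w
  note \<phi> = gst.dual_tens_right[OF \<psi> gs.U.one_closed]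
  have G: "trilinear_on (subspace_sum s t) G"
    unfolding G_def by (rule gst.trilinear_on_gen[OF \<phi>])
  note zs = gs.Ws_mem(2)[OF s Zs] and es = gs.Ws_mem(2)[OF s Es] and ys = rt.Ws_mem(2)[OF t Ys]
  have sW: "x \<in> s \<Longrightarrow> x \<in> subspace_sum s t" and tW: "x \<in> t \<Longrightarrow> x \<in> subspace_sum s t" for x
    using s_sub t_sub by auto
  define F where "F u v = \<psi> (gst.t.tens (?ug u) (cW v))" for u v
  have F: "bilinear_on (subspace_sum s t) F"
    unfolding F_def by (rule gst.bilinear_on_tens[OF subset_UNIV \<psi>])

  have lhs: "\<psi> (cubic_dirac B UNIV b Ws) = (\<Sum>w\<in>set Zs \<union> set Ys. F w w) - cubic_sum (set Zs \<union> set Ys) G / 12"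
    unfolding gst.dual_cubic_dirac[OF st Ws \<psi>]
    using contraction_basis_independent[OF W orthonormal_union(1) F]
      cubic_sum_basis_independent[OF W orthonormal_union(1) G]
    by (simp add: F_def G_def[abs_def])

  \<comment> \<open>Composed with the maps into \<open>U(g) \<otimes> C(s \<oplus> t)\<close>, the functional becomes a functional on the
    algebra in which each operator is defined.\<close>
  have first: "(\<lambda>x. \<psi> (merge_iso B s t (first_emb B s t x))) \<in> dual gs.t.T"
    unfolding first_emb_tens by (rule linear_map_dual[OF big.linear_tens_left[OF rt.one_closed] m])
  note incl_simps = incl_one[OF s_sub subspace_s] incl_gen[OF s_sub subspace_s] incl_gen3[OF s_sub subspace_s]
    incl_one[OF t_sub subspace_t] incl_gen[OF t_sub subspace_t] incl_gen3[OF t_sub subspace_t]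
  have D_first: "\<psi> (merge_iso B s t ?D) = (\<Sum>w\<in>set Zs. F w w) - cubic_sum (set Zs) G / 12"
    unfolding gs.dual_cubic_dirac[OF s Zs first]
    by (simp add: F_def G_def first_emb_tens merge_tens incl_simps zs sW cubic_sum_def)

  have second: "(\<lambda>x. \<psi> (merge_iso B s t (diag_emb B s t Es x))) \<in> dual rt.t.T"
    by (rule linear_map_dual[OF linear_map_diag_emb m])
  have term1: "\<psi> (merge_iso B s t (diag_emb B s t Es (rt.t.tens (env_gen r y) (cliff_gen B t y))))
      = F y y - (\<Sum>z\<in>set Zs. \<Sum>z'\<in>set Zs. structure_form z z' y * G z z' y) / 4" if "y \<in> set Ys" for y
  proof -
    have y: "y \<in> t" "y \<in> r" using ys[OF that] t_sub_r by auto
    have ad: "lie_bracket y v \<in> s" if "v \<in> s" for v using bracket_rs[OF y(2) that] .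
    have lin: "(\<lambda>x. \<psi> (merge_iso B s t (big.tens x (cliff_gen B t y)))) \<in> dual gs.t.T"
      by (rule linear_map_dual[OF big.linear_tens_left[OF rt.gen_closed[OF y(1)]] m])
    have spin: "(\<lambda>c. \<psi> (gst.t.tens ?one (incl c \<otimes>\<^bsub>CW\<^esub> cW y))) \<in> dual (cliff_alg B s)"
      by (rule linear_map_dual[OF linear_map_incl[OF s_sub subspace_s] gst.dual_left[OF \<phi> gst.gen_closed[OF tW[OF y(1)]]]])
    have "\<psi> (merge_iso B s t (diag_emb B s t Es (rt.t.tens (env_gen r y) (cliff_gen B t y))))
        = \<psi> (merge_iso B s t (big.tens (diag y) (cliff_gen B t y)))"
      using y by (simp add: diag_emb_tens diag_env_gen)
    also have "\<dots> = F y y + \<psi> (gst.t.tens ?one (incl (\<alpha> y) \<otimes>\<^bsub>CW\<^esub> cW y))"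
      unfolding diag_def using y
      by (simp add: dual_add[OF lin] alpha_closed merge_tens incl_simps tW F_def)
    also have "\<psi> (gst.t.tens ?one (incl (\<alpha> y) \<otimes>\<^bsub>CW\<^esub> cW y)) = (\<Sum>e\<in>set Es. G (lie_bracket y e) e y) / 4"
      using gs.dual_alpha[OF Es spin ad] by (simp add: incl_gen2[OF s_sub subspace_s] ad es G_def)
    also have "(\<Sum>e\<in>set Es. G (lie_bracket y e) e y) = (\<Sum>z\<in>set Zs. G (lie_bracket y z) z y)"
    proof (rule contraction_basis_independent[where F = "\<lambda>e e'. G (lie_bracket y e) e' y", OF E Z])
      show "bilinear_on s (\<lambda>e e'. G (lie_bracket y e) e' y)"
        using G ad y by (auto simp: bilinear_on_def trilinear_on_def linear_on_def sW tW bracket_add_right bracket_scaleC_right)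
    qed
    also have "\<dots> = (\<Sum>z'\<in>set Zs. \<Sum>z\<in>set Zs. - (structure_form z z' y * G z z' y))"
    proof (intro sum.cong refl)
      fix z' assume z': "z' \<in> set Zs"
      have "G (lie_bracket y z') z' y = (\<Sum>z\<in>set Zs. B (lie_bracket y z') z * G z z' y)"
      proof (rule linear_on_expand[OF Z _ ad[OF zs[OF z']]])
        show "linear_on s (\<lambda>v. G v z' y)"
          using G z' y by (intro linear_on_mono[OF _ s_sub]) (auto simp: trilinear_on_def sW tW zs)
      qed
      also have "\<dots> = (\<Sum>z\<in>set Zs. - (structure_form z z' y * G z z' y))"
      proof (intro sum.cong refl)
        fix z
        have "B (lie_bracket y z') z = - structure_form z z' y"
          using structure_form_swap(1)[of z' z y] B_invariant[of y z' z] B_commute[of y "lie_bracket z' z"]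
          by (simp add: structure_form_def)
        then show "B (lie_bracket y z') z * G z z' y = - (structure_form z z' y * G z z' y)" by simp
      qed
      finally show "G (lie_bracket y z') z' y = (\<Sum>z\<in>set Zs. - (structure_form z z' y * G z z' y))" .
    qed
    also have "\<dots> = - (\<Sum>z\<in>set Zs. \<Sum>z'\<in>set Zs. structure_form z z' y * G z z' y)"
      by (subst sum.swap) (simp add: sum_negf)
    finally show ?thesis by simp
  qed
  have "merge_iso B s t (diag_emb B s t Es (rt.t.tens \<one>\<^bsub>env_alg r\<^esub> c)) = gst.t.tens ?one (incl c)"
    if "c \<in> carrier (cliff_alg B t)" for c
    using that linear_map_closed[OF linear_map_incl[OF t_sub subspace_t] that]
    by (simp add: diag_emb_tens diag_env_one gs.t.one_T merge_tens incl_simps)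
  then have term3: "\<psi> (merge_iso B s t (diag_emb B s t Es (rt.t.tens \<one>\<^bsub>env_alg r\<^esub>
      (cliff_gen B t u \<otimes>\<^bsub>cliff_alg B t\<^esub> cliff_gen B t v \<otimes>\<^bsub>cliff_alg B t\<^esub> cliff_gen B t w)))) = G u v w"
    if "u \<in> set Ys" "v \<in> set Ys" "w \<in> set Ys" for u v w
    using that by (simp add: G_def incl_simps ys)
  have D_second: "\<psi> (merge_iso B s t ?D') = (\<Sum>y\<in>set Ys. F y y)
      - (\<Sum>y\<in>set Ys. \<Sum>z\<in>set Zs. \<Sum>z'\<in>set Zs. structure_form z z' y * G z z' y) / 4 - cubic_sum (set Ys) G / 12"
    unfolding rt.dual_cubic_dirac[OF t Ys second]
    by (simp add: term1 term3 cubic_sum_def sum_subtractf sum_divide_distrib)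

  have union: "cubic_sum (set Zs \<union> set Ys) G = cubic_sum (set Zs) G + cubic_sum (set Ys) G
    + 3 * (\<Sum>z\<in>set Zs. \<Sum>z'\<in>set Zs. \<Sum>y\<in>set Ys. structure_form z z' y * G z z' y)"
    unfolding G_def
  proof (rule gst.cubic_sum_union[OF \<phi>])
    show "B z y = 0" if "z \<in> set Zs" "y \<in> set Ys" for z y
      using B_sr[of z y] zs[OF that(1)] ys[OF that(2)] t_sub_r by auto
    show "structure_form y y' z = 0" if "y \<in> set Ys" "y' \<in> set Ys" "z \<in> set Zs" for y y' z
      using B_sr[of z "lie_bracket y y'"] bracket_r[of y y'] zs[OF that(3)] ys[OF that(1)] ys[OF that(2)] t_sub_r
        B_commute[of z] by (auto simp: structure_form_def)
  qed (use zs ys sW tW orthonormal_union(2) in auto)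
  have swap: "(\<Sum>y\<in>set Ys. \<Sum>z\<in>set Zs. \<Sum>z'\<in>set Zs. structure_form z z' y * G z z' y)
      = (\<Sum>z\<in>set Zs. \<Sum>z'\<in>set Zs. \<Sum>y\<in>set Ys. structure_form z z' y * G z z' y)"
    by (subst sum.swap) (intro sum.cong refl sum.swap)
  have linear: "(\<Sum>w\<in>set Zs \<union> set Ys. F w w) = (\<Sum>w\<in>set Zs. F w w) + (\<Sum>y\<in>set Ys. F y y)"
    by (rule sum.union_disjoint) (use orthonormal_union(2) in auto)
  show "\<psi> (cubic_dirac B UNIV b Ws) = \<psi> (merge_iso B s t (?D \<oplus>\<^bsub>big.T\<^esub> ?D'))"
    unfolding lhs dual_add[OF m D D'] D_first D_second union swap linear by (simp add: field_simps)
qed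

end

context invariant_form begin

text \<open>Split \<open>x\<close> in \<open>r\<close> as \<open>p + q\<close> with \<open>p\<close> in \<open>r \<inter> r'\<close> and \<open>q\<close> in
  \<open>r \<inter> s'\<close>. If \<open>x\<close> is orthogonal to \<open>r \<inter> r'\<close>, then so is \<open>p\<close>. Since \<open>p\<close> is
  also orthogonal to \<open>s\<close>, it is orthogonal to \<open>r'\<close>, hence zero by nondegeneracy.\<close>

lemma orth_compl_inter_relative:
  assumes r': "lie.subspace r'" "nondegenerate_on B r'"
    and s: "s = orth_compl B UNIV r" and s': "s' = orth_compl B UNIV r'"
    and r_split: "r = subspace_sum (r \<inter> r') (r \<inter> s')"
    and r'_split: "r' = subspace_sum (r' \<inter> r) (r' \<inter> s)"
  shows "orth_compl B r (r \<inter> r') = r \<inter> s'"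
proof
  show "r \<inter> s' \<subseteq> orth_compl B r (r \<inter> r')"
    by (auto simp: s' orth_compl_def)
  show "orth_compl B r (r \<inter> r') \<subseteq> r \<inter> s'"
  proof
    fix x assume x: "x \<in> orth_compl B r (r \<inter> r')"
    then have "x \<in> subspace_sum (r \<inter> r') (r \<inter> s')" using r_split by (auto simp: orth_compl_def)
    then obtain p q where pq: "x = p + q" "p \<in> r" "p \<in> r'" "q \<in> r" "q \<in> s'"
      unfolding subspace_sum_def by blast
    have "B p y = 0" if "y \<in> r'" for y
    proof -
      have "y \<in> subspace_sum (r' \<inter> r) (r' \<inter> s)" using that r'_split by blast
      then obtain y1 y2 where y: "y = y1 + y2" "y1 \<in> r'" "y1 \<in> r" "y2 \<in> s"
        unfolding subspace_sum_def by blast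
      have "B x y1 = 0" "B q y1 = 0" "B y2 p = 0"
        using x y pq by (auto simp: orth_compl_def s s')
      then show ?thesis
        unfolding y(1) by (simp add: pq(1) B_add B_add_right B_commute[of p y2])
    qed
    then have "p = 0" using r'(2) pq by (auto simp: nondegenerate_on_def)
    then show "x \<in> r \<inter> s'" using pq by simp
  qed
qed

lemma orth_compl_subset_split:
  assumes s: "s = orth_compl B UNIV r" and split: "UNIV = subspace_sum r s" and b: "b \<subseteq> r"
  shows "subspace_sum s (orth_compl B r b) = orth_compl B UNIV b"
proof
  show "subspace_sum s (orth_compl B r b) \<subseteq> orth_compl B UNIV b"
    using b by (auto simp: subspace_sum_def orth_compl_def s B_add)
  show "orth_compl B UNIV b \<subseteq> subspace_sum s (orth_compl B r b)"
  proof
    fix x assume x: "x \<in> orth_compl B UNIV b"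
    have "x \<in> subspace_sum r s" using split by blast
    then obtain p q where pq: "x = p + q" "p \<in> r" "q \<in> s" unfolding subspace_sum_def by blast
    have "B p y = 0" if "y \<in> b" for y
    proof -
      have "B (p + q) y = 0" "B q y = 0" using x that b pq by (auto simp: orth_compl_def s)
      then show ?thesis by (simp add: B_add)
    qed
    then have "p \<in> orth_compl B r b" using pq by (simp add: orth_compl_def)
    moreover have "x = q + p" using pq by (simp add: add.commute)
    ultimately show "x \<in> subspace_sum s (orth_compl B r b)" using pq(3) unfolding subspace_sum_def by blast
  qed
qed

end

theorem theorem5p2:
  fixes r s r' s' :: "'g::complex_lie_algebra set"
    and Ws Zs Ys Es :: "'g list"
  assumes "finite_dim (UNIV :: 'g set)" and "semisimple_lie (UNIV :: 'g set)"
    and "lie_subalgebra r" and "reductive_lie r" and "nondegenerate_on killing_form r"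
    and "lie_subalgebra r'" and "reductive_lie r'" and "nondegenerate_on killing_form r'"
    and "s = orth_compl killing_form UNIV r" and "is_direct_sum UNIV r s"
    and "s' = orth_compl killing_form UNIV r'" and "is_direct_sum UNIV r' s'"
    and "is_direct_sum r (r \<inter> r') (r \<inter> s')"
    and "is_direct_sum s (s \<inter> r') (s \<inter> s')"
    and "is_direct_sum r' (r' \<inter> r) (r' \<inter> s)"
    and "is_direct_sum s' (s' \<inter> r) (s' \<inter> s)"
    and "orthonormal_basis killing_form (orth_compl killing_form UNIV (r \<inter> r')) Ws"
    and "orthonormal_basis killing_form (orth_compl killing_form UNIV r) Zs"
    and "orthonormal_basis killing_form (orth_compl killing_form r (r \<inter> r')) Ys"
    and "orthonormal_basis killing_form s Es"
  shows "let Big = big_alg killing_form s (r \<inter> s');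
             D_gr = first_emb killing_form s (r \<inter> s') (cubic_dirac killing_form UNIV r Zs);
             D_Delta = diag_emb killing_form s (r \<inter> s') Es (cubic_dirac killing_form r (r \<inter> r') Ys)
         in cubic_dirac killing_form UNIV (r \<inter> r') Ws
              = merge_iso killing_form s (r \<inter> s') (D_gr \<oplus>\<^bsub>Big\<^esub> D_Delta)
          \<and> D_gr \<otimes>\<^bsub>Big\<^esub> D_Delta \<oplus>\<^bsub>Big\<^esub> D_Delta \<otimes>\<^bsub>Big\<^esub> D_gr = \<zero>\<^bsub>Big\<^esub>"
proof -
  let ?K = "killing_form :: 'g \<Rightarrow> 'g \<Rightarrow> complex"
  interpret invariant_form ?K by (rule invariant_form_killing[OF assms(1)])
  have t: "r \<inter> s' = orth_compl ?K r (r \<inter> r')"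
    by (rule orth_compl_inter_relative[symmetric])
      (use assms in \<open>auto simp: lie_subalgebra_def is_direct_sum_def\<close>)
  have st: "subspace_sum s (r \<inter> s') = orth_compl ?K UNIV (r \<inter> r')"
    unfolding t by (rule orth_compl_subset_split) (use assms in \<open>auto simp: is_direct_sum_def\<close>)
  interpret dirac_pair ?K r s "r \<inter> s'" "r \<inter> r'" Zs Es Ys Ws
    using assms(3,9,17-20) t st by unfold_locales simp_all
  show ?thesis
    using decomposition anticommute by (simp add: Let_def)
qed

end
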